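(* Let $C$ be a random finite simple counting measure on $\mathbb{R}$ with $C(\{0\})=1$ a.s., $\mathrm{supp}(C)\subset[0,\infty)$ a.s., and $\mathbb{E}[C(\mathbb{R})^3]<\infty$. Let $\nu>0$ and, for $\theta\in[-1,1]$, let $N_\theta$ be the stationary Poisson cluster process with immigrant rate $\nu$ obtained by independently flipping each cluster with sign law of bias $\theta$ (defined in the context). Then for every $\theta\in[-1,1]$, $N_\theta$ has intensity $$\lambda=\nu\,\mathbb{E}[C(\mathbb{R})],$$ and the same reduced second factorial cumulant measure (not depending on $\theta$), hence the same full Bartlett spectrum $$\Gamma(\omega)=\nu\,\mathbb{E}|\widehat C(\omega)|^2,\qquad \widehat C(\omega):=\int_{\mathbb{R}}e^{-\mathrm{i}\omega x}\,C(dx).$$ Moreover, $N_{-1}\stackrel{d}{=}RN_1$ and $N_0$ is reversible. If the reduced third factorial cumulant density $c_{3,1}$ of $N_1$ exists and belongs to $L^1(\mathbb{R}^2)$, then, writing $c_{3,\theta}$ for the reduced third factorial cumulant density of $N_\theta$ and $B_\theta$ for its Fourier transform (the factorial bispectrum of $N_\theta$), $$c_{3,-1}(\tau)=c_{3,1}(-\tau)\quad\text{for a.e. }\tau\in\mathbb{R}^2,$$ and $$c_{3,\theta}=c_3^{\mathrm e}+\theta c_3^{\mathrm o},\qquad B_\theta=\operatorname{Re}B_1+\mathrm{i}\,\theta\operatorname{Im}B_1,$$ where $$c_3^{\mathrm e}(\tau):=\tfrac12(c_{3,1}(\tau)+c_{3,1}(-\tau)),\qquad c_3^{\mathrm o}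(\tau):=\tfrac12(c_{3,1}(\tau)-c_{3,1}(-\tau)).$$
   Context: Fourier convention: $\widehat f(\omega)=\int e^{-\mathrm{i}\omega\cdot t}f(t)\,dt$, and likewise for finite signed measures. Construction of $N_\theta$: let $\{U_j\}$ be a homogeneous Poisson process on $\mathbb{R}$ with rate $\nu$, independent of i.i.d. copies $\{C_j\}$ of $C$. Let $\{S_{j,\theta}\}_j$ be i.i.d. signs with $\mathbb{P}(S_{j,\theta}=+1)=\frac{1+\theta}{2}$, $\mathbb{P}(S_{j,\theta}=-1)=\frac{1-\theta}{2}$, independent of $\{U_j,C_j\}_j$. For $s\in\{\pm1\}$ and a counting measure $\mu$ put $(s\mu)(A)=\mu(sA)$, and let $(\vartheta_u\mu)(A)=\mu(A-u)$. Set $N_\theta:=\sum_j\vartheta_{U_j}(S_{j,\theta}C_j)$. With $(RN)(A)=N(-A)$, $N$ is reversible if $N\stackrel{d}{=}RN$. Factorial cumulant measures: $\kappa_n$ is characterized by $\int\prod_jf_j(t_j)\,\kappa_n(dt)=\partial_{s_0}\cdots\partial_{s_{n-1}}\log\mathbb{E}\prod_{x\in N}(1+\sum_js_jf_j(x))|_{s=0}$ for bounded compactly supported $f_0,\dots,f_{n-1}$, interpreted as a finite-order variational derivative at the origin (the standard factorial cumulant measures). For $n\ge2$, the reduced measure is defined by $\int F\,d\kappa_n=\int_{\mathbb{R}}\int_{\mathbb{R}^{n-1}}F(t_0,t_0+\tau_1,\dots,t_0+\tau_{n-1})\,\kappa_n^{\mathrm{red}}(d\tau)\,dt_0$. The full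 Bartlett spectrum is $\Gamma(\omega)=\lambda+\int_{\mathbb{R}}e^{-\mathrm{i}\omega\tau}\kappa_2^{\mathrm{red}}(d\tau)$, i.e. the Fourier transform of the complete reduced covariance measure $\gamma_2^{\mathrm{red}}=\lambda\delta_0+\kappa_2^{\mathrm{red}}$. "Reduced third factorial cumulant density" means the Lebesgue density of $\kappa_3^{\mathrm{red}}$ on $\mathbb{R}^2$. *)

theory Defs
  imports "HOL-Probability.Probability"
begin

section \<open>Random measures on the real line\<close>

text \<open>The space of all Borel measures on the line, with the \<open>\<sigma>\<close>-algebra generated by the
  evaluations \<open>\<mu> \<mapsto> \<mu>(A)\<close>. It is not restricted to locally finite counting measures, because a
  cluster process is locally finite only almost surely.\<close>

definition measure_algebra :: "real measure measure" where
  "measure_algebra =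
     (SUP A \<in> sets borel.
        vimage_algebra {\<mu>. sets \<mu> = sets borel} (\<lambda>\<mu>. emeasure \<mu> A) borel)"

definition locally_finite_counting :: "real measure \<Rightarrow> bool" where
  "locally_finite_counting \<mu> \<longleftrightarrow>
     sets \<mu> = sets borel \<and>
     (\<forall>A\<in>sets borel. bounded A \<longrightarrow> (\<exists>k::nat. emeasure \<mu> A = of_nat k))"

definition finite_simple_counting :: "real measure \<Rightarrow> bool" where
  "finite_simple_counting \<mu> \<longleftrightarrow>
     sets \<mu> = sets borel \<and>
     (\<forall>A\<in>sets borel. \<exists>k::nat. emeasure \<mu> A = of_nat k) \<and>
     (\<forall>x. emeasure \<mu> {x} \<le> 1)"

definition cluster_algebra :: "real measure measure" where
  "cluster_algebra = restrict_space measure_algebra {\<mu>. finite_simple_counting \<mu>}"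

definition superpose :: "(nat \<Rightarrow> real measure) \<Rightarrow> real measure" where
  "superpose \<mu> = measure_of UNIV (sets borel) (\<lambda>A. \<Sum>j. emeasure (\<mu> j) A)"

text \<open>The image measure under \<open>x \<mapsto> x + u\<close> is \<open>A \<mapsto> \<mu>(A - u)\<close>, and for \<open>s = 1\<close> or \<open>s = -1\<close> the image
  measure under \<open>x \<mapsto> s x\<close> is \<open>A \<mapsto> \<mu>(s A)\<close>.\<close>

definition translate :: "real \<Rightarrow> real measure \<Rightarrow> real measure" where
  "translate u \<mu> = distr \<mu> borel (\<lambda>x. x + u)"

definition flip :: "real \<Rightarrow> real measure \<Rightarrow> real measure" where
  "flip s \<mu> = distr \<mu> borel (\<lambda>x. s * x)"

definition same_law :: "'a measure \<Rightarrow> ('a \<Rightarrow> real measure) \<Rightarrow> ('a \<Rightarrow> real measure) \<Rightarrow> bool" where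
  "same_law M X Y \<longleftrightarrow>
     X \<in> measurable M measure_algebra \<and> Y \<in> measurable M measure_algebra \<and>
     distr M measure_algebra X = distr M measure_algebra Y"

definition point_process :: "'a measure \<Rightarrow> ('a \<Rightarrow> real measure) \<Rightarrow> bool" where
  "point_process M N \<longleftrightarrow>
     N \<in> measurable M measure_algebra \<and> (AE \<omega> in M. locally_finite_counting (N \<omega>))"

definition stationary :: "'a measure \<Rightarrow> ('a \<Rightarrow> real measure) \<Rightarrow> bool" where
  "stationary M N \<longleftrightarrow> (\<forall>u. same_law M (\<lambda>\<omega>. translate u (N \<omega>)) N)"

definition reversible :: "'a measure \<Rightarrow> ('a \<Rightarrow> real measure) \<Rightarrow> bool" where
  "reversible M N \<longleftrightarrow> same_law M N (\<lambda>\<omega>. flip (- 1) (N \<omega>))"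

definition has_intensity :: "'a measure \<Rightarrow> ('a \<Rightarrow> real measure) \<Rightarrow> real \<Rightarrow> bool" where
  "has_intensity M N l \<longleftrightarrow>
     0 \<le> l \<and> (\<forall>A\<in>sets borel. (\<integral>\<^sup>+\<omega>. emeasure (N \<omega>) A \<partial>M) = ennreal l * emeasure lborel A)"


section \<open>The Poisson cluster process\<close>

text \<open>Independence of two random elements with values in different types; the library's
  \<open>indep_var\<close> asks for one common value type.\<close>

definition indep_elements ::
  "'a measure \<Rightarrow> 'b measure \<Rightarrow> ('a \<Rightarrow> 'b) \<Rightarrow> 'c measure \<Rightarrow> ('a \<Rightarrow> 'c) \<Rightarrow> bool" where
  "indep_elements M S X T Y \<longleftrightarrow>
     X \<in> measurable M S \<and> Y \<in> measurable M T \<and>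
     prob_space.indep_set M {X -` A \<inter> space M | A. A \<in> sets S} {Y -` B \<inter> space M | B. B \<in> sets T}"

text \<open>A homogeneous Poisson process of rate \<open>\<nu>\<close>, given by an enumeration of its points. For
  \<open>\<nu> > 0\<close> there are almost surely infinitely many points, so the index set is \<open>nat\<close>.\<close>

definition poisson_points :: "'a measure \<Rightarrow> real \<Rightarrow> (nat \<Rightarrow> 'a \<Rightarrow> real) \<Rightarrow> bool" where
  "poisson_points M \<nu> U \<longleftrightarrow>
     (\<forall>j. U j \<in> borel_measurable M) \<and>
     (\<forall>A\<in>sets borel. bounded A \<longrightarrow> (\<forall>k::nat.
        measure M {\<omega> \<in> space M. emeasure (superpose (\<lambda>j. return borel (U j \<omega>))) A = of_nat k} =
        (\<nu> * measure lborel A) ^ k / fact k * exp (- (\<nu> * measure lborel A)))) \<and>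
     (\<forall>(I::nat set) A. finite I \<longrightarrow> disjoint_family_on A I \<longrightarrow>
        (\<forall>i\<in>I. A i \<in> sets borel \<and> bounded (A i)) \<longrightarrow>
        prob_space.indep_vars M (\<lambda>_. borel)
          (\<lambda>i \<omega>. emeasure (superpose (\<lambda>j. return borel (U j \<omega>))) (A i)) I)"

definition cluster_process ::
  "(nat \<Rightarrow> 'a \<Rightarrow> real) \<Rightarrow> (nat \<Rightarrow> 'a \<Rightarrow> real measure) \<Rightarrow> (nat \<Rightarrow> 'a \<Rightarrow> real) \<Rightarrow> 'a \<Rightarrow> real measure"
where
  "cluster_process U K S \<omega> = superpose (\<lambda>j. translate (U j \<omega>) (flip (S j \<omega>) (K j \<omega>)))"


section \<open>Factorial cumulant measures\<close>

text \<open>A locally finite signed measure is given by a pair of locally finite measures, of which it is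
  the difference.\<close>

type_synonym 'b signed_measure = "'b measure \<times> 'b measure"

definition signed_integral :: "'b signed_measure \<Rightarrow> ('b \<Rightarrow> real) \<Rightarrow> real" where
  "signed_integral \<kappa> f = (\<integral>x. f x \<partial>fst \<kappa>) - (\<integral>x. f x \<partial>snd \<kappa>)"

text \<open>The product of \<open>h\<close> over the points of a locally finite counting measure, with multiplicity. It
  is finite when \<open>h - 1\<close> has bounded support. For other measures, which a point process takes as
  values with probability zero only, it is set to \<open>1\<close>.\<close>

definition point_product :: "real measure \<Rightarrow> (real \<Rightarrow> real) \<Rightarrow> real" where
  "point_product \<mu> h =
     (if locally_finite_counting \<mu>
      then \<Prod>x | emeasure \<mu> {x} \<noteq> 0 \<and> h x \<noteq> 1. h x ^ nat \<lfloor>measure \<mu> {x}\<rfloor>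
      else 1)"

definition log_pgfl ::
  "'a measure \<Rightarrow> ('a \<Rightarrow> real measure) \<Rightarrow> nat \<Rightarrow> (nat \<Rightarrow> real \<Rightarrow> real) \<Rightarrow> (nat \<Rightarrow> real) \<Rightarrow> real" where
  "log_pgfl M N n f s = ln (\<integral>\<omega>. point_product (N \<omega>) (\<lambda>x. 1 + (\<Sum>j<n. s j * f j x)) \<partial>M)"

text \<open>\<open>mixed_left_deriv n L s D\<close>: the iterated partial derivative of \<open>L\<close> in the variables
  \<open>0, \<dots>, n - 1\<close>, each taken from the left at \<open>0\<close>, exists and equals \<open>D\<close>; the variables from \<open>n\<close> on
  are held at their values in \<open>s\<close>.\<close>

primrec mixed_left_deriv :: "nat \<Rightarrow> ((nat \<Rightarrow> real) \<Rightarrow> real) \<Rightarrow> (nat \<Rightarrow> real) \<Rightarrow> real \<Rightarrow> bool" where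
  "mixed_left_deriv 0 L s D \<longleftrightarrow> L s = D"
| "mixed_left_deriv (Suc k) L s D \<longleftrightarrow>
     (\<exists>G \<epsilon>. 0 < \<epsilon> \<and> (\<forall>x\<in>{-\<epsilon><..0}. mixed_left_deriv k L (s(k := x)) (G x)) \<and>
        (G has_real_derivative D) (at 0 within {..0}))"

definition test_function :: "(real \<Rightarrow> real) \<Rightarrow> bool" where
  "test_function f \<longleftrightarrow>
     f \<in> borel_measurable borel \<and> (\<exists>B. \<forall>x. 0 \<le> f x \<and> f x \<le> B) \<and> bounded {x. f x \<noteq> 0}"

text \<open>The defining identity of \<open>\<kappa>\<^sub>n\<close>. Without exponential moments the generating functional need not
  be finite for factors exceeding \<open>1\<close>, so the derivative at the origin is taken along nonnegative
  test functions with nonpositive parameters, where every factor is in \<open>[0,1]\<close>. Both sides are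
  multilinear in the test functions, so this fixes the identity for signed test functions, too.\<close>

definition factorial_cumulant ::
  "'a measure \<Rightarrow> ('a \<Rightarrow> real measure) \<Rightarrow> nat \<Rightarrow> (nat \<Rightarrow> real) signed_measure \<Rightarrow> bool" where
  "factorial_cumulant M N n \<kappa> \<longleftrightarrow>
     (\<forall>\<rho>\<in>{fst \<kappa>, snd \<kappa>}. sets \<rho> = sets (PiM {..<n} (\<lambda>_. borel)) \<and>
        (\<forall>r. emeasure \<rho> {t \<in> space \<rho>. \<forall>i<n. \<bar>t i\<bar> \<le> r} < \<infinity>)) \<and>
     (\<forall>f. (\<forall>j<n. test_function (f j)) \<longrightarrow>
        mixed_left_deriv n (log_pgfl M N n f) (\<lambda>_. 0)
          (signed_integral \<kappa> (\<lambda>t. \<Prod>j<n. f j (t j))))"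

text \<open>The reduced measure lives on a Euclidean space \<open>'v\<close> playing the role of \<open>\<real>\<^sup>n\<^sup>-\<^sup>1\<close>, whose
  coordinates \<open>\<tau>\<^sub>1, \<dots>, \<tau>\<^sub>n\<^sub>-\<^sub>1\<close> are \<open>e \<tau> 1, \<dots>, e \<tau> (n - 1)\<close>.\<close>

definition reduced_measure ::
  "nat \<Rightarrow> ('v::euclidean_space \<Rightarrow> nat \<Rightarrow> real) \<Rightarrow>
     (nat \<Rightarrow> real) signed_measure \<Rightarrow> 'v signed_measure \<Rightarrow> bool" where
  "reduced_measure n e \<kappa> \<rho> \<longleftrightarrow>
     (\<forall>\<sigma>\<in>{fst \<rho>, snd \<rho>}. sets \<sigma> = sets borel \<and> (\<forall>r. emeasure \<sigma> (cball 0 r) < \<infinity>)) \<and>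
     (\<forall>F\<in>borel_measurable (PiM {..<n} (\<lambda>_. borel)).
        bounded (range F) \<longrightarrow> (\<exists>r. \<forall>t. F t \<noteq> 0 \<longrightarrow> (\<forall>i<n. \<bar>t i\<bar> \<le> r)) \<longrightarrow>
        signed_integral \<kappa> F =
          (\<integral>t\<^sub>0. signed_integral \<rho> (\<lambda>\<tau>. F (\<lambda>i\<in>{..<n}. if i = 0 then t\<^sub>0 else t\<^sub>0 + e \<tau> i)) \<partial>lborel))"

definition reduced_cumulant2 ::
  "'a measure \<Rightarrow> ('a \<Rightarrow> real measure) \<Rightarrow> real signed_measure \<Rightarrow> bool" where
  "reduced_cumulant2 M N \<rho> \<longleftrightarrow>
     (\<exists>\<kappa>. factorial_cumulant M N 2 \<kappa> \<and> reduced_measure 2 (\<lambda>\<tau> i. \<tau>) \<kappa> \<rho>)"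

definition reduced_cumulant3 ::
  "'a measure \<Rightarrow> ('a \<Rightarrow> real measure) \<Rightarrow> (real \<times> real) signed_measure \<Rightarrow> bool" where
  "reduced_cumulant3 M N \<rho> \<longleftrightarrow>
     (\<exists>\<kappa>. factorial_cumulant M N 3 \<kappa> \<and>
        reduced_measure 3 (\<lambda>\<tau> i. if i = 1 then fst \<tau> else snd \<tau>) \<kappa> \<rho>)"

text \<open>As \<open>ennreal\<close> sends negative numbers to \<open>0\<close>, the two components are the measures with densities
  \<open>c\<^sup>+\<close> and \<open>c\<^sup>-\<close>.\<close>

definition reduced_cumulant_density3 ::
  "'a measure \<Rightarrow> ('a \<Rightarrow> real measure) \<Rightarrow> (real \<times> real \<Rightarrow> real) \<Rightarrow> bool" where
  "reduced_cumulant_density3 M N c \<longleftrightarrow>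
     c \<in> borel_measurable borel \<and>
     reduced_cumulant3 M N
       (density lborel (\<lambda>\<tau>. ennreal (c \<tau>)), density lborel (\<lambda>\<tau>. ennreal (- c \<tau>)))"


section \<open>Fourier transforms\<close>

definition fourier_measure :: "'v::euclidean_space measure \<Rightarrow> 'v \<Rightarrow> complex" where
  "fourier_measure \<mu> w = (\<integral>x. exp (- (\<i> * complex_of_real (w \<bullet> x))) \<partial>\<mu>)"

definition fourier :: "('v::euclidean_space \<Rightarrow> real) \<Rightarrow> 'v \<Rightarrow> complex" where
  "fourier f w = (\<integral>x. exp (- (\<i> * complex_of_real (w \<bullet> x))) * complex_of_real (f x) \<partial>lborel)"

definition bartlett_spectrum ::
  "'a measure \<Rightarrow> ('a \<Rightarrow> real measure) \<Rightarrow> (real \<Rightarrow> complex) \<Rightarrow> bool" where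
  "bartlett_spectrum M N \<Gamma> \<longleftrightarrow>
     (\<exists>l \<rho>. has_intensity M N l \<and> reduced_cumulant2 M N \<rho> \<and>
        finite_measure (fst \<rho>) \<and> finite_measure (snd \<rho>) \<and>
        (\<forall>w. \<Gamma> w = complex_of_real l + (fourier_measure (fst \<rho>) w - fourier_measure (snd \<rho>) w)))"

end

theory Submission imports Defs begin

text \<open>Write \<open>p = (1 + \<theta>) / 2\<close> and \<open>q = (1 - \<theta>) / 2\<close>. Integrating out the Poisson process and the signs
  turns the Laplace functional of \<open>N\<^sub>\<theta>\<close> at \<open>g\<close> into \<open>exp (- \<nu> (p \<Lambda> g + q \<Lambda> (g \<circ> uminus)))\<close>, where \<open>\<Lambda>\<close>
  depends only on the law of \<open>C\<close>. Laplace functionals determine laws, which gives the two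
  distributional identities. It also shows that the logarithm of the probability generating
  functional of \<open>N\<^sub>\<theta>\<close> is the mixture, with weights \<open>p\<close> and \<open>q\<close>, of that of \<open>N\<^sub>1\<close> and of its
  reflection, and so are all factorial cumulant measures. The reduced second one, the mean number of
  differences \<open>y - x\<close> over ordered pairs of distinct points of \<open>C\<close>, is invariant under reflection, so
  the mixture does not depend on \<open>\<theta>\<close>. For third-order densities the mixture is
  \<open>p c\<^sub>1(\<tau>) + q c\<^sub>1(-\<tau>)\<close>, whose even and odd parts carry the factors \<open>1\<close> and \<open>\<theta>\<close>; reflection
  conjugates the Fourier transform.\<close>

section \<open>Kernels and mixtures of measures\<close>

text \<open>Two obstacles shape the development. A cluster process is locally finite only almost
  surely, so random measures range over all Borel measures and Laplace functionals must allow
  infinite values. Only polynomial moments of the cluster size are available, so generating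
  functionals are used for factors in [1/2, 1] and every one-sided derivative is justified by
  dominated convergence.

  Signs and clusters are averaged out first, for fixed immigrants. What remains is a product of
  factors in [0, 1] over the immigrants, and writing each factor as \<open>eneg\<close> of its
  negative logarithm gives a Laplace functional of the Poisson process itself.

  The second cumulant has to be shown to exist, so it is computed. The third is never computed: for
  \<theta> = 1 the reflected part of the mixture has weight zero, so the assumed density yields the
  derivatives of the underlying rate for all test functions, reflected ones included, and these
  supply every other \<theta>. As a density is any function satisfying the defining identity, its
  uniqueness almost everywhere has to be proved as well.\<close>

lemma borel_measurable_nn_integral_kernel:
  assumes sets: "\<And>t. t \<in> space T \<Longrightarrow> sets (k t) = sets N"
    and meas: "\<And>A. A \<in> sets N \<Longrightarrow> (\<lambda>t. emeasure (k t) A) \<in> borel_measurable T"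
    and f: "f \<in> borel_measurable N"
  shows "(\<lambda>t. \<integral>\<^sup>+x. f x \<partial>k t) \<in> borel_measurable T"
  using f
proof (induction rule: borel_measurable_induct)
  case (cong f g)
  have "(\<integral>\<^sup>+x. f x \<partial>k t) = (\<integral>\<^sup>+x. g x \<partial>k t)" if "t \<in> space T" for t
    using cong sets_eq_imp_space_eq[OF sets[OF that]] by (intro nn_integral_cong) auto
  with cong show ?case by (simp cong: measurable_cong)
next
  case (set A)
  have "(\<integral>\<^sup>+x. indicator A x \<partial>k t) = emeasure (k t) A" if "t \<in> space T" for t
    using set sets[OF that] by simp
  with meas[OF set] show ?case by (simp cong: measurable_cong)
next
  case (mult u c)
  have "u \<in> borel_measurable (k t)" if "t \<in> space T" for t
    using mult sets[OF that] by (simp cong: measurable_cong_sets)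
  then have "(\<integral>\<^sup>+x. c * u x \<partial>k t) = c * (\<integral>\<^sup>+x. u x \<partial>k t)" if "t \<in> space T" for t
    using that by (intro nn_integral_cmult) auto
  with mult show ?case by (simp cong: measurable_cong)
next
  case (add u v)
  have "u \<in> borel_measurable (k t)" "v \<in> borel_measurable (k t)" if "t \<in> space T" for t
    using add sets[OF that] by (simp_all cong: measurable_cong_sets)
  then have "(\<integral>\<^sup>+x. v x + u x \<partial>k t) = (\<integral>\<^sup>+x. v x \<partial>k t) + (\<integral>\<^sup>+x. u x \<partial>k t)" if "t \<in> space T" for t
    using that by (intro nn_integral_add) auto
  with add show ?case by (simp cong: measurable_cong)
next
  case (seq U)
  have "U i \<in> borel_measurable (k t)" if "t \<in> space T" for t i
    using seq sets[OF that] by (simp cong: measurable_cong_sets)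
  then have "(\<integral>\<^sup>+x. (SUP i. U i x) \<partial>k t) = (SUP i. \<integral>\<^sup>+x. U i x \<partial>k t)" if "t \<in> space T" for t
    using that seq by (intro nn_integral_monotone_convergence_SUP) auto
  moreover have "(SUP i. U i) = (\<lambda>x. SUP i. U i x)" by (auto simp: fun_eq_iff image_comp)
  ultimately show ?case using seq by (simp cong: measurable_cong)
qed

text \<open>A Dynkin argument on rectangles. Finiteness of \<open>k t\<close> enters at complements,
  whose measure is a difference from the total mass.\<close>

lemma borel_measurable_emeasure_finite_kernel:
  assumes sets: "\<And>t. t \<in> space T \<Longrightarrow> sets (k t) = sets N"
    and fin: "\<And>t. t \<in> space T \<Longrightarrow> finite_measure (k t)"
    and meas: "\<And>A. A \<in> sets N \<Longrightarrow> (\<lambda>t. emeasure (k t) A) \<in> borel_measurable T"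
    and Q: "Q \<in> sets (T \<Otimes>\<^sub>M N)"
  shows "(\<lambda>t. emeasure (k t) (Pair t -` Q)) \<in> borel_measurable T"
proof -
  have *: "{a \<times> b |a b. a \<in> sets T \<and> b \<in> sets N} \<subseteq> Pow (space T \<times> space N)"
    using sets.space_closed[of T] sets.space_closed[of N] by fast
  have "Q \<in> sigma_sets (space T \<times> space N) {a \<times> b |a b. a \<in> sets T \<and> b \<in> sets N}"
    using Q by (simp add: sets_pair_measure)
  from Int_stable_pair_measure_generator * this show ?thesis
  proof (induction rule: sigma_sets_induct_disjoint)
    case (basic A)
    then obtain a b where ab: "A = a \<times> b" "a \<in> sets T" "b \<in> sets N" by auto
    have "(\<lambda>t. emeasure (k t) (Pair t -` A)) = (\<lambda>t. if t \<in> a then emeasure (k t) b else 0)"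
      using ab by (auto simp: fun_eq_iff)
    then show ?case using ab meas[OF ab(3)] by (auto intro!: measurable_If_set)
  next
    case empty
    then show ?case by simp
  next
    case (compl A)
    then have A: "A \<in> sets (T \<Otimes>\<^sub>M N)" by (simp add: sets_pair_measure)
    have "emeasure (k t) (Pair t -` (space T \<times> space N - A)) =
        emeasure (k t) (space N) - emeasure (k t) (Pair t -` A)" if t: "t \<in> space T" for t
    proof -
      interpret finite_measure "k t" by (rule fin[OF t])
      have "Pair t -` (space T \<times> space N - A) = space N - Pair t -` A" using t by auto
      moreover have "Pair t -` A \<in> sets (k t)" using sets_Pair1[OF A] sets[OF t] by auto
      moreover have "space N = space (k t)" using sets_eq_imp_space_eq[OF sets[OF t]] by simp
      ultimately show ?thesis by (simp add: emeasure_compl)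
    qed
    moreover have "(\<lambda>t. emeasure (k t) (space N) - emeasure (k t) (Pair t -` A)) \<in> borel_measurable T"
      using compl meas by auto
    ultimately show ?case by (simp cong: measurable_cong)
  next
    case (union F)
    then have F: "F i \<in> sets (T \<Otimes>\<^sub>M N)" for i by (auto simp: sets_pair_measure)
    have "emeasure (k t) (Pair t -` (\<Union>i. F i)) = (\<Sum>i. emeasure (k t) (Pair t -` F i))"
      if t: "t \<in> space T" for t
    proof -
      have "range (\<lambda>i. Pair t -` F i) \<subseteq> sets (k t)" using sets_Pair1[OF F] sets[OF t] by auto
      moreover have "disjoint_family (\<lambda>i. Pair t -` F i)"
        using union(1) by (auto simp: disjoint_family_on_def)
      ultimately show ?thesis by (simp add: suminf_emeasure vimage_UN)
    qed
    with union show ?case by (simp cong: measurable_cong)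
  qed
qed

text \<open>The dependence of the integrand on t is removed by pushing \<open>k t\<close> forward
  along \<open>Pair t\<close>: this gives a kernel into the product space, against which one fixed
  function is integrated.\<close>

lemma borel_measurable_nn_integral_finite_kernel:
  assumes sets: "\<And>t. t \<in> space T \<Longrightarrow> sets (k t) = sets N"
    and fin: "\<And>t. t \<in> space T \<Longrightarrow> finite_measure (k t)"
    and meas: "\<And>A. A \<in> sets N \<Longrightarrow> (\<lambda>t. emeasure (k t) A) \<in> borel_measurable T"
    and f: "(\<lambda>(t, x). f t x) \<in> borel_measurable (T \<Otimes>\<^sub>M N)"
  shows "(\<lambda>t. \<integral>\<^sup>+x. f t x \<partial>k t) \<in> borel_measurable T"
proof -
  define k' where "k' t = distr (k t) (T \<Otimes>\<^sub>M N) (Pair t)" for t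
  have Pair: "Pair t \<in> measurable (k t) (T \<Otimes>\<^sub>M N)" if "t \<in> space T" for t
    using that measurable_Pair1'[OF that, of N] sets[OF that] by (simp cong: measurable_cong_sets)
  have em: "emeasure (k' t) Q = emeasure (k t) (Pair t -` Q)"
    if "t \<in> space T" "Q \<in> sets (T \<Otimes>\<^sub>M N)" for t Q
  proof -
    have "Pair t -` Q \<subseteq> space (k t)"
      using sets.sets_into_space[OF that(2)] sets_eq_imp_space_eq[OF sets[OF that(1)]]
      by (auto simp: space_pair_measure)
    then show ?thesis unfolding k'_def by (simp add: emeasure_distr Pair that Int_absorb2)
  qed
  have "(\<lambda>t. \<integral>\<^sup>+z. (\<lambda>(t, x). f t x) z \<partial>k' t) \<in> borel_measurable T"
  proof (rule borel_measurable_nn_integral_kernel[OF _ _ f])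
    show "sets (k' t) = sets (T \<Otimes>\<^sub>M N)" for t by (simp add: k'_def)
    show "(\<lambda>t. emeasure (k' t) A) \<in> borel_measurable T" if "A \<in> sets (T \<Otimes>\<^sub>M N)" for A
      using borel_measurable_emeasure_finite_kernel[OF sets fin meas that] em that
      by (simp cong: measurable_cong)
  qed
  moreover have "(\<integral>\<^sup>+z. (\<lambda>(t, x). f t x) z \<partial>k' t) = (\<integral>\<^sup>+x. f t x \<partial>k t)" if "t \<in> space T" for t
    using f by (simp add: k'_def nn_integral_distr Pair that)
  ultimately show ?thesis by (simp cong: measurable_cong)
qed

text \<open>The components may have infinite mass. Superposition, with counting measure as
  \<open>T\<close>, and averaging over clusters, with a probability as \<open>T\<close>, are both
  instances. Through \<open>measure_of\<close> the sigma-algebra is known before additivity of the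
  set function is.\<close>

definition mixture :: "'a measure \<Rightarrow> ('a \<Rightarrow> 'b::topological_space measure) \<Rightarrow> 'b measure" where
  "mixture T k = measure_of UNIV (sets borel) (\<lambda>A. \<integral>\<^sup>+t. emeasure (k t) A \<partial>T)"

lemma sets_mixture [simp, measurable_cong]: "sets (mixture T k) = sets borel"
  and space_mixture [simp]: "space (mixture T k) = UNIV"
  by (auto simp: mixture_def sets_measure_of_conv space_measure_of_conv
      sets.sigma_sets_eq[of borel, simplified])

lemma emeasure_mixture:
  assumes sets: "\<And>t. t \<in> space T \<Longrightarrow> sets (k t) = sets borel"
    and meas: "\<And>A. A \<in> sets borel \<Longrightarrow> (\<lambda>t. emeasure (k t) A) \<in> borel_measurable T"
    and A: "A \<in> sets borel"
  shows "emeasure (mixture T k) A = (\<integral>\<^sup>+t. emeasure (k t) A \<partial>T)"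
proof (rule emeasure_measure_of[OF mixture_def])
  show "countably_additive (sets (mixture T k)) (\<lambda>A. \<integral>\<^sup>+t. emeasure (k t) A \<partial>T)"
  proof (rule countably_additiveI)
    fix B :: "nat \<Rightarrow> 'b set"
    assume B: "range B \<subseteq> sets (mixture T k)" "disjoint_family B"
    then have Bi: "B i \<in> sets borel" for i by auto
    have "(\<Sum>i. \<integral>\<^sup>+t. emeasure (k t) (B i) \<partial>T) = (\<integral>\<^sup>+t. (\<Sum>i. emeasure (k t) (B i)) \<partial>T)"
      by (rule nn_integral_suminf[symmetric]) (use meas Bi in auto)
    also have "\<dots> = (\<integral>\<^sup>+t. emeasure (k t) (\<Union>i. B i) \<partial>T)"
    proof (rule nn_integral_cong)
      fix t assume "t \<in> space T"
      then show "(\<Sum>i. emeasure (k t) (B i)) = emeasure (k t) (\<Union>i. B i)"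
        using B sets by (intro suminf_emeasure) auto
    qed
    finally show "(\<Sum>i. \<integral>\<^sup>+t. emeasure (k t) (B i) \<partial>T) = (\<integral>\<^sup>+t. emeasure (k t) (\<Union>i. B i) \<partial>T)" .
  qed
qed (use A in \<open>auto simp: positive_def\<close>)

lemma nn_integral_mixture:
  assumes sets: "\<And>t. t \<in> space T \<Longrightarrow> sets (k t) = sets borel"
    and meas: "\<And>A. A \<in> sets borel \<Longrightarrow> (\<lambda>t. emeasure (k t) A) \<in> borel_measurable T"
    and f: "f \<in> borel_measurable borel"
  shows "(\<integral>\<^sup>+x. f x \<partial>mixture T k) = (\<integral>\<^sup>+t. (\<integral>\<^sup>+x. f x \<partial>k t) \<partial>T)"
  using f
proof (induction rule: borel_measurable_induct)
  case (cong f g)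
  then have "f = g" by (auto simp: fun_eq_iff)
  with cong show ?case by simp
next
  case (set A)
  have "(\<integral>\<^sup>+t. (\<integral>\<^sup>+x. indicator A x \<partial>k t) \<partial>T) = (\<integral>\<^sup>+t. emeasure (k t) A \<partial>T)"
    using set sets by (intro nn_integral_cong) simp
  with set show ?case by (simp add: emeasure_mixture[OF sets meas])
next
  case (mult u c)
  have u: "u \<in> borel_measurable (k t)" if "t \<in> space T" for t
    using mult sets[OF that] by (simp cong: measurable_cong_sets)
  have "(\<integral>\<^sup>+t. (\<integral>\<^sup>+x. c * u x \<partial>k t) \<partial>T) = (\<integral>\<^sup>+t. c * (\<integral>\<^sup>+x. u x \<partial>k t) \<partial>T)"
    by (intro nn_integral_cong nn_integral_cmult u)
  also have "\<dots> = c * (\<integral>\<^sup>+t. (\<integral>\<^sup>+x. u x \<partial>k t) \<partial>T)"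
    by (intro nn_integral_cmult borel_measurable_nn_integral_kernel[OF sets meas] mult)
  finally show ?case using mult by (simp add: nn_integral_cmult)
next
  case (add u v)
  have uv: "u \<in> borel_measurable (k t)" "v \<in> borel_measurable (k t)" if "t \<in> space T" for t
    using add sets[OF that] by (simp_all cong: measurable_cong_sets)
  have "(\<integral>\<^sup>+t. (\<integral>\<^sup>+x. v x + u x \<partial>k t) \<partial>T) = (\<integral>\<^sup>+t. (\<integral>\<^sup>+x. v x \<partial>k t) + (\<integral>\<^sup>+x. u x \<partial>k t) \<partial>T)"
    by (intro nn_integral_cong nn_integral_add uv)
  also have "\<dots> = (\<integral>\<^sup>+t. (\<integral>\<^sup>+x. v x \<partial>k t) \<partial>T) + (\<integral>\<^sup>+t. (\<integral>\<^sup>+x. u x \<partial>k t) \<partial>T)"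
    by (intro nn_integral_add borel_measurable_nn_integral_kernel[OF sets meas] add)
  finally show ?case using add by (simp add: nn_integral_add)
next
  case (seq U)
  have U: "U i \<in> borel_measurable (k t)" if "t \<in> space T" for t i
    using seq sets[OF that] by (simp cong: measurable_cong_sets)
  have S: "(SUP i. U i) = (\<lambda>x. SUP i. U i x)" by (auto simp: fun_eq_iff image_comp)
  have "(\<integral>\<^sup>+t. (\<integral>\<^sup>+x. (SUP i. U i x) \<partial>k t) \<partial>T) = (\<integral>\<^sup>+t. (SUP i. \<integral>\<^sup>+x. U i x \<partial>k t) \<partial>T)"
    using U seq by (intro nn_integral_cong nn_integral_monotone_convergence_SUP) auto
  also have "\<dots> = (SUP i. \<integral>\<^sup>+t. (\<integral>\<^sup>+x. U i x \<partial>k t) \<partial>T)"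
    using seq by (intro nn_integral_monotone_convergence_SUP
        borel_measurable_nn_integral_kernel[OF sets meas])
      (auto simp: incseq_def le_fun_def intro!: nn_integral_mono)
  also have "\<dots> = (SUP i. \<integral>\<^sup>+x. U i x \<partial>mixture T k)" using seq by simp
  also have "\<dots> = (\<integral>\<^sup>+x. (SUP i. U i x) \<partial>mixture T k)"
    using seq by (intro nn_integral_monotone_convergence_SUP[symmetric])
      (auto cong: measurable_cong_sets)
  finally show ?case by (simp add: S)
qed

lemma superpose_eq_mixture: "superpose \<mu> = mixture (count_space UNIV) \<mu>"
  by (simp add: superpose_def mixture_def nn_integral_count_space_nat)

lemma sets_superpose [simp, measurable_cong]: "sets (superpose \<mu>) = sets borel"
  by (simp_all add: superpose_eq_mixture)

lemma emeasure_superpose: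
  assumes "\<And>j. sets (\<mu> j) = sets borel" "A \<in> sets borel"
  shows "emeasure (superpose \<mu>) A = (\<Sum>j. emeasure (\<mu> j) A)"
  using assms by (simp add: superpose_eq_mixture emeasure_mixture nn_integral_count_space_nat)

lemma nn_integral_superpose:
  assumes "\<And>j. sets (\<mu> j) = sets borel" "f \<in> borel_measurable borel"
  shows "(\<integral>\<^sup>+x. f x \<partial>superpose \<mu>) = (\<Sum>j. \<integral>\<^sup>+x. f x \<partial>\<mu> j)"
  using assms by (simp add: superpose_eq_mixture nn_integral_mixture nn_integral_count_space_nat)

section \<open>The spaces of measures and of clusters\<close>

lemma space_measure_algebra: "space measure_algebra = {\<mu>. sets \<mu> = sets borel}"
  unfolding measure_algebra_def by (subst space_Sup_eq_UN) auto

lemma sets_measure_algebraD: "\<mu> \<in> space measure_algebra \<Longrightarrow> sets \<mu> = sets borel"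
  by (simp add: space_measure_algebra)

lemma measurable_emeasure_measure_algebra:
  assumes "A \<in> sets borel"
  shows "(\<lambda>\<mu>. emeasure \<mu> A) \<in> borel_measurable measure_algebra"
  unfolding measure_algebra_def
  by (rule measurable_Sup1[OF imageI[OF assms] measurable_vimage_algebra1]) auto

text \<open>The universal property of the supremum of initial algebras: measurability is tested on
  evaluations.\<close>

lemma measurable_measure_algebraI:
  assumes "\<And>t. t \<in> space T \<Longrightarrow> sets (k t) = sets borel"
    and "\<And>A. A \<in> sets borel \<Longrightarrow> (\<lambda>t. emeasure (k t) A) \<in> borel_measurable T"
  shows "k \<in> measurable T measure_algebra"
  unfolding measure_algebra_def
  by (rule measurable_SUP2) (use assms in \<open>auto intro!: measurable_vimage_algebra2\<close>)

lemma measurable_nn_integral_measure_algebra: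
  assumes "g \<in> borel_measurable borel"
  shows "(\<lambda>\<mu>. \<integral>\<^sup>+x. g x \<partial>\<mu>) \<in> borel_measurable measure_algebra"
  by (rule borel_measurable_nn_integral_kernel[OF _ _ assms])
    (auto simp: sets_measure_algebraD measurable_emeasure_measure_algebra)

lemma space_cluster_algebra: "space cluster_algebra = {\<mu>. finite_simple_counting \<mu>}"
  by (auto simp: cluster_algebra_def space_restrict_space space_measure_algebra
      finite_simple_counting_def)

lemma measurable_emeasure_cluster_algebra:
  "A \<in> sets borel \<Longrightarrow> (\<lambda>\<mu>. emeasure \<mu> A) \<in> borel_measurable cluster_algebra"
  unfolding cluster_algebra_def
  by (rule measurable_restrict_space1[OF measurable_emeasure_measure_algebra])

lemma sets_finite_simple_counting: "finite_simple_counting \<mu> \<Longrightarrow> sets \<mu> = sets borel"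
  by (simp add: finite_simple_counting_def)

lemma finite_measure_finite_simple_counting:
  assumes "finite_simple_counting \<mu>" shows "finite_measure \<mu>"
proof
  have "space \<mu> = UNIV"
    using sets_eq_imp_space_eq[OF sets_finite_simple_counting[OF assms]] by simp
  moreover have "\<forall>A\<in>sets borel. \<exists>k::nat. emeasure \<mu> A = of_nat k"
    using assms by (simp add: finite_simple_counting_def)
  then have "\<exists>k::nat. emeasure \<mu> UNIV = of_nat k" by (rule bspec) simp
  ultimately show "emeasure \<mu> (space \<mu>) \<noteq> \<infinity>" by auto
qed

text \<open>Clusters have finite total mass, which admits integrands that depend on the parameter as
  well. This is how random shifts and signs are moved from the measure into the integrand.\<close>

lemma measurable_nn_integral_cluster:
  assumes K: "K \<in> measurable T cluster_algebra"
    and f: "(\<lambda>(t, x). f t x) \<in> borel_measurable (T \<Otimes>\<^sub>M borel)"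
  shows "(\<lambda>t. \<integral>\<^sup>+x. f t x \<partial>K t) \<in> borel_measurable T"
proof (rule borel_measurable_nn_integral_finite_kernel[OF _ _ _ f])
  have "finite_simple_counting (K t)" if "t \<in> space T" for t
    using measurable_space[OF K that] by (simp add: space_cluster_algebra)
  then show "sets (K t) = sets borel" "finite_measure (K t)" if "t \<in> space T" for t
    using that sets_finite_simple_counting finite_measure_finite_simple_counting by auto
  show "(\<lambda>t. emeasure (K t) A) \<in> borel_measurable T" if "A \<in> sets borel" for A
    by (rule measurable_compose[OF K measurable_emeasure_cluster_algebra[OF that]])
qed

section \<open>Translation and reflection of measures\<close>

lemma sets_translate [simp, measurable_cong]: "sets (translate u \<mu>) = sets borel"
  and sets_flip [simp, measurable_cong]: "sets (flip s \<mu>) = sets borel"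
  by (simp_all add: translate_def flip_def)

lemma nn_integral_translate:
  assumes "sets \<mu> = sets borel" "g \<in> borel_measurable borel"
  shows "(\<integral>\<^sup>+x. g x \<partial>translate u \<mu>) = (\<integral>\<^sup>+x. g (x + u) \<partial>\<mu>)"
  using assms unfolding translate_def
  by (subst nn_integral_distr) (auto cong: measurable_cong_sets)

lemma nn_integral_flip:
  assumes "sets \<mu> = sets borel" "g \<in> borel_measurable borel"
  shows "(\<integral>\<^sup>+x. g x \<partial>flip s \<mu>) = (\<integral>\<^sup>+x. g (s * x) \<partial>\<mu>)"
  using assms unfolding flip_def
  by (subst nn_integral_distr) (auto cong: measurable_cong_sets)

lemma emeasure_eq_nn_integral:
  assumes "sets \<mu> = sets borel" "A \<in> sets borel"
  shows "emeasure \<mu> A = (\<integral>\<^sup>+x. indicator A x \<partial>\<mu>)"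
  using assms by simp

lemma measurable_translate: "translate u \<in> measurable measure_algebra measure_algebra"
proof (rule measurable_measure_algebraI)
  fix A :: "real set" assume A[measurable]: "A \<in> sets borel"
  have "(\<lambda>\<mu>. \<integral>\<^sup>+x. indicator A (x + u) \<partial>\<mu>) \<in> borel_measurable measure_algebra"
    by (intro measurable_nn_integral_measure_algebra) measurable
  moreover have "emeasure (translate u \<mu>) A = (\<integral>\<^sup>+x. indicator A (x + u) \<partial>\<mu>)"
    if "\<mu> \<in> space measure_algebra" for \<mu>
    using that A by (simp add: emeasure_eq_nn_integral[OF _ A] nn_integral_translate
        sets_measure_algebraD del: nn_integral_indicator)
  ultimately show "(\<lambda>\<mu>. emeasure (translate u \<mu>) A) \<in> borel_measurable measure_algebra"
    by (simp cong: measurable_cong)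
qed simp

lemma measurable_flip: "flip s \<in> measurable measure_algebra measure_algebra"
proof (rule measurable_measure_algebraI)
  fix A :: "real set" assume A[measurable]: "A \<in> sets borel"
  have "(\<lambda>\<mu>. \<integral>\<^sup>+x. indicator A (s * x) \<partial>\<mu>) \<in> borel_measurable measure_algebra"
    by (intro measurable_nn_integral_measure_algebra) measurable
  moreover have "emeasure (flip s \<mu>) A = (\<integral>\<^sup>+x. indicator A (s * x) \<partial>\<mu>)"
    if "\<mu> \<in> space measure_algebra" for \<mu>
    using that A by (simp add: emeasure_eq_nn_integral[OF _ A] nn_integral_flip
        sets_measure_algebraD del: nn_integral_indicator)
  ultimately show "(\<lambda>\<mu>. emeasure (flip s \<mu>) A) \<in> borel_measurable measure_algebra"
    by (simp cong: measurable_cong)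
qed simp

section \<open>Laplace functionals\<close>

text \<open>The function exp(-x), extended continuously by 0 to infinity. Infinite arguments do
  occur: test functions may take the value infinity, and so may the mass of a superposition on a
  bounded set.\<close>

definition eneg :: "ennreal \<Rightarrow> ennreal" where
  "eneg x = (if x = \<infinity> then 0 else ennreal (exp (- enn2real x)))"

lemma eneg_ennreal [simp]: "0 \<le> r \<Longrightarrow> eneg (ennreal r) = ennreal (exp (- r))"
  by (simp add: eneg_def)

lemma eneg_top [simp]: "eneg \<top> = 0"
  by (simp add: eneg_def)

lemma eneg_0 [simp]: "eneg 0 = 1"
  using eneg_ennreal[of 0] by simp

lemma eneg_le_1: "eneg x \<le> 1"
  by (cases x) (auto simp: ennreal_le_1)

lemma eneg_ne_top [simp]: "eneg x \<noteq> \<top>"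
  using eneg_le_1[of x] by (auto simp: top_unique)

lemma eneg_add: "eneg (x + y) = eneg x * eneg y"
  by (cases x; cases y)
    (auto simp: ennreal_plus[symmetric] ennreal_mult[symmetric] mult_exp_exp simp del: ennreal_plus)

lemma eneg_sum: "eneg (\<Sum>i\<in>I. f i) = (\<Prod>i\<in>I. eneg (f i))"
  by (induction I rule: infinite_finite_induct) (auto simp: eneg_add)

lemma eneg_of_nat_mult: "eneg (of_nat n * x) = eneg x ^ n"
  by (induction n) (auto simp: eneg_add distrib_right)

lemma measurable_eneg [measurable]: "eneg \<in> borel_measurable borel"
  unfolding eneg_def by measurable

lemma tendsto_eneg:
  assumes "(f \<longlongrightarrow> x) F"
  shows "((\<lambda>n. eneg (f n)) \<longlongrightarrow> eneg x) F"
proof (cases "x = \<top>")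
  case False
  then have "x < \<top>" by (simp add: less_top)
  then have "eventually (\<lambda>n. f n < \<top>) F" using assms order_tendstoD(2) by blast
  then have ev: "eventually (\<lambda>n. ennreal (exp (- enn2real (f n))) = eneg (f n)) F"
    by eventually_elim (auto simp: eneg_def)
  have "((\<lambda>n. ennreal (exp (- enn2real (f n)))) \<longlongrightarrow> ennreal (exp (- enn2real x))) F"
  proof (intro tendsto_ennrealI tendsto_intros)
    show "(f \<longlongrightarrow> ennreal (enn2real x)) F" using assms False by (simp add: ennreal_enn2real_if)
  qed simp
  from Lim_transform_eventually[OF this ev] show ?thesis using False by (simp add: eneg_def[of x])
next
  case True
  show ?thesis unfolding True eneg_top
  proof (rule order_tendstoI)
    fix a :: ennreal assume "0 < a"
    then obtain z where z: "0 < z" "z < a" by (rule dense[THEN exE]) auto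
    moreover obtain r where "z = ennreal r" "0 \<le> r" using z by (cases z) auto
    ultimately have r: "0 < r" "ennreal r < a" by (auto simp: ennreal_less_zero_iff)
    \<comment> \<open>Arguments above K have \<open>eneg\<close> at most r; the maximum with 0 keeps
      K in the range on which \<open>ennreal\<close> is injective.\<close>
    define K where "K = max 0 (- ln r)"
    have "eventually (\<lambda>n. ennreal K < f n) F"
      using assms True order_tendstoD(1) by fastforce
    then show "eventually (\<lambda>n. eneg (f n) < a) F"
    proof eventually_elim
      case (elim n)
      have "eneg (f n) \<le> ennreal r"
      proof (cases "f n")
        case (real s)
        have "0 \<le> K" by (simp add: K_def)
        with real elim have "K < s" by (simp add: ennreal_less_iff)
        then have "exp (- s) \<le> exp (ln r)" by (subst exp_le_cancel_iff) (auto simp: K_def)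
        with real r show ?thesis by (auto intro: ennreal_leI)
      qed simp
      with r show ?case by simp
    qed
  qed simp
qed

lemma eneg_antimono: "x \<le> y \<Longrightarrow> eneg y \<le> eneg x"
  by (cases x; cases y) (auto intro: ennreal_leI simp: top_unique)

lemma one_minus_eneg_le: "1 - eneg x \<le> x"
proof (cases x)
  case (real r)
  then have "1 - eneg x = ennreal (1 - exp (- r))"
    by (simp add: ennreal_1[symmetric] ennreal_minus del: ennreal_1)
  also have "\<dots> \<le> ennreal r" using exp_ge_add_one_self[of "- r"] by (intro ennreal_leI) simp
  finally show ?thesis using real by simp
qed simp

text \<open>The inverse of \<open>eneg\<close> on [0, 1]. It presents an averaged cluster factor as
  \<open>eneg\<close> of a test function, which is infinite where the factor vanishes.\<close>

definition neglog :: "ennreal \<Rightarrow> ennreal" where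
  "neglog x = (if x = 0 then \<infinity> else ennreal (- ln (enn2real x)))"

lemma measurable_neglog [measurable]: "neglog \<in> borel_measurable borel"
  unfolding neglog_def by measurable

lemma eneg_neglog:
  assumes "x \<le> 1" shows "eneg (neglog x) = x"
proof (cases "x = 0")
  case False
  from assms obtain r where r: "x = ennreal r" "0 \<le> r" "r \<le> 1"
    by (cases x) (auto simp: ennreal_le_1 top_unique)
  with False show ?thesis by (auto simp: neglog_def)
qed (simp add: neglog_def)

section \<open>Threshold indicators as limits of polynomials in exponentials\<close>

text \<open>Put z = exp(-m). For t < m, Bernoulli's inequality bounds the power below by 1 minus
  roughly n exp(-n (m - t)), which tends to 1. For m \<le> t the exponent times z to the n is at
  least n, so the power is at most exp(-n). The factor n in the exponent is there for the boundary
  case t = m, which makes the threshold strict.\<close>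

lemma tendsto_step_power:
  fixes t m :: real
  assumes "0 \<le> t" "0 \<le> m"
  shows "(\<lambda>n. (1 - exp (- (real n * m))) ^ nat \<lceil>real n * exp (real n * t)\<rceil>)
           \<longlonglongrightarrow> (if t < m then 1 else 0)"
proof (cases "t < m")
  case True
  let ?k = "\<lambda>n. nat \<lceil>real n * exp (real n * t)\<rceil>"
  \<comment> \<open>The summand 1 bounds the rounding by the ceiling. It costs
    \<open>exp (- m) ^ n\<close>, which vanishes in the limit because m is positive.\<close>
  have "(\<lambda>n. 1 - (real n * exp (real n * t) + 1) * exp (- (real n * m))) \<longlonglongrightarrow> 1" if "0 < m"
  proof -
    define d where "d = m - t"
    have "0 < d" using True by (simp add: d_def)
    then have a: "(\<lambda>n. real n * exp (- d) ^ n) \<longlonglongrightarrow> 0" by (intro powser_times_n_limit_0) simp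
    have b: "(\<lambda>n. exp (- m) ^ n) \<longlonglongrightarrow> 0" using that by (intro LIMSEQ_power_zero) (simp add: abs_less_iff)
    have "(\<lambda>n. 1 - (real n * exp (- d) ^ n + exp (- m) ^ n)) \<longlonglongrightarrow> 1 - (0 + 0)"
      by (rule tendsto_diff[OF tendsto_const tendsto_add[OF a b]])
    then have "(\<lambda>n. 1 - (real n * exp (- (real n * d)) + exp (- (real n * m)))) \<longlonglongrightarrow> 1"
      by (simp flip: exp_of_nat_mult)
    moreover have "(real n * exp (real n * t) + 1) * exp (- (real n * m)) =
        real n * exp (- (real n * d)) + exp (- (real n * m))" for n
      by (simp add: algebra_simps d_def flip: exp_add)
    ultimately show ?thesis by simp
  qed
  show ?thesis
  proof (cases "m = 0")
    case False
    then have lim: "(\<lambda>n. 1 - (real n * exp (real n * t) + 1) * exp (- (real n * m))) \<longlonglongrightarrow> 1"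
      using assms \<open>0 < m \<Longrightarrow> _\<close> by simp
    have "1 - (real n * exp (real n * t) + 1) * exp (- (real n * m)) \<le> (1 - exp (- (real n * m))) ^ ?k n" for n
    proof -
      have "0 \<le> real n * exp (real n * t)" by simp
      then have "real (?k n) \<le> real n * exp (real n * t) + 1" by linarith
      then have "1 - (real n * exp (real n * t) + 1) * exp (- (real n * m)) \<le> 1 + real (?k n) * - exp (- (real n * m))"
        by (simp add: mult_right_mono)
      also have "\<dots> \<le> (1 + - exp (- (real n * m))) ^ ?k n"
        by (rule Bernoulli_inequality) (use assms in \<open>simp add: mult_nonneg_nonneg\<close>)
      finally show ?thesis by simp
    qed
    moreover have "(1 - exp (- (real n * m))) ^ ?k n \<le> 1" for n
      by (rule power_le_one) (use assms in auto)
    ultimately have "(\<lambda>n. (1 - exp (- (real n * m))) ^ ?k n) \<longlonglongrightarrow> 1"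
      by (intro tendsto_sandwich[OF _ _ lim tendsto_const] always_eventually) auto
    then show ?thesis using True by simp
  qed (use assms True in \<open>auto\<close>)
next
  case False
  have le: "(1 - exp (- (real n * m))) ^ nat \<lceil>real n * exp (real n * t)\<rceil> \<le> exp (- real n)" for n
  proof -
    have "(1 - exp (- (real n * m))) ^ nat \<lceil>real n * exp (real n * t)\<rceil> \<le>
        exp (- exp (- (real n * m))) ^ nat \<lceil>real n * exp (real n * t)\<rceil>"
      using exp_ge_add_one_self[of "- exp (- (real n * m))"] assms by (intro power_mono) auto
    also have "\<dots> = exp (- (real (nat \<lceil>real n * exp (real n * t)\<rceil>) * exp (- (real n * m))))"
      by (simp flip: exp_of_nat_mult)
    also have "\<dots> \<le> exp (- real n)"
    proof -
      have "real n \<le> real n * exp (real n * t) * exp (- (real n * m))"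
        using False by (simp add: mult.assoc mult_left_mono flip: exp_add)
          (simp add: mult_le_cancel_left1 mult_left_mono)
      also have "\<dots> \<le> real (nat \<lceil>real n * exp (real n * t)\<rceil>) * exp (- (real n * m))"
        by (intro mult_right_mono) (auto intro: real_nat_ceiling_ge)
      finally show ?thesis by simp
    qed
    finally show ?thesis .
  qed
  have lim: "(\<lambda>n. exp (- real n)) \<longlonglongrightarrow> 0"
    using LIMSEQ_power_zero[of "exp (- 1 :: real)"] by (simp flip: exp_of_nat_mult)
  have "0 \<le> (1 - exp (- (real n * m))) ^ nat \<lceil>real n * exp (real n * t)\<rceil>" for n
    using assms by (intro zero_le_power) simp
  then have "(\<lambda>n. (1 - exp (- (real n * m))) ^ nat \<lceil>real n * exp (real n * t)\<rceil>) \<longlonglongrightarrow> 0"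
    by (intro tendsto_sandwich[OF _ _ tendsto_const lim] always_eventually allI le)
  then show ?thesis using False by simp
qed

lemma tendsto_step_eneg:
  "(\<lambda>n. (1 - enn2real (eneg (of_nat n * m))) ^ nat \<lceil>real n * exp (real n * t)\<rceil>)
     \<longlonglongrightarrow> (if ennreal t < m then 1 else 0)" if "0 \<le> t"
proof (cases m)
  case (real r)
  have "enn2real (eneg (of_nat n * m)) = exp (- (real n * r))" for n
    using real by (simp add: ennreal_of_nat_eq_real_of_nat flip: ennreal_mult)
  with real that tendsto_step_power[of t r] show ?thesis by (simp add: ennreal_less_iff)
next
  case top
  \<comment> \<open>The index n = 0 has to be excluded, since 0 times infinity is 0.\<close>
  have "eventually (\<lambda>n. (1 - enn2real (eneg (of_nat n * m))) ^ nat \<lceil>real n * exp (real n * t)\<rceil> = 1) sequentially"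
    using eventually_gt_at_top[of 0] by eventually_elim (simp add: top ennreal_mult_top)
  then show ?thesis using top by (auto intro: tendsto_eventually)
qed

section \<open>Laplace functionals determine laws\<close>

text \<open>Multiplied out, the product is a signed combination of Laplace factors, because
  \<open>eneg\<close> turns sums of test functions into products. Since subtraction in
  \<open>ennreal\<close> is not linear in general, the expansion is carried out one factor at a
  time.\<close>

lemma laplace_product_eq:
  fixes X Y :: "'a \<Rightarrow> real measure"
  assumes M: "prob_space M"
    and X: "X \<in> measurable M measure_algebra" and Y: "Y \<in> measurable M measure_algebra"
    and eq: "\<And>g. g \<in> borel_measurable borel \<Longrightarrow>
      (\<integral>\<^sup>+\<omega>. eneg (\<integral>\<^sup>+x. g x \<partial>X \<omega>) \<partial>M) = (\<integral>\<^sup>+\<omega>. eneg (\<integral>\<^sup>+x. g x \<partial>Y \<omega>) \<partial>M)"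
    and I: "finite I" and h: "\<And>i. i \<in> I \<Longrightarrow> h i \<in> borel_measurable borel"
  shows "(\<integral>\<^sup>+\<omega>. (\<Prod>i\<in>I. (1 - eneg (\<integral>\<^sup>+x. h i x \<partial>X \<omega>)) ^ k i) \<partial>M) =
         (\<integral>\<^sup>+\<omega>. (\<Prod>i\<in>I. (1 - eneg (\<integral>\<^sup>+x. h i x \<partial>Y \<omega>)) ^ k i) \<partial>M)"
proof -
  interpret prob_space M by fact
  let ?L = "\<lambda>g \<mu>. eneg (\<integral>\<^sup>+x. g x \<partial>\<mu>)"
  \<comment> \<open>The extra factor with an arbitrary g makes the property inductive: the next
    factor is absorbed into it. The bound by 1 keeps all integrals finite, so that they may be
    subtracted.\<close>
  define good where "good F \<longleftrightarrow> F \<in> borel_measurable measure_algebra \<and> (\<forall>\<mu>. F \<mu> \<le> 1) \<and>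
    (\<forall>g\<in>borel_measurable borel. (\<integral>\<^sup>+\<omega>. F (X \<omega>) * ?L g (X \<omega>) \<partial>M) = (\<integral>\<^sup>+\<omega>. F (Y \<omega>) * ?L g (Y \<omega>) \<partial>M))"
    for F :: "real measure \<Rightarrow> ennreal"
  have L [measurable]: "?L g \<in> borel_measurable measure_algebra" if "g \<in> borel_measurable borel" for g
    by (rule measurable_compose[OF measurable_nn_integral_measure_algebra[OF that] measurable_eneg])
  note [measurable] = X Y
  \<comment> \<open>The factor 1 - L g leaves two terms, with test functions g' and g + g', and
    \<open>good F\<close> covers both.\<close>
  have step: "good (\<lambda>\<mu>. F \<mu> * (1 - ?L g \<mu>))" if F: "good F" and g [measurable]: "g \<in> borel_measurable borel" for F g
    unfolding good_def
  proof (intro conjI allI ballI)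
    have [measurable]: "F \<in> borel_measurable measure_algebra" using F by (simp add: good_def)
    show "(\<lambda>\<mu>. F \<mu> * (1 - ?L g \<mu>)) \<in> borel_measurable measure_algebra" by measurable
    have Ft: "F \<mu> \<noteq> \<top>" for \<mu>
    proof -
      have "F \<mu> \<le> 1" using F by (simp add: good_def)
      then show ?thesis by (auto simp: top_unique)
    qed
    show "F \<mu> * (1 - ?L g \<mu>) \<le> 1" for \<mu>
      using F mult_mono[of "F \<mu>" 1 "1 - ?L g \<mu>" 1] by (auto simp: good_def diff_le_self_ennreal)
    fix g' :: "real \<Rightarrow> ennreal" assume g' [measurable]: "g' \<in> borel_measurable borel"
    have "(\<integral>\<^sup>+\<omega>. F (Z \<omega>) * (1 - ?L g (Z \<omega>)) * ?L g' (Z \<omega>) \<partial>M) =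
        (\<integral>\<^sup>+\<omega>. F (Z \<omega>) * ?L g' (Z \<omega>) \<partial>M) - (\<integral>\<^sup>+\<omega>. F (Z \<omega>) * ?L (\<lambda>x. g x + g' x) (Z \<omega>) \<partial>M)"
      if Z [measurable]: "Z \<in> measurable M measure_algebra" for Z
    proof -
      have add: "?L (\<lambda>x. g x + g' x) (Z \<omega>) = ?L g (Z \<omega>) * ?L g' (Z \<omega>)" if "\<omega> \<in> space M" for \<omega>
        using sets_measure_algebraD[OF measurable_space[OF Z that]]
        by (subst nn_integral_add) (auto simp: eneg_add cong: measurable_cong_sets)
      have le: "F (Z \<omega>) * ?L (\<lambda>x. g x + g' x) (Z \<omega>) \<le> 1" for \<omega>
        using F mult_mono[of "F (Z \<omega>)" 1 "?L (\<lambda>x. g x + g' x) (Z \<omega>)" 1]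
        by (auto simp: good_def eneg_le_1)
      have "F (Z \<omega>) * (1 - ?L g (Z \<omega>)) * ?L g' (Z \<omega>) =
          F (Z \<omega>) * ?L g' (Z \<omega>) - F (Z \<omega>) * ?L (\<lambda>x. g x + g' x) (Z \<omega>)" if "\<omega> \<in> space M" for \<omega>
        using Ft eneg_ne_top unfolding add[OF that]
        by (simp add: ennreal_right_diff_distrib mult.commute mult.left_commute
            ennreal_mult_eq_top_iff)
      then have "(\<integral>\<^sup>+\<omega>. F (Z \<omega>) * (1 - ?L g (Z \<omega>)) * ?L g' (Z \<omega>) \<partial>M) =
        (\<integral>\<^sup>+\<omega>. F (Z \<omega>) * ?L g' (Z \<omega>) - F (Z \<omega>) * ?L (\<lambda>x. g x + g' x) (Z \<omega>) \<partial>M)"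
        by (intro nn_integral_cong) auto
      also have "\<dots> = (\<integral>\<^sup>+\<omega>. F (Z \<omega>) * ?L g' (Z \<omega>) \<partial>M) - (\<integral>\<^sup>+\<omega>. F (Z \<omega>) * ?L (\<lambda>x. g x + g' x) (Z \<omega>) \<partial>M)"
      proof (rule nn_integral_diff)
        have "(\<integral>\<^sup>+\<omega>. F (Z \<omega>) * ?L (\<lambda>x. g x + g' x) (Z \<omega>) \<partial>M) \<le> (\<integral>\<^sup>+\<omega>. 1 \<partial>M)"
          by (intro nn_integral_mono le)
        then show "(\<integral>\<^sup>+\<omega>. F (Z \<omega>) * ?L (\<lambda>x. g x + g' x) (Z \<omega>) \<partial>M) \<noteq> \<infinity>"
          by (auto simp: emeasure_space_1 top_unique)
        show "AE \<omega> in M. F (Z \<omega>) * ?L (\<lambda>x. g x + g' x) (Z \<omega>) \<le> F (Z \<omega>) * ?L g' (Z \<omega>)"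
        proof (rule AE_I2)
          fix \<omega> assume "\<omega> \<in> space M"
          then show "F (Z \<omega>) * ?L (\<lambda>x. g x + g' x) (Z \<omega>) \<le> F (Z \<omega>) * ?L g' (Z \<omega>)"
            using add mult_right_mono[OF eneg_le_1] by (auto intro!: mult_left_mono)
        qed
      qed measurable
      finally show ?thesis .
    qed
    from this[OF X] this[OF Y] show "(\<integral>\<^sup>+\<omega>. F (X \<omega>) * (1 - ?L g (X \<omega>)) * ?L g' (X \<omega>) \<partial>M) =
        (\<integral>\<^sup>+\<omega>. F (Y \<omega>) * (1 - ?L g (Y \<omega>)) * ?L g' (Y \<omega>) \<partial>M)"
      using F g g' by (simp add: good_def)
  qed
  have pow: "good (\<lambda>\<mu>. F \<mu> * (1 - ?L g \<mu>) ^ n)" if "good F" "g \<in> borel_measurable borel" for F g n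
  proof (induction n)
    case (Suc n)
    from step[OF this that(2)] show ?case by (simp add: ac_simps)
  qed (use that in simp)
  have "good (\<lambda>\<mu>. \<Prod>i\<in>I. (1 - ?L (h i) \<mu>) ^ k i)"
    using I h
  proof (induction I)
    case empty
    show ?case using eq by (simp add: good_def)
  next
    case (insert i I)
    then have "good (\<lambda>\<mu>. (\<Prod>i\<in>I. (1 - ?L (h i) \<mu>) ^ k i) * (1 - ?L (h i) \<mu>) ^ k i)"
      by (intro pow) auto
    with insert show ?case by (simp add: ac_simps)
  qed
  then show ?thesis by (auto simp: good_def dest!: bspec[where x="\<lambda>_. 0"])
qed

text \<open>The test function n times the indicator of A has Laplace factor exp(-n \<mu>(A)), the
  n-th power in the approximating polynomial. All approximations lie in [0, 1], so dominated
  convergence applies on a probability space, also where \<mu>(A) is infinite.\<close>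

lemma emeasure_thresholds:
  fixes X :: "'a \<Rightarrow> real measure"
  assumes M: "prob_space M" and X [measurable]: "X \<in> measurable M measure_algebra"
    and J: "finite J" "J \<subseteq> sets borel \<times> {0..}"
  shows "(\<lambda>n. \<integral>\<^sup>+\<omega>. (\<Prod>j\<in>J. (1 - eneg (\<integral>\<^sup>+x. of_nat n * indicator (fst j) x \<partial>X \<omega>))
             ^ nat \<lceil>real n * exp (real n * snd j)\<rceil>) \<partial>M)
          \<longlonglongrightarrow> emeasure M {\<omega>\<in>space M. \<forall>(A, t)\<in>J. ennreal t < emeasure (X \<omega>) A}"
proof -
  interpret prob_space M by fact
  let ?k = "\<lambda>n j. nat \<lceil>real n * exp (real n * snd j)\<rceil>"
  have fst [measurable]: "fst j \<in> sets borel" if "j \<in> J" for j using J that by auto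
  have A [measurable]: "(\<lambda>\<omega>. emeasure (X \<omega>) (fst j)) \<in> borel_measurable M" if "j \<in> J" for j
    by (rule measurable_compose[OF X measurable_emeasure_measure_algebra[OF fst[OF that]]])
  have int: "(\<integral>\<^sup>+x. of_nat n * indicator (fst j) x \<partial>X \<omega>) = of_nat n * emeasure (X \<omega>) (fst j)"
    if "\<omega> \<in> space M" "j \<in> J" for \<omega> j and n :: nat
    using fst[OF that(2)] sets_measure_algebraD[OF measurable_space[OF X that(1)]]
    by (subst nn_integral_cmult) (auto cong: measurable_cong_sets)
  define G where "G n \<omega> = (\<Prod>j\<in>J. (1 - enn2real (eneg (of_nat n * emeasure (X \<omega>) (fst j)))) ^ ?k n j)"
    for n :: nat and \<omega>
  have e1: "0 \<le> 1 - enn2real (eneg x)" "enn2real (eneg x) \<le> 1" for x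
    using eneg_le_1[of x] by (auto intro: enn2real_leI)
  have e2: "1 - eneg x = ennreal (1 - enn2real (eneg x))" for x
    using e1[of x] by (subst ennreal_minus[symmetric]) (auto simp: ennreal_enn2real_if)
  have G: "(\<Prod>j\<in>J. (1 - eneg (\<integral>\<^sup>+x. of_nat n * indicator (fst j) x \<partial>X \<omega>)) ^ ?k n j) = ennreal (G n \<omega>)"
    if "\<omega> \<in> space M" for n \<omega>
  proof -
    have "(\<Prod>j\<in>J. (1 - eneg (\<integral>\<^sup>+x. of_nat n * indicator (fst j) x \<partial>X \<omega>)) ^ ?k n j) =
        (\<Prod>j\<in>J. ennreal ((1 - enn2real (eneg (of_nat n * emeasure (X \<omega>) (fst j)))) ^ ?k n j))"
      using that e1 by (intro prod.cong) (auto simp: int e2 ennreal_power)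
    also have "\<dots> = ennreal (G n \<omega>)"
      unfolding G_def using e1 by (intro prod_ennreal) auto
    finally show ?thesis .
  qed
  have [measurable]: "G n \<in> borel_measurable M" for n unfolding G_def by measurable
  have "(\<lambda>n. \<integral>\<^sup>+\<omega>. ennreal (G n \<omega>) \<partial>M) \<longlonglongrightarrow>
     (\<integral>\<^sup>+\<omega>. ennreal (\<Prod>j\<in>J. if ennreal (snd j) < emeasure (X \<omega>) (fst j) then 1 else 0) \<partial>M)"
  proof (rule nn_integral_dominated_convergence[where w="\<lambda>_. 1"])
    have "G n \<omega> \<le> 1" for n \<omega>
      unfolding G_def using e1 by (intro prod_le_1) (auto intro: power_le_one)
    then show "AE \<omega> in M. ennreal (G n \<omega>) \<le> 1" for n by (auto simp: ennreal_le_1)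
    show "AE \<omega> in M. (\<lambda>n. ennreal (G n \<omega>)) \<longlonglongrightarrow>
       ennreal (\<Prod>j\<in>J. if ennreal (snd j) < emeasure (X \<omega>) (fst j) then 1 else 0)"
      unfolding G_def using J
      by (intro AE_I2 tendsto_ennrealI tendsto_prod tendsto_step_eneg) auto
  qed (auto simp: emeasure_space_1)
  also have "(\<integral>\<^sup>+\<omega>. ennreal (\<Prod>j\<in>J. if ennreal (snd j) < emeasure (X \<omega>) (fst j) then 1 else 0) \<partial>M) =
     (\<integral>\<^sup>+\<omega>. indicator {\<omega>\<in>space M. \<forall>(A, t)\<in>J. ennreal t < emeasure (X \<omega>) A} \<omega> \<partial>M)"
  proof (intro nn_integral_cong)
    have "(\<Prod>j\<in>J. if Q j then 1 else 0 :: real) = (if \<forall>j\<in>J. Q j then 1 else 0)" for Q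
      using J(1) by (induction J) auto
    then show "ennreal (\<Prod>j\<in>J. if ennreal (snd j) < emeasure (X \<omega>) (fst j) then 1 else 0) =
        indicator {\<omega>\<in>space M. \<forall>(A, t)\<in>J. ennreal t < emeasure (X \<omega>) A} \<omega>"
      if "\<omega> \<in> space M" for \<omega>
      using that by (simp add: indicator_def split_beta)
  qed
  also have "\<dots> = emeasure M {\<omega>\<in>space M. \<forall>(A, t)\<in>J. ennreal t < emeasure (X \<omega>) A}"
  proof (rule nn_integral_indicator)
    have "{\<omega>\<in>space M. \<forall>j\<in>J. ennreal (snd j) < emeasure (X \<omega>) (fst j)} \<in> sets M"
      by (intro sets.sets_Collect_finite_All) (use J in auto)
    then show "{\<omega>\<in>space M. \<forall>(A, t)\<in>J. ennreal t < emeasure (X \<omega>) A} \<in> sets M"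
      by (simp add: split_beta)
  qed
  finally show ?thesis by (simp add: G cong: nn_integral_cong)
qed

text \<open>On \<open>[0, 1]\<close> the polynomials \<open>(1 - z\<^sup>n)\<^bsup>\<lceil>n c\<^sup>n\<rceil>\<^esup>\<close> converge boundedly to the indicator of
  \<open>z < 1 / c\<close>. Taking \<open>z = exp (- \<mu> A)\<close>, Laplace functionals determine the probabilities of all
  finite intersections of events \<open>\<mu> A > t\<close>.\<close>

theorem same_law_laplaceI:
  fixes X Y :: "'a \<Rightarrow> real measure"
  assumes M: "prob_space M"
    and X [measurable]: "X \<in> measurable M measure_algebra"
    and Y [measurable]: "Y \<in> measurable M measure_algebra"
    and eq: "\<And>g. g \<in> borel_measurable borel \<Longrightarrow>
      (\<integral>\<^sup>+\<omega>. eneg (\<integral>\<^sup>+x. g x \<partial>X \<omega>) \<partial>M) = (\<integral>\<^sup>+\<omega>. eneg (\<integral>\<^sup>+x. g x \<partial>Y \<omega>) \<partial>M)"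
  shows "same_law M X Y"
proof -
  interpret prob_space M by fact
  let ?\<Omega> = "space measure_algebra"
  let ?B = "\<lambda>J. {\<mu>\<in>?\<Omega>. \<forall>(A, t)\<in>J. ennreal t < emeasure \<mu> A}"
  let ?E = "{?B J |J. finite J \<and> J \<subseteq> sets borel \<times> {0..}}"
  have B_sets: "?B J \<in> sets measure_algebra" if J: "finite J" "J \<subseteq> sets borel \<times> {0..}" for J
  proof -
    have "{\<mu>\<in>?\<Omega>. \<forall>j\<in>J. ennreal (snd j) < emeasure \<mu> (fst j)} \<in> sets measure_algebra"
    proof (rule sets.sets_Collect_finite_All[OF _ J(1)])
      fix j assume "j \<in> J"
      then have "fst j \<in> sets borel" using J by auto
      note [measurable] = measurable_emeasure_measure_algebra[OF this]
      show "{\<mu>\<in>?\<Omega>. ennreal (snd j) < emeasure \<mu> (fst j)} \<in> sets measure_algebra" by measurable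
    qed
    then show ?thesis by (simp add: split_beta)
  qed
  \<comment> \<open>Strict superlevel sets at finite levels suffice: at level infinity the set is
    empty. Finite conjunctions are included in the generator to make it stable under intersection,
    and the empty conjunction is the whole space.\<close>
  have gen: "sets measure_algebra = sigma_sets ?\<Omega> ?E"
  proof
    show "sigma_sets ?\<Omega> ?E \<subseteq> sets measure_algebra"
      using B_sets by (intro sets.sigma_sets_subset) auto
    have pow: "?E \<subseteq> Pow ?\<Omega>" by auto
    have "(\<lambda>\<mu>. \<mu>) \<in> measurable (sigma ?\<Omega> ?E) measure_algebra"
    proof (rule measurable_measure_algebraI)
      show "sets \<mu> = sets borel" if "\<mu> \<in> space (sigma ?\<Omega> ?E)" for \<mu> :: "real measure"
        using that by (simp add: space_measure_of[OF pow] sets_measure_algebraD)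
      fix A :: "real set" assume A: "A \<in> sets borel"
      show "(\<lambda>\<mu>. emeasure \<mu> A) \<in> borel_measurable (sigma ?\<Omega> ?E)"
      proof (rule borel_measurableI_greater)
        fix y :: ennreal
        have "{\<mu>\<in>?\<Omega>. y < emeasure \<mu> A} \<in> sigma_sets ?\<Omega> ?E"
        proof (cases y)
          case (real r)
          then have "{\<mu>\<in>?\<Omega>. y < emeasure \<mu> A} = ?B {(A, r)}" by auto
          also have "\<dots> \<in> ?E" using A real by (intro CollectI exI[of _ "{(A, r)}"]) auto
          finally show ?thesis by (rule sigma_sets.Basic)
        qed (simp add: sigma_sets.Empty)
        then show "{\<mu> \<in> space (sigma ?\<Omega> ?E). y < emeasure \<mu> A} \<in> sets (sigma ?\<Omega> ?E)"
          by (simp only: space_measure_of[OF pow] sets_measure_of[OF pow])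
      qed
    qed
    then have "(\<lambda>\<mu>. \<mu>) -` S \<inter> space (sigma ?\<Omega> ?E) \<in> sets (sigma ?\<Omega> ?E)"
      if "S \<in> sets measure_algebra" for S
      using that by (rule measurable_sets)
    then show "sets measure_algebra \<subseteq> sigma_sets ?\<Omega> ?E"
      using sets.sets_into_space[of _ measure_algebra]
      by (force simp only: space_measure_of[OF pow] sets_measure_of[OF pow] vimage_ident Int_absorb2)
  qed
  have "distr M measure_algebra X = distr M measure_algebra Y"
  proof (rule measure_eqI_generator_eq[where E="?E" and \<Omega>="?\<Omega>" and A="\<lambda>_. ?\<Omega>"])
    show "Int_stable ?E"
    proof (rule Int_stableI)
      fix a b assume "a \<in> ?E" "b \<in> ?E"
      then obtain J K where "a = ?B J" "finite J" "J \<subseteq> sets borel \<times> {0..}"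
          "b = ?B K" "finite K" "K \<subseteq> sets borel \<times> {0..}" by auto
      then show "a \<inter> b \<in> ?E" by (intro CollectI exI[of _ "J \<union> K"]) auto
    qed
    show "?E \<subseteq> Pow ?\<Omega>" by auto
    show "sets (distr M measure_algebra X) = sigma_sets ?\<Omega> ?E"
      "sets (distr M measure_algebra Y) = sigma_sets ?\<Omega> ?E" by (simp_all add: gen)
    show "range (\<lambda>_. ?\<Omega>) \<subseteq> ?E" by (auto intro!: exI[of _ "{}"])
    show "(\<Union>i. ?\<Omega>) = ?\<Omega>" by simp
    show "emeasure (distr M measure_algebra X) ?\<Omega> \<noteq> \<infinity>" by (simp add: emeasure_distr)
    fix S assume "S \<in> ?E"
    then obtain J where J: "S = ?B J" "finite J" "J \<subseteq> sets borel \<times> {0..}" by auto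
    have Z: "emeasure (distr M measure_algebra Z) S =
        emeasure M {\<omega>\<in>space M. \<forall>(A, t)\<in>J. ennreal t < emeasure (Z \<omega>) A}"
      if "Z \<in> measurable M measure_algebra" for Z
      using that B_sets[OF J(2,3)] measurable_space[OF that] unfolding J(1)
      by (subst emeasure_distr) (auto intro!: arg_cong[where f="emeasure M"])
    have "(\<integral>\<^sup>+\<omega>. (\<Prod>j\<in>J. (1 - eneg (\<integral>\<^sup>+x. of_nat n * indicator (fst j) x \<partial>X \<omega>))
             ^ nat \<lceil>real n * exp (real n * snd j)\<rceil>) \<partial>M) =
        (\<integral>\<^sup>+\<omega>. (\<Prod>j\<in>J. (1 - eneg (\<integral>\<^sup>+x. of_nat n * indicator (fst j) x \<partial>Y \<omega>))
             ^ nat \<lceil>real n * exp (real n * snd j)\<rceil>) \<partial>M)" for n :: nat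
      by (rule laplace_product_eq[OF M X Y eq J(2)]) (use J in auto)
    then show "emeasure (distr M measure_algebra X) S = emeasure (distr M measure_algebra Y) S"
      using emeasure_thresholds[OF M X J(2,3)] emeasure_thresholds[OF M Y J(2,3)]
      by (simp add: Z X Y LIMSEQ_unique)
  qed
  then show ?thesis by (simp add: same_law_def X Y)
qed

section \<open>The Poisson process\<close>

abbreviation point_measure :: "(nat \<Rightarrow> 'a \<Rightarrow> real) \<Rightarrow> 'a \<Rightarrow> real measure" where
  "point_measure U \<omega> \<equiv> superpose (\<lambda>j. return borel (U j \<omega>))"

lemma nn_integral_point_measure:
  "g \<in> borel_measurable borel \<Longrightarrow> (\<integral>\<^sup>+x. g x \<partial>point_measure U \<omega>) = (\<Sum>j. g (U j \<omega>))"
  by (subst nn_integral_superpose) (auto simp: nn_integral_return)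

lemma emeasure_point_measure:
  "A \<in> sets borel \<Longrightarrow> emeasure (point_measure U \<omega>) A = (\<Sum>j. indicator A (U j \<omega>))"
  by (subst emeasure_superpose) auto

locale poisson_process = prob_space M for M :: "'a measure" +
  fixes \<nu> :: real and U :: "nat \<Rightarrow> 'a \<Rightarrow> real"
  assumes \<nu>_pos: "0 < \<nu>" and poisson: "poisson_points M \<nu> U"
begin

lemma measurable_U [measurable]: "U j \<in> borel_measurable M"
  using poisson by (simp add: poisson_points_def)

lemma measurable_count [measurable]:
  "A \<in> sets borel \<Longrightarrow> (\<lambda>\<omega>. emeasure (point_measure U \<omega>) A) \<in> borel_measurable M"
  by (simp add: emeasure_point_measure)

text \<open>The Poisson law is prescribed at natural values only. As its weights sum to 1, the count
  is almost surely one of them, so infinity contributes nothing and the expectation is a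
  series.\<close>

lemma nn_integral_count:
  assumes A: "A \<in> sets borel" "bounded A"
  shows "(\<integral>\<^sup>+\<omega>. F (emeasure (point_measure U \<omega>) A) \<partial>M) =
    (\<Sum>k. F (of_nat k) * ennreal ((\<nu> * measure lborel A) ^ k / fact k * exp (- (\<nu> * measure lborel A))))"
proof -
  let ?N = "\<lambda>\<omega>. emeasure (point_measure U \<omega>) A"
  let ?m = "\<nu> * measure lborel A"
  define p where "p k = ?m ^ k / fact k * exp (- ?m)" for k :: nat
  define E where "E k = {\<omega>\<in>space M. ?N \<omega> = of_nat k}" for k :: nat
  have m: "0 \<le> ?m" using \<nu>_pos by simp
  note [measurable] = measurable_count[OF A(1)]
  have E [measurable]: "E k \<in> sets M" for k unfolding E_def by measurable
  have PE: "emeasure M (E k) = ennreal (p k)" for k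
    using poisson A unfolding poisson_points_def E_def p_def by (simp add: emeasure_eq_measure)
  have dis: "disjoint_family E" by (auto simp: disjoint_family_on_def E_def)
  have "p sums (exp ?m * exp (- ?m))"
    using sums_mult2[OF exp_converges[of ?m], of "exp (- ?m)"] unfolding p_def
    by (simp add: divide_inverse mult.commute)
  then have "p sums 1" by (simp flip: exp_add)
  then have "(\<Sum>k. ennreal (p k)) = ennreal 1" using m by (intro suminf_ennreal_eq) (simp add: p_def)
  then have "emeasure M (\<Union>k. E k) = 1"
    using suminf_emeasure[OF _ dis, of M] by (simp add: PE image_subset_iff)
  then have "AE \<omega> in M. \<omega> \<in> (\<Union>k. E k)"
    by (intro AE_prob_1) (simp add: measure_def)
  then have "(\<integral>\<^sup>+\<omega>. F (?N \<omega>) \<partial>M) = (\<integral>\<^sup>+\<omega>. (\<Sum>k. F (of_nat k) * indicator (E k) \<omega>) \<partial>M)"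
  proof (intro nn_integral_cong_AE, eventually_elim)
    case (elim \<omega>)
    then obtain k where "\<omega> \<in> E k" by auto
    from suminf_cmult_indicator[OF dis this, of "\<lambda>k. F (of_nat k)"] show ?case
      using \<open>\<omega> \<in> E k\<close> by (simp add: E_def)
  qed
  also have "\<dots> = (\<Sum>k. F (of_nat k) * ennreal (p k))"
    by (subst nn_integral_suminf) (auto simp: nn_integral_cmult_indicator PE)
  finally show ?thesis by (simp add: p_def)
qed

text \<open>The Poisson generating function: a count N with mean m has E[z^N] = exp(-m (1 - z)),
  here with z = exp(-a).\<close>

lemma laplace_count:
  assumes A: "A \<in> sets borel" "bounded A" and y: "y \<noteq> \<top>"
  shows "(\<integral>\<^sup>+\<omega>. eneg (y * emeasure (point_measure U \<omega>) A) \<partial>M) =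
    eneg (ennreal \<nu> * (emeasure lborel A * (1 - eneg y)))"
proof -
  obtain a where a: "y = ennreal a" "0 \<le> a" using y by (cases y) auto
  let ?m = "\<nu> * measure lborel A"
  have m: "0 \<le> ?m" using \<nu>_pos by simp
  have "eneg (y * of_nat k) * ennreal (?m ^ k / fact k * exp (- ?m)) =
      ennreal ((?m * exp (- a)) ^ k / fact k * exp (- ?m))" for k :: nat
  proof -
    have "y * of_nat k = ennreal (a * real k)"
      using a by (simp add: ennreal_of_nat_eq_real_of_nat ennreal_mult)
    then have "eneg (y * of_nat k) = ennreal (exp (- a) ^ k)"
      using a by (simp add: mult.commute[of a] flip: exp_of_nat_mult)
    moreover have "exp (- a) ^ k * (?m ^ k / fact k * exp (- ?m)) = (?m * exp (- a)) ^ k / fact k * exp (- ?m)"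
      by (simp add: power_mult_distrib)
    ultimately show ?thesis using m by (simp flip: ennreal_mult)
  qed
  then have "(\<integral>\<^sup>+\<omega>. eneg (y * emeasure (point_measure U \<omega>) A) \<partial>M) =
      (\<Sum>k. ennreal ((?m * exp (- a)) ^ k / fact k * exp (- ?m)))"
    by (simp add: nn_integral_count[OF A, of "\<lambda>z. eneg (y * z)"])
  also have "\<dots> = ennreal (exp (?m * exp (- a)) * exp (- ?m))"
  proof (rule suminf_ennreal_eq)
    show "(\<lambda>k. (?m * exp (- a)) ^ k / fact k * exp (- ?m)) sums (exp (?m * exp (- a)) * exp (- ?m))"
      using sums_mult2[OF exp_converges[of "?m * exp (- a)"], of "exp (- ?m)"]
      by (simp add: divide_inverse mult.commute)
  qed (use m in auto)
  also have "\<dots> = ennreal (exp (- (\<nu> * (measure lborel A * (1 - exp (- a))))))"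
    by (simp add: mult_exp_exp algebra_simps)
  also have "\<dots> = eneg (ennreal \<nu> * (ennreal (measure lborel A) * (1 - eneg y)))"
    using a \<nu>_pos by (simp add: ennreal_minus ennreal_mult[symmetric] flip: ennreal_1)
  also have "ennreal (measure lborel A) = emeasure lborel A"
    using emeasure_bounded_finite[OF A(2)] by (simp add: emeasure_eq_ennreal_measure less_top)
  finally show ?thesis .
qed

text \<open>The level sets of a simple function are disjoint, so their counts are independent and
  the expectation of the product factorizes into one-set Laplace transforms.\<close>

lemma laplace_simple:
  assumes g: "simple_function borel g" "\<And>x. g x \<noteq> \<top>" "bounded {x. g x \<noteq> 0}"
  shows "(\<integral>\<^sup>+\<omega>. eneg (\<integral>\<^sup>+x. g x \<partial>point_measure U \<omega>) \<partial>M) =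
    eneg (ennreal \<nu> * (\<integral>\<^sup>+x. (1 - eneg (g x)) \<partial>lborel))"
proof -
  \<comment> \<open>The value 0 is left out because its level set is unbounded, whereas the Poisson
    axioms speak of bounded sets.\<close>
  define I where "I = g ` UNIV - {0}"
  have "finite I" using g(1) by (auto simp: I_def simple_function_def)
  \<comment> \<open>Values are numbered because independence in \<open>poisson_points\<close> is
    formulated for index sets of naturals.\<close>
  then obtain b where b: "bij_betw b {0..<card I} I" using ex_bij_betw_nat_finite by blast
  define J where "J = {0..<card I}"
  define A where "A i = g -` {b i}" for i
  have J: "finite J" "bij_betw b J I" using b by (auto simp: J_def)
  have A: "A i \<in> sets borel" "bounded (A i)" if "i \<in> J" for i
  proof -
    show "A i \<in> sets borel" using g(1) simple_functionD(2)[of borel g "{b i}"] by (simp add: A_def)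
    have "b i \<noteq> 0" using J that by (auto simp: I_def dest: bij_betw_apply)
    then show "bounded (A i)" by (intro bounded_subset[OF g(3)]) (auto simp: A_def)
  qed
  have dis: "disjoint_family_on A J"
    using bij_betw_imp_inj_on[OF J(2)] by (auto simp: disjoint_family_on_def A_def dest: inj_onD)
  have b_top: "b i \<noteq> \<top>" if "i \<in> J" for i
    using J that g(2) by (auto simp: I_def dest!: bij_betw_apply)
  have g_eq: "g x = (\<Sum>i\<in>J. b i * indicator (A i) x)" for x
  proof -
    have "(\<Sum>i\<in>J. b i * indicator (A i) x) = (\<Sum>y\<in>I. y * indicator (g -` {y}) x)"
      unfolding A_def using sum.reindex_bij_betw[OF J(2), of "\<lambda>y. y * indicator (g -` {y}) x"] by simp
    also have "\<dots> = (\<Sum>y\<in>I \<inter> {g x}. y * indicator (g -` {y}) x)"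
      by (rule sum.mono_neutral_right) (use \<open>finite I\<close> in \<open>auto simp: indicator_def\<close>)
    also have "\<dots> = g x" by (cases "g x = 0") (auto simp: I_def)
    finally show ?thesis by simp
  qed
  have int: "(\<integral>\<^sup>+x. g x \<partial>point_measure U \<omega>) = (\<Sum>i\<in>J. b i * emeasure (point_measure U \<omega>) (A i))" for \<omega>
    unfolding g_eq using A
    by (subst nn_integral_sum) (auto simp: nn_integral_cmult_indicator)
  have "indep_vars (\<lambda>_. borel) (\<lambda>i \<omega>. emeasure (point_measure U \<omega>) (A i)) J"
    by (rule poisson[unfolded poisson_points_def, THEN conjunct2, THEN conjunct2, rule_format, OF J(1) dis])
      (use A in auto)
  then have ind: "indep_vars (\<lambda>_. borel) (\<lambda>i \<omega>. eneg (b i * emeasure (point_measure U \<omega>) (A i))) J"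
    by (rule indep_vars_compose2) measurable
  have "(\<integral>\<^sup>+\<omega>. eneg (\<integral>\<^sup>+x. g x \<partial>point_measure U \<omega>) \<partial>M) =
      (\<Prod>i\<in>J. \<integral>\<^sup>+\<omega>. eneg (b i * emeasure (point_measure U \<omega>) (A i)) \<partial>M)"
    unfolding int eneg_sum by (rule indep_vars_nn_integral[OF J(1) ind]) simp
  also have "\<dots> = (\<Prod>i\<in>J. eneg (ennreal \<nu> * (emeasure lborel (A i) * (1 - eneg (b i)))))"
    using A b_top by (intro prod.cong refl laplace_count) auto
  also have "\<dots> = eneg (ennreal \<nu> * (\<Sum>i\<in>J. (1 - eneg (b i)) * emeasure lborel (A i)))"
    by (simp add: eneg_sum[symmetric] sum_distrib_left mult_ac)
  also have "(\<Sum>i\<in>J. (1 - eneg (b i)) * emeasure lborel (A i)) =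
      (\<integral>\<^sup>+x. (\<Sum>i\<in>J. (1 - eneg (b i)) * indicator (A i) x) \<partial>lborel)"
    using A by (subst nn_integral_sum) (auto simp: nn_integral_cmult_indicator)
  also have "(\<lambda>x. \<Sum>i\<in>J. (1 - eneg (b i)) * indicator (A i) x) = (\<lambda>x. 1 - eneg (g x))"
  proof
    fix x
    show "(\<Sum>i\<in>J. (1 - eneg (b i)) * indicator (A i) x) = 1 - eneg (g x)"
    proof (cases "g x = 0")
      case True
      then have "x \<notin> A i" if "i \<in> J" for i
        using J that by (auto simp: A_def I_def dest: bij_betw_apply)
      then show ?thesis using True by simp
    next
      case False
      then have "g x \<in> b ` J" using bij_betw_imp_surj_on[OF J(2)] by (auto simp: I_def)
      then obtain i where i: "i \<in> J" "g x = b i" by auto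
      then have "x \<in> A k \<longleftrightarrow> k = i" if "k \<in> J" for k
        using that bij_betw_imp_inj_on[OF J(2)] by (auto simp: A_def dest: inj_onD)
      then have "(\<Sum>k\<in>J. (1 - eneg (b k)) * indicator (A k) x) = (\<Sum>k\<in>J. if k = i then 1 - eneg (b k) else 0)"
        by (intro sum.cong) auto
      with i J(1) show ?thesis by simp
    qed
  qed
  finally show ?thesis .
qed

text \<open>Approximation from below by simple functions with finite values and bounded support. The
  left side converges by domination by 1, the right side monotonically, so g itself may be infinite
  and have unbounded support.\<close>

theorem laplace_poisson:
  assumes g: "g \<in> borel_measurable borel"
  shows "(\<integral>\<^sup>+\<omega>. eneg (\<Sum>j. g (U j \<omega>)) \<partial>M) =
    eneg (ennreal \<nu> * (\<integral>\<^sup>+x. (1 - eneg (g x)) \<partial>lborel))"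
proof -
  obtain f where f: "\<And>i. simple_function borel (f i)" "incseq f" "\<And>i x. f i x < \<top>"
    "\<And>x. (SUP i. f i x) = g x"
    using borel_measurable_implies_simple_function_sequence'[OF g] by metis
  \<comment> \<open>Truncation to [-n, n] supplies the bounded support and keeps the sequence
    increasing.\<close>
  define h where "h n x = f n x * indicator {- real n..real n} x" for n x
  have h_simple: "simple_function borel (h n)" for n
    unfolding h_def by (intro simple_function_mult f simple_function_indicator) simp
  have h_meas [measurable]: "h n \<in> borel_measurable borel" for n
    by (rule borel_measurable_simple_function[OF h_simple])
  have h_top: "h n x \<noteq> \<top>" for n x
    using f(3)[of n x] by (auto simp: h_def indicator_def)
  have h_bounded: "bounded {x. h n x \<noteq> 0}" for n
    by (rule bounded_subset[of "{- real n..real n}"]) (auto simp: h_def indicator_def)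
  have h_inc: "incseq h"
  proof (intro incseq_SucI le_funI)
    fix n x
    have "f n x \<le> f (Suc n) x" using f(2) by (auto simp: incseq_Suc_iff le_fun_def)
    moreover have "(indicator {- real n..real n} x :: ennreal) \<le> indicator {- real (Suc n)..real (Suc n)} x"
      by (auto simp: indicator_def)
    ultimately show "h n x \<le> h (Suc n) x" unfolding h_def by (rule mult_mono) auto
  qed
  have h_lim: "(\<lambda>n. h n x) \<longlonglongrightarrow> g x" for x
  proof -
    have "incseq (\<lambda>n. f n x)" using f(2) by (auto simp: incseq_def le_fun_def)
    then have 1: "(\<lambda>n. f n x) \<longlonglongrightarrow> g x" using LIMSEQ_SUP[of "\<lambda>n. f n x"] f(4) by simp
    obtain n0 where "\<bar>x\<bar> \<le> real n0" using real_arch_simple by blast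
    then have "eventually (\<lambda>n. f n x = h n x) sequentially"
      by (intro eventually_sequentiallyI[of n0]) (auto simp: h_def indicator_def)
    with 1 show ?thesis by (rule Lim_transform_eventually)
  qed
  note nn_lim = nn_integral_LIMSEQ
  have 1: "(\<lambda>n. \<integral>\<^sup>+\<omega>. eneg (\<integral>\<^sup>+x. h n x \<partial>point_measure U \<omega>) \<partial>M) \<longlonglongrightarrow>
      (\<integral>\<^sup>+\<omega>. eneg (\<integral>\<^sup>+x. g x \<partial>point_measure U \<omega>) \<partial>M)"
  proof (rule nn_integral_dominated_convergence[where w="\<lambda>_. 1"])
    show "(\<lambda>\<omega>. eneg (\<integral>\<^sup>+x. h n x \<partial>point_measure U \<omega>)) \<in> borel_measurable M" for n
      by (simp add: nn_integral_point_measure)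
    show "(\<lambda>\<omega>. eneg (\<integral>\<^sup>+x. g x \<partial>point_measure U \<omega>)) \<in> borel_measurable M"
      using g by (simp add: nn_integral_point_measure)
    have "(\<lambda>n. \<integral>\<^sup>+x. h n x \<partial>point_measure U \<omega>) \<longlonglongrightarrow> (\<integral>\<^sup>+x. g x \<partial>point_measure U \<omega>)" for \<omega>
      by (rule nn_lim[OF h_inc _ h_lim]) (simp cong: measurable_cong_sets)
    then show "AE \<omega> in M. (\<lambda>n. eneg (\<integral>\<^sup>+x. h n x \<partial>point_measure U \<omega>)) \<longlonglongrightarrow>
        eneg (\<integral>\<^sup>+x. g x \<partial>point_measure U \<omega>)"
      by (intro AE_I2 tendsto_eneg)
  qed (auto simp: eneg_le_1 emeasure_space_1)
  have 2: "(\<lambda>n. \<integral>\<^sup>+x. (1 - eneg (h n x)) \<partial>lborel) \<longlonglongrightarrow> (\<integral>\<^sup>+x. (1 - eneg (g x)) \<partial>lborel)"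
  proof (rule nn_lim)
    show "incseq (\<lambda>n x. 1 - eneg (h n x))"
      using h_inc by (auto simp: incseq_def le_fun_def intro!: ennreal_minus_mono eneg_antimono)
    show "(\<lambda>n. 1 - eneg (h n x)) \<longlonglongrightarrow> 1 - eneg (g x)" for x
      by (intro tendsto_diff_ennreal tendsto_const tendsto_eneg h_lim) auto
  qed measurable
  have "(\<lambda>n. \<integral>\<^sup>+\<omega>. eneg (\<integral>\<^sup>+x. h n x \<partial>point_measure U \<omega>) \<partial>M) \<longlonglongrightarrow>
      eneg (ennreal \<nu> * (\<integral>\<^sup>+x. (1 - eneg (g x)) \<partial>lborel))"
    unfolding laplace_simple[OF h_simple h_top h_bounded]
    by (intro tendsto_eneg ennreal_tendsto_cmult 2) simp
  from LIMSEQ_unique[OF 1 this] show ?thesis by (simp add: nn_integral_point_measure[OF g])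
qed

lemma mean_count:
  assumes A: "A \<in> sets borel" "bounded A"
  shows "(\<integral>\<^sup>+\<omega>. emeasure (point_measure U \<omega>) A \<partial>M) = ennreal \<nu> * emeasure lborel A"
proof -
  let ?m = "\<nu> * measure lborel A"
  have m: "0 \<le> ?m" using \<nu>_pos by simp
  have "(\<integral>\<^sup>+\<omega>. emeasure (point_measure U \<omega>) A \<partial>M) =
      (\<Sum>k. ennreal (real k * (?m ^ k / fact k * exp (- ?m))))"
    using m by (simp add: nn_integral_count[OF A, of "\<lambda>z. z"] ennreal_of_nat_eq_real_of_nat
        flip: ennreal_mult)
  also have "\<dots> = ennreal ?m"
  proof (rule suminf_ennreal_eq)
    have "(\<lambda>k. ?m ^ k / fact k * exp (- ?m) * ?m) sums (exp ?m * exp (- ?m) * ?m)"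
      using sums_mult2[OF sums_mult2[OF exp_converges[of ?m], of "exp (- ?m)"], of ?m]
      by (simp only: divide_inverse real_scaleR_def mult.commute[of "inverse _"])
    moreover have "?m ^ k / fact k * exp (- ?m) * ?m = real (Suc k) * (?m ^ Suc k / fact (Suc k) * exp (- ?m))" for k
      by (simp add: field_simps del: of_nat_Suc) 
    moreover have "exp ?m * exp (- ?m) * ?m = ?m" by (simp add: mult_exp_exp)
    ultimately have "(\<lambda>k. real (Suc k) * (?m ^ Suc k / fact (Suc k) * exp (- ?m))) sums ?m"
      by (simp only:)
    \<comment> \<open>The shift of index loses only the term k = 0, which vanishes because of its
      factor k.\<close>
    from sums_Suc[OF this] show "(\<lambda>k. real k * (?m ^ k / fact k * exp (- ?m))) sums ?m" by simp
  qed (use m in simp)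
  also have "\<dots> = ennreal \<nu> * emeasure lborel A"
    using emeasure_bounded_finite[OF A(2)] \<nu>_pos
    by (simp add: emeasure_eq_ennreal_measure less_top ennreal_mult)
  finally show ?thesis .
qed

text \<open>The superposition of the laws of the \<open>U j\<close> is the intensity measure; it
  agrees with \<nu> times Lebesgue measure on bounded sets, hence everywhere by exhaustion. The sum
  over j stays outside the expectation because clusters are averaged out separately for each
  j.\<close>

theorem campbell_poisson:
  assumes f: "f \<in> borel_measurable borel"
  shows "(\<Sum>j. \<integral>\<^sup>+\<omega>. f (U j \<omega>) \<partial>M) = ennreal \<nu> * (\<integral>\<^sup>+x. f x \<partial>lborel)"
proof -
  let ?m = "superpose (\<lambda>j. distr M borel (U j))"
  have em: "emeasure ?m A = (\<integral>\<^sup>+\<omega>. emeasure (point_measure U \<omega>) A \<partial>M)" if "A \<in> sets borel" for A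
  proof -
    note [measurable] = that
    have "emeasure ?m A = (\<Sum>j. \<integral>\<^sup>+\<omega>. indicator A (U j \<omega>) \<partial>M)"
      using that by (simp add: emeasure_superpose emeasure_eq_nn_integral[of "distr M borel _"] nn_integral_distr
          del: nn_integral_indicator)
    also have "\<dots> = (\<integral>\<^sup>+\<omega>. (\<Sum>j. indicator A (U j \<omega>)) \<partial>M)"
      by (intro nn_integral_suminf[symmetric]) measurable
    finally show ?thesis using that by (simp add: emeasure_point_measure)
  qed
  have "?m = density lborel (\<lambda>_. ennreal \<nu>)"
  proof (rule measure_eqI)
    fix A assume "A \<in> sets ?m"
    then have A: "A \<in> sets borel" by simp
    define B where "B n = A \<inter> {- real n..real n}" for n
    have B: "B n \<in> sets borel" "bounded (B n)" for n
      using A by (auto simp: B_def intro: bounded_subset[of "{- real n..real n}"])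
    have UB: "(\<Union>n. B n) = A"
    proof -
      have "x \<in> (\<Union>n. B n)" if "x \<in> A" for x
      proof -
        obtain n where "\<bar>x\<bar> \<le> real n" using real_arch_simple by blast
        with that have "x \<in> B n" by (auto simp: B_def)
        then show ?thesis by blast
      qed
      then show ?thesis by (auto simp: B_def)
    qed
    have inc: "incseq B" by (auto simp: incseq_def B_def)
    have "emeasure ?m (B n) = emeasure (density lborel (\<lambda>_. ennreal \<nu>)) (B n)" for n
      using B by (simp add: em mean_count emeasure_density nn_integral_cmult_indicator)
    with Lim_emeasure_incseq[of B ?m] Lim_emeasure_incseq[of B "density lborel (\<lambda>_. ennreal \<nu>)"] B inc UB
    show "emeasure ?m A = emeasure (density lborel (\<lambda>_. ennreal \<nu>)) A"
      by (simp add: image_subset_iff LIMSEQ_unique)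
  qed simp
  then have "(\<integral>\<^sup>+x. f x \<partial>?m) = ennreal \<nu> * (\<integral>\<^sup>+x. f x \<partial>lborel)"
    using f by (simp add: nn_integral_density nn_integral_cmult)
  moreover have "(\<integral>\<^sup>+x. f x \<partial>?m) = (\<Sum>j. \<integral>\<^sup>+\<omega>. f (U j \<omega>) \<partial>M)"
    using f by (simp add: nn_integral_superpose nn_integral_distr)
  ultimately show ?thesis by simp
qed

end

section \<open>Independence\<close>

text \<open>Independence makes the joint law a product, and Tonelli's theorem applies. The
  independent copy of Y is realized by a second integration over the same space M.\<close>

lemma indep_elements_nn_integral:
  assumes M: "prob_space M" and ind: "indep_elements M S X T Y"
    and F: "F \<in> borel_measurable (S \<Otimes>\<^sub>M T)"
  shows "(\<integral>\<^sup>+\<omega>. F (X \<omega>, Y \<omega>) \<partial>M) = (\<integral>\<^sup>+\<omega>. \<integral>\<^sup>+\<omega>'. F (X \<omega>, Y \<omega>') \<partial>M \<partial>M)"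
proof -
  interpret prob_space M by fact
  have X [measurable]: "X \<in> measurable M S" and Y [measurable]: "Y \<in> measurable M T"
    and I: "indep_set {X -` A \<inter> space M | A. A \<in> sets S} {Y -` B \<inter> space M | B. B \<in> sets T}"
    using ind by (auto simp: indep_elements_def)
  interpret X: prob_space "distr M S X" by (rule prob_space_distr) fact
  interpret Y: prob_space "distr M T Y" by (rule prob_space_distr) fact
  have eq: "distr M S X \<Otimes>\<^sub>M distr M T Y = distr M (S \<Otimes>\<^sub>M T) (\<lambda>\<omega>. (X \<omega>, Y \<omega>))"
  proof (rule pair_measure_eqI)
    fix A B assume "A \<in> sets (distr M S X)" "B \<in> sets (distr M T Y)"
    then have A [measurable]: "A \<in> sets S" and B [measurable]: "B \<in> sets T" by auto
    have "prob ((X -` A \<inter> space M) \<inter> (Y -` B \<inter> space M)) = prob (X -` A \<inter> space M) * prob (Y -` B \<inter> space M)"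
      by (rule indep_setD[OF I]) (use A B in auto)
    moreover have "(\<lambda>\<omega>. (X \<omega>, Y \<omega>)) -` (A \<times> B) \<inter> space M = (X -` A \<inter> space M) \<inter> (Y -` B \<inter> space M)"
      by auto
    ultimately show "emeasure (distr M S X) A * emeasure (distr M T Y) B =
        emeasure (distr M (S \<Otimes>\<^sub>M T) (\<lambda>\<omega>. (X \<omega>, Y \<omega>))) (A \<times> B)"
      by (simp add: emeasure_distr emeasure_eq_measure ennreal_mult)
  qed (simp_all add: X.sigma_finite_measure_axioms Y.sigma_finite_measure_axioms)
  have "(\<integral>\<^sup>+\<omega>. F (X \<omega>, Y \<omega>) \<partial>M) = (\<integral>\<^sup>+z. F z \<partial>(distr M S X \<Otimes>\<^sub>M distr M T Y))"
    unfolding eq using F by (simp add: nn_integral_distr)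
  also have "\<dots> = (\<integral>\<^sup>+x. \<integral>\<^sup>+y. F (x, y) \<partial>distr M T Y \<partial>distr M S X)"
    by (rule Y.nn_integral_fst[symmetric]) (use F in \<open>simp cong: measurable_cong_sets\<close>)
  also have "\<dots> = (\<integral>\<^sup>+\<omega>. \<integral>\<^sup>+y. F (X \<omega>, y) \<partial>distr M T Y \<partial>M)"
    using F by (subst nn_integral_distr) (auto intro!: Y.borel_measurable_nn_integral_fst cong: measurable_cong_sets)
  also have "\<dots> = (\<integral>\<^sup>+\<omega>. \<integral>\<^sup>+\<omega>'. F (X \<omega>, Y \<omega>') \<partial>M \<partial>M)"
    using F measurable_space[OF X] by (intro nn_integral_cong) (subst nn_integral_distr, auto)
  finally show ?thesis .
qed

text \<open>The hypothesis is uncurried and the conclusion curried, so that it can serve as a rule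
  for the \<open>measurable\<close> method on expressions in position, cluster and sign.\<close>

lemma measurable_compose_triple:
  assumes h: "(\<lambda>(u, \<mu>, s). h u \<mu> s) \<in> measurable (A \<Otimes>\<^sub>M B \<Otimes>\<^sub>M D) E"
    and [measurable]: "f \<in> measurable T A" "g \<in> measurable T B" "k \<in> measurable T D"
  shows "(\<lambda>t. h (f t) (g t) (k t)) \<in> measurable T E"
proof -
  have "(\<lambda>t. (f t, g t, k t)) \<in> measurable T (A \<Otimes>\<^sub>M B \<Otimes>\<^sub>M D)" by measurable
  from measurable_compose[OF this h] show ?thesis by simp
qed

lemma one_minus_convex_combination:
  assumes "0 \<le> p" "0 \<le> q" "p + q = 1" "0 \<le> a" "a \<le> 1" "0 \<le> b" "b \<le> 1"
  shows "1 - (ennreal p * ennreal a + ennreal q * ennreal b) =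
    ennreal p * (1 - ennreal a) + ennreal q * (1 - ennreal b)"
proof -
  have "1 - (p * a + q * b) = p * (1 - a) + q * (1 - b)"
    using assms(3) by (simp add: algebra_simps)
  then show ?thesis
    using assms by (simp add: ennreal_minus ennreal_mult[symmetric] ennreal_plus[symmetric]
        flip: ennreal_1 del: ennreal_plus)
qed

text \<open>The terms of a convergent series tend to 0, and naturals below 1 are 0, so the series is
  a finite sum.\<close>

lemma suminf_of_nat:
  fixes a :: "nat \<Rightarrow> ennreal"
  assumes "\<And>j. \<exists>k::nat. a j = of_nat k" "(\<Sum>j. a j) \<noteq> \<top>"
  shows "\<exists>k::nat. (\<Sum>j. a j) = of_nat k"
proof -
  obtain k where k: "a j = of_nat (k j)" for j :: nat using assms(1) by metis
  have "summable (\<lambda>j. real (k j))"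
    by (rule summable_suminf_not_top) (use assms(2) in \<open>simp_all add: k ennreal_of_nat_eq_real_of_nat\<close>)
  then have "(\<lambda>j. real (k j)) \<longlonglongrightarrow> 0" by (rule summable_LIMSEQ_zero)
  then have "eventually (\<lambda>j. real (k j) < 1) sequentially" by (rule order_tendstoD) simp
  then obtain n where "\<And>j. n \<le> j \<Longrightarrow> k j = 0" by (auto simp: eventually_sequentially)
  then have "(\<Sum>j. a j) = (\<Sum>j<n. a j)" by (intro suminf_finite) (auto simp: k not_less)
  also have "\<dots> = of_nat (\<Sum>j<n. k j)" by (simp add: k)
  finally show ?thesis ..
qed

section \<open>The cluster process\<close>

text \<open>The functional \<Lambda> of the overview. Multiplied by \<nu> it is the negative
  logarithm of the Laplace functional of the process with unflipped clusters: each position u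
  contributes the mean of 1 - exp(-.) for a cluster started there.\<close>

definition cluster_rate :: "'p measure \<Rightarrow> ('p \<Rightarrow> real measure) \<Rightarrow> (real \<Rightarrow> ennreal) \<Rightarrow> ennreal" where
  "cluster_rate P C g = (\<integral>\<^sup>+u. \<integral>\<^sup>+\<omega>. (1 - eneg (\<integral>\<^sup>+x. g (x + u) \<partial>C \<omega>)) \<partial>P \<partial>lborel)"

lemma cluster_rate_translate:
  assumes P: "prob_space P" and C: "C \<in> measurable P cluster_algebra" and g: "g \<in> borel_measurable borel"
  shows "cluster_rate P C (\<lambda>x. g (x + v)) = cluster_rate P C g"
proof -
  interpret prob_space P by fact
  note [measurable] = g C
  have [measurable]: "(\<lambda>(u, \<omega>). \<integral>\<^sup>+x. g (x + u) \<partial>C \<omega>) \<in> borel_measurable (borel \<Otimes>\<^sub>M P)"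
    unfolding split_beta by (rule measurable_nn_integral_cluster) measurable
  have "cluster_rate P C g = (\<integral>\<^sup>+u. \<integral>\<^sup>+\<omega>. (1 - eneg (\<integral>\<^sup>+x. g (x + (v + 1 * u)) \<partial>C \<omega>)) \<partial>P \<partial>lborel)"
    unfolding cluster_rate_def
    by (subst nn_integral_real_affine[where c=1 and t=v]) (auto intro!: borel_measurable_nn_integral)
  then show ?thesis by (simp add: cluster_rate_def add_ac)
qed

text \<open>The model for one bias \<theta>. Different biases become different interpretations over
  the same immigrants and clusters, and they are compared through their Laplace and generating
  functionals, which involve the same \<open>cluster_rate P C\<close>.\<close>

locale cluster_model = poisson_process M \<nu> U + P: prob_space P
  for M :: "'a measure" and \<nu> U and P :: "'p measure" +
  fixes C :: "'p \<Rightarrow> real measure" and K :: "nat \<Rightarrow> 'a \<Rightarrow> real measure"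
    and S :: "nat \<Rightarrow> 'a \<Rightarrow> real" and \<theta> :: real
  assumes C [measurable]: "C \<in> measurable P cluster_algebra"
    and K_indep: "indep_vars (\<lambda>_. cluster_algebra) K UNIV"
    and K_law: "\<And>j. distr M cluster_algebra (K j) = distr P cluster_algebra C"
    and U_K_indep: "indep_elements M (PiM UNIV (\<lambda>_. borel)) (\<lambda>\<omega> j. U j \<omega>)
                      (PiM UNIV (\<lambda>_. cluster_algebra)) (\<lambda>\<omega> j. K j \<omega>)"
    and \<theta>: "\<theta> \<in> {-1..1}"
    and S_indep: "indep_vars (\<lambda>_. borel) S UNIV"
    and S_plus: "\<And>j. measure M {\<omega> \<in> space M. S j \<omega> = 1} = (1 + \<theta>) / 2"
    and S_minus: "\<And>j. measure M {\<omega> \<in> space M. S j \<omega> = - 1} = (1 - \<theta>) / 2"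
    and S_UK_indep: "indep_elements M
                        (PiM UNIV (\<lambda>_. borel) \<Otimes>\<^sub>M PiM UNIV (\<lambda>_. cluster_algebra))
                        (\<lambda>\<omega>. (\<lambda>j. U j \<omega>, \<lambda>j. K j \<omega>))
                        (PiM UNIV (\<lambda>_. borel)) (\<lambda>\<omega> j. S j \<omega>)"
begin

abbreviation N :: "'a \<Rightarrow> real measure" where "N \<equiv> cluster_process U K S"
abbreviation p :: ennreal where "p \<equiv> ennreal ((1 + \<theta>) / 2)"
abbreviation q :: ennreal where "q \<equiv> ennreal ((1 - \<theta>) / 2)"

lemma p_add_q: "p + q = 1"
proof -
  have "p + q = ennreal ((1 + \<theta>) / 2 + (1 - \<theta>) / 2)" using \<theta> by (intro ennreal_plus[symmetric]) auto
  also have "(1 + \<theta>) / 2 + (1 - \<theta>) / 2 = 1" by (simp add: field_simps)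
  finally show ?thesis by simp
qed

lemma measurable_K [measurable]: "K j \<in> measurable M cluster_algebra"
  using K_indep by (auto simp: indep_vars_def)

lemma measurable_S [measurable]: "S j \<in> borel_measurable M"
  using S_indep by (auto simp: indep_vars_def)

lemma K_counting: "\<omega> \<in> space M \<Longrightarrow> finite_simple_counting (K j \<omega>)"
  using measurable_space[OF measurable_K] by (simp add: space_cluster_algebra)

lemma C_counting: "\<omega> \<in> space P \<Longrightarrow> finite_simple_counting (C \<omega>)"
  using measurable_space[OF C] by (simp add: space_cluster_algebra)

lemma nn_integral_sign:
  assumes [measurable]: "h \<in> borel_measurable borel"
  shows "(\<integral>\<^sup>+\<omega>. h (S j \<omega>) \<partial>M) = p * h 1 + q * h (- 1)"
proof -
  let ?A = "{\<omega>\<in>space M. S j \<omega> = 1}" and ?B = "{\<omega>\<in>space M. S j \<omega> = - 1}"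
  have "prob (?A \<union> ?B) = prob ?A + prob ?B"
    by (rule finite_measure_Union) auto
  also have "\<dots> = 1" by (simp add: S_plus S_minus field_simps)
  finally have "AE \<omega> in M. \<omega> \<in> ?A \<union> ?B" by (rule AE_prob_1)
  then have "(\<integral>\<^sup>+\<omega>. h (S j \<omega>) \<partial>M) = (\<integral>\<^sup>+\<omega>. h 1 * indicator ?A \<omega> + h (- 1) * indicator ?B \<omega> \<partial>M)"
    by (intro nn_integral_cong_AE, eventually_elim) (auto simp: indicator_def)
  also have "\<dots> = h 1 * emeasure M ?A + h (- 1) * emeasure M ?B"
    by (subst nn_integral_add) (auto simp: nn_integral_cmult_indicator)
  finally show ?thesis by (simp add: emeasure_eq_measure S_plus S_minus mult.commute)
qed

lemma nn_integral_K:
  assumes "h \<in> borel_measurable cluster_algebra"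
  shows "(\<integral>\<^sup>+\<omega>. h (K j \<omega>) \<partial>M) = (\<integral>\<^sup>+\<omega>. h (C \<omega>) \<partial>P)"
proof -
  have "(\<integral>\<^sup>+\<omega>. h (K j \<omega>) \<partial>M) = (\<integral>\<^sup>+\<mu>. h \<mu> \<partial>distr M cluster_algebra (K j))"
    using assms by (simp add: nn_integral_distr)
  also have "\<dots> = (\<integral>\<^sup>+\<omega>. h (C \<omega>) \<partial>P)"
    unfolding K_law using assms by (simp add: nn_integral_distr)
  finally show ?thesis .
qed

text \<open>The conditional mean of one cluster's contribution, given that its immigrant sits at
  u.\<close>

definition cluster_mean :: "(real \<Rightarrow> real measure \<Rightarrow> real \<Rightarrow> ennreal) \<Rightarrow> real \<Rightarrow> ennreal" where
  "cluster_mean h u = p * (\<integral>\<^sup>+\<omega>. h u (C \<omega>) 1 \<partial>P) + q * (\<integral>\<^sup>+\<omega>. h u (C \<omega>) (- 1) \<partial>P)"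

lemma measurable_cluster_mean [measurable]:
  assumes h: "(\<lambda>(u, \<mu>, s). h u \<mu> s) \<in> borel_measurable (borel \<Otimes>\<^sub>M cluster_algebra \<Otimes>\<^sub>M borel)"
  shows "cluster_mean h \<in> borel_measurable borel"
proof -
  note [measurable (raw)] = measurable_compose_triple[OF h]
  show ?thesis unfolding cluster_mean_def by measurable
qed

text \<open>Two conditionings, matching the two independence assumptions: with immigrants and
  clusters frozen the signs are averaged, then with immigrants frozen the clusters are. Finite
  products suffice; infinite ones are reached as limits, and a single factor gives first
  moments.\<close>

lemma nn_integral_prod_clusters:
  assumes J: "finite J"
    and h [measurable]: "(\<lambda>(u, \<mu>, s). h u \<mu> s) \<in> borel_measurable (borel \<Otimes>\<^sub>M cluster_algebra \<Otimes>\<^sub>M borel)"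
  shows "(\<integral>\<^sup>+\<omega>. (\<Prod>j\<in>J. h (U j \<omega>) (K j \<omega>) (S j \<omega>)) \<partial>M) = (\<integral>\<^sup>+\<omega>. (\<Prod>j\<in>J. cluster_mean h (U j \<omega>)) \<partial>M)"
proof -
  note [measurable (raw)] = measurable_compose_triple[OF h]
  \<comment> \<open>The mean over the sign with position and cluster still frozen.\<close>
  define h' where "h' u \<mu> = p * h u \<mu> 1 + q * h u \<mu> (- 1)" for u \<mu>
  have h' [measurable]: "(\<lambda>(u, \<mu>). h' u \<mu>) \<in> borel_measurable (borel \<Otimes>\<^sub>M cluster_algebra)"
    unfolding h'_def by measurable
  have F: "(\<lambda>z. \<Prod>j\<in>J. h (fst (fst z) j) (snd (fst z) j) (snd z j)) \<in> borel_measurable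
      ((PiM UNIV (\<lambda>_. borel) \<Otimes>\<^sub>M PiM UNIV (\<lambda>_. cluster_algebra)) \<Otimes>\<^sub>M PiM UNIV (\<lambda>_. borel))"
    by measurable
  have G: "(\<lambda>z. \<Prod>j\<in>J. h' (fst z j) (snd z j)) \<in> borel_measurable
      (PiM UNIV (\<lambda>_. borel) \<Otimes>\<^sub>M PiM UNIV (\<lambda>_. cluster_algebra))"
    by measurable
  have "(\<integral>\<^sup>+\<omega>. (\<Prod>j\<in>J. h (U j \<omega>) (K j \<omega>) (S j \<omega>)) \<partial>M) =
      (\<integral>\<^sup>+\<omega>. \<integral>\<^sup>+\<omega>'. (\<Prod>j\<in>J. h (U j \<omega>) (K j \<omega>) (S j \<omega>')) \<partial>M \<partial>M)"
    using indep_elements_nn_integral[OF prob_space_axioms S_UK_indep F] by simp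
  also have "\<dots> = (\<integral>\<^sup>+\<omega>. (\<Prod>j\<in>J. h' (U j \<omega>) (K j \<omega>)) \<partial>M)"
  proof (rule nn_integral_cong)
    fix \<omega> assume \<omega>: "\<omega> \<in> space M"
    have K: "K j \<omega> \<in> space cluster_algebra" for j using measurable_space[OF measurable_K \<omega>] .
    have [measurable]: "h (U j \<omega>) (K j \<omega>) \<in> borel_measurable borel" for j
    proof -
      have "(\<lambda>s. (U j \<omega>, K j \<omega>, s)) \<in> measurable borel (borel \<Otimes>\<^sub>M cluster_algebra \<Otimes>\<^sub>M borel)"
        using K by measurable
      from measurable_compose[OF this h] show ?thesis by simp
    qed
    have "indep_vars (\<lambda>_. borel) S J" by (rule indep_vars_subset[OF S_indep]) simp
    then have "indep_vars (\<lambda>_. borel) (\<lambda>j \<omega>'. h (U j \<omega>) (K j \<omega>) (S j \<omega>')) J"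
      by (rule indep_vars_compose2) measurable
    then have "(\<integral>\<^sup>+\<omega>'. (\<Prod>j\<in>J. h (U j \<omega>) (K j \<omega>) (S j \<omega>')) \<partial>M) =
        (\<Prod>j\<in>J. \<integral>\<^sup>+\<omega>'. h (U j \<omega>) (K j \<omega>) (S j \<omega>') \<partial>M)"
      by (rule indep_vars_nn_integral[OF J]) simp
    then show "(\<integral>\<^sup>+\<omega>'. (\<Prod>j\<in>J. h (U j \<omega>) (K j \<omega>) (S j \<omega>')) \<partial>M) = (\<Prod>j\<in>J. h' (U j \<omega>) (K j \<omega>))"
      by (simp add: nn_integral_sign h'_def)
  qed
  also have "\<dots> = (\<integral>\<^sup>+\<omega>. \<integral>\<^sup>+\<omega>'. (\<Prod>j\<in>J. h' (U j \<omega>) (K j \<omega>')) \<partial>M \<partial>M)"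
    using indep_elements_nn_integral[OF prob_space_axioms U_K_indep G] by simp
  also have "\<dots> = (\<integral>\<^sup>+\<omega>. (\<Prod>j\<in>J. cluster_mean h (U j \<omega>)) \<partial>M)"
  proof (rule nn_integral_cong)
    fix \<omega> assume \<omega>: "\<omega> \<in> space M"
    have [measurable]: "h' (U j \<omega>) \<in> borel_measurable cluster_algebra" for j
      by measurable
    have "indep_vars (\<lambda>_. cluster_algebra) K J" by (rule indep_vars_subset[OF K_indep]) simp
    then have "indep_vars (\<lambda>_. borel) (\<lambda>j \<omega>'. h' (U j \<omega>) (K j \<omega>')) J"
      by (rule indep_vars_compose2) measurable
    then have "(\<integral>\<^sup>+\<omega>'. (\<Prod>j\<in>J. h' (U j \<omega>) (K j \<omega>')) \<partial>M) = (\<Prod>j\<in>J. \<integral>\<^sup>+\<omega>'. h' (U j \<omega>) (K j \<omega>') \<partial>M)"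
      by (rule indep_vars_nn_integral[OF J]) simp
    moreover have "(\<integral>\<^sup>+\<omega>'. h' u (K j \<omega>') \<partial>M) = cluster_mean h u" for u j
    proof -
      have [measurable]: "h' u \<in> borel_measurable cluster_algebra" by measurable
      have "(\<integral>\<^sup>+\<omega>'. h' u (K j \<omega>') \<partial>M) = (\<integral>\<^sup>+\<omega>'. h' u (C \<omega>') \<partial>P)"
        by (rule nn_integral_K) measurable
      then show ?thesis
        unfolding h'_def cluster_mean_def by (simp add: nn_integral_add nn_integral_cmult)
    qed
    ultimately show "(\<integral>\<^sup>+\<omega>'. (\<Prod>j\<in>J. h' (U j \<omega>) (K j \<omega>')) \<partial>M) = (\<Prod>j\<in>J. cluster_mean h (U j \<omega>))"
      by simp
  qed
  finally show ?thesis .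
qed

lemma nn_integral_N:
  assumes "\<omega> \<in> space M" "g \<in> borel_measurable borel"
  shows "(\<integral>\<^sup>+x. g x \<partial>N \<omega>) = (\<Sum>j. \<integral>\<^sup>+x. g (S j \<omega> * x + U j \<omega>) \<partial>K j \<omega>)"
  using assms K_counting sets_finite_simple_counting
  by (simp add: cluster_process_def nn_integral_superpose nn_integral_translate nn_integral_flip)

lemma measurable_cluster_integral [measurable]:
  assumes [measurable]: "g \<in> borel_measurable borel"
  shows "(\<lambda>(u, \<mu>, s). \<integral>\<^sup>+x. g (s * x + u) \<partial>\<mu>) \<in> borel_measurable (borel \<Otimes>\<^sub>M cluster_algebra \<Otimes>\<^sub>M borel)"
  unfolding split_beta by (rule measurable_nn_integral_cluster) measurable

lemma measurable_shifted_cluster_integral: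
  assumes [measurable]: "g \<in> borel_measurable borel"
  shows "(\<lambda>(u, \<omega>). \<integral>\<^sup>+x. g (s * x + u) \<partial>C \<omega>) \<in> borel_measurable (lborel \<Otimes>\<^sub>M P)"
  unfolding split_beta by (rule measurable_nn_integral_cluster) measurable

lemma measurable_N [measurable]: "N \<in> measurable M measure_algebra"
proof (rule measurable_measure_algebraI)
  fix A :: "real set" assume [measurable]: "A \<in> sets borel"
  have [measurable]: "(\<lambda>\<omega>. \<integral>\<^sup>+x. indicator A (S j \<omega> * x + U j \<omega>) \<partial>K j \<omega>) \<in> borel_measurable M" for j
    by (rule measurable_nn_integral_cluster) measurable
  have "(\<lambda>\<omega>. \<Sum>j. \<integral>\<^sup>+x. indicator A (S j \<omega> * x + U j \<omega>) \<partial>K j \<omega>) \<in> borel_measurable M"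
    by measurable
  moreover have "emeasure (N \<omega>) A = (\<integral>\<^sup>+x. indicator A x \<partial>N \<omega>)" for \<omega>
    by (rule emeasure_eq_nn_integral) (simp_all add: cluster_process_def)
  ultimately show "(\<lambda>\<omega>. emeasure (N \<omega>) A) \<in> borel_measurable M"
    by (simp add: nn_integral_N cong: measurable_cong del: nn_integral_indicator)
qed (simp add: cluster_process_def)

text \<open>Given the immigrants, the clusters are independent, so the conditional Laplace
  functional is the product of \<phi>(U j), where \<phi> is the mean cluster factor. With \<phi>
  written as \<open>eneg\<close> of \<open>neglog \<phi>\<close>, this is a Laplace functional of
  the Poisson process, and \<open>laplace_poisson\<close> returns the integral of 1 -
  \<phi>.\<close>

theorem laplace_N:
  assumes g [measurable]: "g \<in> borel_measurable borel"
  shows "(\<integral>\<^sup>+\<omega>. eneg (\<integral>\<^sup>+x. g x \<partial>N \<omega>) \<partial>M) =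
    eneg (ennreal \<nu> * (p * cluster_rate P C g + q * cluster_rate P C (\<lambda>x. g (- x))))"
proof -
  define h where "h u \<mu> s = eneg (\<integral>\<^sup>+x. g (s * x + u) \<partial>\<mu>)" for u \<mu> and s :: real
  have h [measurable]: "(\<lambda>(u, \<mu>, s). h u \<mu> s) \<in> borel_measurable (borel \<Otimes>\<^sub>M cluster_algebra \<Otimes>\<^sub>M borel)"
  proof -
    from measurable_compose[OF measurable_cluster_integral[OF g] measurable_eneg]
    show ?thesis by (simp add: h_def split_beta)
  qed
  note [measurable (raw)] = measurable_compose_triple[OF h]
  let ?\<phi> = "cluster_mean h"
  have int1: "(\<integral>\<^sup>+\<omega>. h u (C \<omega>) s \<partial>P) \<le> 1" for u s
  proof -
    have "(\<integral>\<^sup>+\<omega>. h u (C \<omega>) s \<partial>P) \<le> (\<integral>\<^sup>+\<omega>. 1 \<partial>P)"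
      by (intro nn_integral_mono) (simp add: h_def eneg_le_1)
    then show ?thesis by (simp add: P.emeasure_space_1)
  qed
  have \<phi>1: "?\<phi> u \<le> 1" for u
  proof -
    have "?\<phi> u \<le> p * 1 + q * 1"
      unfolding cluster_mean_def by (intro add_mono mult_left_mono int1) auto
    then show ?thesis by (simp add: p_add_q)
  qed
  \<comment> \<open>Infinite products are limits of finite ones, with 1 as dominating function. The
    fact is used for the cluster factors and for the averaged factors, whose finite products have
    equal means.\<close>
  have prefix: "(\<lambda>n. \<integral>\<^sup>+\<omega>. (\<Prod>j<n. eneg (a j \<omega>)) \<partial>M) \<longlonglongrightarrow> (\<integral>\<^sup>+\<omega>. eneg (\<Sum>j. a j \<omega>) \<partial>M)"
    if [measurable]: "\<And>j. a j \<in> borel_measurable M" for a :: "nat \<Rightarrow> 'a \<Rightarrow> ennreal"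
  proof -
    have "(\<lambda>n. \<integral>\<^sup>+\<omega>. eneg (\<Sum>j<n. a j \<omega>) \<partial>M) \<longlonglongrightarrow> (\<integral>\<^sup>+\<omega>. eneg (\<Sum>j. a j \<omega>) \<partial>M)"
    proof (rule nn_integral_dominated_convergence[where w="\<lambda>_. 1"])
      show "AE \<omega> in M. (\<lambda>n. eneg (\<Sum>j<n. a j \<omega>)) \<longlonglongrightarrow> eneg (\<Sum>j. a j \<omega>)"
        by (intro AE_I2 tendsto_eneg summable_LIMSEQ) simp
    qed (auto simp: eneg_le_1 emeasure_space_1)
    then show ?thesis by (simp add: eneg_sum)
  qed
  have [measurable]: "(\<lambda>\<omega>. \<integral>\<^sup>+x. g (S j \<omega> * x + U j \<omega>) \<partial>K j \<omega>) \<in> borel_measurable M" for j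
    by (rule measurable_nn_integral_cluster) measurable
  have 1: "(\<lambda>n. \<integral>\<^sup>+\<omega>. (\<Prod>j<n. h (U j \<omega>) (K j \<omega>) (S j \<omega>)) \<partial>M) \<longlonglongrightarrow>
      (\<integral>\<^sup>+\<omega>. eneg (\<Sum>j. \<integral>\<^sup>+x. g (S j \<omega> * x + U j \<omega>) \<partial>K j \<omega>) \<partial>M)"
    unfolding h_def by (rule prefix) measurable
  have 2: "(\<lambda>n. \<integral>\<^sup>+\<omega>. (\<Prod>j<n. eneg (neglog (?\<phi> (U j \<omega>)))) \<partial>M) \<longlonglongrightarrow>
      (\<integral>\<^sup>+\<omega>. eneg (\<Sum>j. neglog (?\<phi> (U j \<omega>))) \<partial>M)"
    by (rule prefix) measurable
  have "(\<integral>\<^sup>+\<omega>. eneg (\<integral>\<^sup>+x. g x \<partial>N \<omega>) \<partial>M) = (\<integral>\<^sup>+\<omega>. eneg (\<Sum>j. neglog (?\<phi> (U j \<omega>))) \<partial>M)"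
    using LIMSEQ_unique[OF 1] 2
    by (simp add: nn_integral_prod_clusters h eneg_neglog \<phi>1 nn_integral_N cong: nn_integral_cong)
  also have "\<dots> = eneg (ennreal \<nu> * (\<integral>\<^sup>+u. (1 - ?\<phi> u) \<partial>lborel))"
    by (subst laplace_poisson) (auto simp: eneg_neglog \<phi>1)
  also have "(\<integral>\<^sup>+u. (1 - ?\<phi> u) \<partial>lborel) =
      (\<integral>\<^sup>+u. p * (\<integral>\<^sup>+\<omega>. (1 - h u (C \<omega>) 1) \<partial>P) + q * (\<integral>\<^sup>+\<omega>. (1 - h u (C \<omega>) (- 1)) \<partial>P) \<partial>lborel)"
  proof (rule nn_integral_cong)
    fix u :: real
    have diff: "(\<integral>\<^sup>+\<omega>. (1 - h u (C \<omega>) s) \<partial>P) = 1 - (\<integral>\<^sup>+\<omega>. h u (C \<omega>) s \<partial>P)" for s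
      using int1[of u s]
      by (subst nn_integral_diff) (auto simp: P.emeasure_space_1 top_unique h_def eneg_le_1)
    have fin: "(\<integral>\<^sup>+\<omega>. h u (C \<omega>) s \<partial>P) \<noteq> \<top>" for s
      using int1[of u s] by (auto simp: top_unique)
    obtain a b where ab: "(\<integral>\<^sup>+\<omega>. h u (C \<omega>) 1 \<partial>P) = ennreal a" "0 \<le> a"
        "(\<integral>\<^sup>+\<omega>. h u (C \<omega>) (- 1) \<partial>P) = ennreal b" "0 \<le> b"
      using fin by (metis ennreal_cases infinity_ennreal_def)
    then have "a \<le> 1" "b \<le> 1" using int1[of u 1] int1[of u "- 1"] by (auto simp: ennreal_le_1)
    \<comment> \<open>Since the two sign probabilities sum to 1, the constant 1 is split between the
      two signs.\<close>
    have "1 - ?\<phi> u = p * (1 - ennreal a) + q * (1 - ennreal b)"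
      unfolding cluster_mean_def ab
      by (rule one_minus_convex_combination)
        (use ab \<theta> \<open>a \<le> 1\<close> \<open>b \<le> 1\<close> in \<open>auto simp: field_simps\<close>)
    then show "1 - ?\<phi> u = p * (\<integral>\<^sup>+\<omega>. (1 - h u (C \<omega>) 1) \<partial>P) + q * (\<integral>\<^sup>+\<omega>. (1 - h u (C \<omega>) (- 1)) \<partial>P)"
      by (simp add: diff ab)
  qed
  also have "\<dots> = p * (\<integral>\<^sup>+u. \<integral>\<^sup>+\<omega>. (1 - h u (C \<omega>) 1) \<partial>P \<partial>lborel) +
      q * (\<integral>\<^sup>+u. \<integral>\<^sup>+\<omega>. (1 - h u (C \<omega>) (- 1)) \<partial>P \<partial>lborel)"
  proof -
    have [measurable]: "(\<lambda>u. \<integral>\<^sup>+\<omega>. (1 - h u (C \<omega>) s) \<partial>P) \<in> borel_measurable lborel" for s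
      by (rule P.borel_measurable_nn_integral) measurable
    show ?thesis by (simp add: nn_integral_add nn_integral_cmult)
  qed
  also have "(\<integral>\<^sup>+u. \<integral>\<^sup>+\<omega>. (1 - h u (C \<omega>) 1) \<partial>P \<partial>lborel) = cluster_rate P C g"
    by (simp add: h_def cluster_rate_def)
  also have "(\<integral>\<^sup>+u. \<integral>\<^sup>+\<omega>. (1 - h u (C \<omega>) (- 1)) \<partial>P \<partial>lborel) =
      (\<integral>\<^sup>+u. \<integral>\<^sup>+\<omega>. (1 - h (0 + - 1 * u) (C \<omega>) (- 1)) \<partial>P \<partial>lborel)"
  \<comment> \<open>Replacing u by -u turns g(-x + u) into g(-(x + u)): a flipped cluster seen by g
    is an unflipped one seen by the reflected g.\<close>
  proof (subst nn_integral_real_affine[where c="- 1" and t=0])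
    show "(\<lambda>u. \<integral>\<^sup>+\<omega>. (1 - h u (C \<omega>) (- 1)) \<partial>P) \<in> borel_measurable borel"
      by (rule P.borel_measurable_nn_integral) measurable
  qed auto
  also have "\<dots> = cluster_rate P C (\<lambda>x. g (- x))"
    by (simp add: h_def cluster_rate_def)
  finally show ?thesis .
qed

text \<open>After Tonelli, translation invariance of Lebesgue measure erases the position of each
  cluster point, and with it the sign s. Only the number of points remains, which is why the
  intensity does not see \<theta>.\<close>

lemma nn_integral_shifted_cluster:
  assumes f [measurable]: "f \<in> borel_measurable borel"
  shows "(\<integral>\<^sup>+u. \<integral>\<^sup>+\<omega>. \<integral>\<^sup>+x. f (s * x + u) \<partial>C \<omega> \<partial>P \<partial>lborel) =
    (\<integral>\<^sup>+\<omega>. emeasure (C \<omega>) UNIV \<partial>P) * (\<integral>\<^sup>+x. f x \<partial>lborel)"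
proof -
  interpret pair_sigma_finite lborel P ..
  have "(\<integral>\<^sup>+u. \<integral>\<^sup>+\<omega>. (\<integral>\<^sup>+x. f (s * x + u) \<partial>C \<omega>) \<partial>P \<partial>lborel) = (\<integral>\<^sup>+\<omega>. \<integral>\<^sup>+u. (\<integral>\<^sup>+x. f (s * x + u) \<partial>C \<omega>) \<partial>lborel \<partial>P)"
    using measurable_shifted_cluster_integral[OF f, of s]
    by (intro Fubini'[symmetric]) simp
  also have "\<dots> = (\<integral>\<^sup>+\<omega>. emeasure (C \<omega>) UNIV * (\<integral>\<^sup>+x. f x \<partial>lborel) \<partial>P)"
  proof (rule nn_integral_cong)
    fix \<omega> assume \<omega>: "\<omega> \<in> space P"
    interpret C\<omega>: finite_measure "C \<omega>"
      by (rule finite_measure_finite_simple_counting[OF C_counting[OF \<omega>]])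
    interpret CL: pair_sigma_finite "C \<omega>" lborel ..
    have sets [measurable_cong]: "sets (C \<omega>) = sets borel"
      by (rule sets_finite_simple_counting[OF C_counting[OF \<omega>]])
    then have sp: "space (C \<omega>) = UNIV" using sets_eq_imp_space_eq[OF sets] by simp
    have "(\<integral>\<^sup>+u. (\<integral>\<^sup>+x. f (s * x + u) \<partial>C \<omega>) \<partial>lborel) = (\<integral>\<^sup>+x. \<integral>\<^sup>+u. f (s * x + u) \<partial>lborel \<partial>C \<omega>)"
      by (rule CL.Fubini') measurable
    also have "\<dots> = (\<integral>\<^sup>+x. \<integral>\<^sup>+u. f u \<partial>lborel \<partial>C \<omega>)"
      using nn_integral_real_affine[OF f, of 1] by simp
    finally show "(\<integral>\<^sup>+u. (\<integral>\<^sup>+x. f (s * x + u) \<partial>C \<omega>) \<partial>lborel) = emeasure (C \<omega>) UNIV * (\<integral>\<^sup>+x. f x \<partial>lborel)"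
      by (simp add: sp mult.commute)
  qed
  also have "\<dots> = (\<integral>\<^sup>+\<omega>. emeasure (C \<omega>) UNIV \<partial>P) * (\<integral>\<^sup>+x. f x \<partial>lborel)"
    by (intro nn_integral_multc measurable_compose[OF C measurable_emeasure_cluster_algebra]) simp
  finally show ?thesis .
qed

text \<open>The one-factor case of \<open>nn_integral_prod_clusters\<close> for each j, summed up by
  Campbell's formula. Both signs give the same integral, so their weights add to 1.\<close>

theorem mean_N:
  assumes f [measurable]: "f \<in> borel_measurable borel"
  shows "(\<integral>\<^sup>+\<omega>. \<integral>\<^sup>+x. f x \<partial>N \<omega> \<partial>M) =
    ennreal \<nu> * ((\<integral>\<^sup>+\<omega>. emeasure (C \<omega>) UNIV \<partial>P) * (\<integral>\<^sup>+x. f x \<partial>lborel))"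
proof -
  define h where "h u \<mu> s = (\<integral>\<^sup>+x. f (s * x + u) \<partial>\<mu>)" for u \<mu> and s :: real
  have h [measurable]: "(\<lambda>(u, \<mu>, s). h u \<mu> s) \<in> borel_measurable (borel \<Otimes>\<^sub>M cluster_algebra \<Otimes>\<^sub>M borel)"
    using measurable_cluster_integral[OF f] by (simp add: h_def split_beta)
  note [measurable (raw)] = measurable_compose_triple[OF h]
  have [measurable]: "(\<lambda>\<omega>. \<integral>\<^sup>+x. f (S j \<omega> * x + U j \<omega>) \<partial>K j \<omega>) \<in> borel_measurable M" for j
    by (rule measurable_nn_integral_cluster) measurable
  have "(\<integral>\<^sup>+\<omega>. \<integral>\<^sup>+x. f x \<partial>N \<omega> \<partial>M) = (\<Sum>j. \<integral>\<^sup>+\<omega>. h (U j \<omega>) (K j \<omega>) (S j \<omega>) \<partial>M)"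
    by (simp add: nn_integral_N nn_integral_suminf h_def cong: nn_integral_cong)
  also have "\<dots> = (\<Sum>j. \<integral>\<^sup>+\<omega>. cluster_mean h (U j \<omega>) \<partial>M)"
    using nn_integral_prod_clusters[of "{j}" h for j] by simp
  also have "\<dots> = ennreal \<nu> * (\<integral>\<^sup>+u. cluster_mean h u \<partial>lborel)"
    by (rule campbell_poisson) measurable
  also have "(\<integral>\<^sup>+u. cluster_mean h u \<partial>lborel) =
      p * (\<integral>\<^sup>+u. \<integral>\<^sup>+\<omega>. h u (C \<omega>) 1 \<partial>P \<partial>lborel) + q * (\<integral>\<^sup>+u. \<integral>\<^sup>+\<omega>. h u (C \<omega>) (- 1) \<partial>P \<partial>lborel)"
  proof -
    have [measurable]: "(\<lambda>u. \<integral>\<^sup>+\<omega>. h u (C \<omega>) s \<partial>P) \<in> borel_measurable lborel" for s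
      by (rule P.borel_measurable_nn_integral) measurable
    show ?thesis by (simp add: cluster_mean_def nn_integral_add nn_integral_cmult)
  qed
  also have "\<dots> = (\<integral>\<^sup>+\<omega>. emeasure (C \<omega>) UNIV \<partial>P) * (\<integral>\<^sup>+x. f x \<partial>lborel)"
    using nn_integral_shifted_cluster[OF f, of 1] nn_integral_shifted_cluster[OF f, of "- 1"]
    by (simp add: h_def p_add_q flip: distrib_right)
  finally show ?thesis .
qed

section \<open>Stationarity and local finiteness of the cluster process\<close>

lemma stationary_N: "stationary M N"
  unfolding stationary_def
proof (intro allI same_law_laplaceI)
  fix v and g :: "real \<Rightarrow> ennreal" assume g [measurable]: "g \<in> borel_measurable borel"
  have "(\<integral>\<^sup>+\<omega>. eneg (\<integral>\<^sup>+x. g x \<partial>translate v (N \<omega>)) \<partial>M) = (\<integral>\<^sup>+\<omega>. eneg (\<integral>\<^sup>+x. g (x + v) \<partial>N \<omega>) \<partial>M)"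
    using g by (simp add: nn_integral_translate cluster_process_def)
  \<comment> \<open>Both rates are translation invariant; in the reflected one the shift by v
    appears as a shift by -v.\<close>
  also have "\<dots> = (\<integral>\<^sup>+\<omega>. eneg (\<integral>\<^sup>+x. g x \<partial>N \<omega>) \<partial>M)"
    using cluster_rate_translate[OF P.prob_space_axioms C, of g v]
      cluster_rate_translate[OF P.prob_space_axioms C, of "\<lambda>x. g (- x)" "- v"]
    by (simp add: laplace_N add.commute)
  finally show "(\<integral>\<^sup>+\<omega>. eneg (\<integral>\<^sup>+x. g x \<partial>translate v (N \<omega>)) \<partial>M) = (\<integral>\<^sup>+\<omega>. eneg (\<integral>\<^sup>+x. g x \<partial>N \<omega>) \<partial>M)" .
qed (auto intro: prob_space_axioms measurable_compose[OF measurable_N measurable_translate])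

lemma emeasure_mean_N:
  assumes "A \<in> sets borel"
  shows "(\<integral>\<^sup>+\<omega>. emeasure (N \<omega>) A \<partial>M) = ennreal \<nu> * ((\<integral>\<^sup>+\<omega>. emeasure (C \<omega>) UNIV \<partial>P) * emeasure lborel A)"
  using mean_N[of "indicator A"] assms by (simp add: cluster_process_def)

text \<open>For every outcome the clusters are integer valued, so finiteness on countably many
  intervals is all that can fail. This describes the event by measurable conditions, on which the
  measurability of \<open>point_product (N \<omega>) h\<close> will rest.\<close>

lemma locally_finite_N_iff:
  assumes \<omega>: "\<omega> \<in> space M"
  shows "locally_finite_counting (N \<omega>) \<longleftrightarrow> (\<forall>n::nat. emeasure (N \<omega>) {- real n..real n} \<noteq> \<top>)"
proof
  assume l: "locally_finite_counting (N \<omega>)"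
  show "\<forall>n::nat. emeasure (N \<omega>) {- real n..real n} \<noteq> \<top>"
  proof
    fix n :: nat
    have "\<exists>k::nat. emeasure (N \<omega>) {- real n..real n} = of_nat k"
      using l by (simp add: locally_finite_counting_def)
    then show "emeasure (N \<omega>) {- real n..real n} \<noteq> \<top>" by auto
  qed
next
  assume fin_n: "\<forall>n::nat. emeasure (N \<omega>) {- real n..real n} \<noteq> \<top>"
  show "locally_finite_counting (N \<omega>)"
    unfolding locally_finite_counting_def
  proof (intro conjI ballI impI)
    show "sets (N \<omega>) = sets borel" by (simp add: cluster_process_def)
    fix A :: "real set" assume A: "A \<in> sets borel" "bounded A"
    then obtain r where r: "\<And>x. x \<in> A \<Longrightarrow> \<bar>x\<bar> \<le> r" by (auto simp: bounded_real)
    obtain n where "r \<le> real n" using real_arch_simple by blast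
    then have "A \<subseteq> {- real n..real n}" using r by (force simp: abs_le_iff)
    then have "emeasure (N \<omega>) A \<le> emeasure (N \<omega>) {- real n..real n}"
      by (intro emeasure_mono) (auto simp: cluster_process_def)
    then have fin: "emeasure (N \<omega>) A \<noteq> \<top>" using fin_n by (auto simp: top_unique)
    have K: "sets (K j \<omega>) = sets borel" "\<forall>B\<in>sets borel. \<exists>k::nat. emeasure (K j \<omega>) B = of_nat k" for j
      using K_counting[OF \<omega>] by (simp_all add: finite_simple_counting_def)
    have "emeasure (N \<omega>) A = (\<Sum>j. emeasure (translate (U j \<omega>) (flip (S j \<omega>) (K j \<omega>))) A)"
      using A by (simp add: cluster_process_def emeasure_superpose)
    moreover have "\<exists>k::nat. emeasure (translate (U j \<omega>) (flip (S j \<omega>) (K j \<omega>))) A = of_nat k" for j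
    proof -
      have "emeasure (translate (U j \<omega>) (flip (S j \<omega>) (K j \<omega>))) A =
          (\<integral>\<^sup>+x. indicator ((\<lambda>x. S j \<omega> * x + U j \<omega>) -` A) x \<partial>K j \<omega>)"
        using A K by (simp add: emeasure_eq_nn_integral[of "translate _ _"] nn_integral_translate nn_integral_flip
            indicator_vimage del: nn_integral_indicator)
      moreover have "(\<lambda>x. S j \<omega> * x + U j \<omega>) -` A \<in> sets borel"
        using measurable_sets[of "\<lambda>x. S j \<omega> * x + U j \<omega>" borel borel A] A by simp
      ultimately show ?thesis using K by simp
    qed
    ultimately show "\<exists>k::nat. emeasure (N \<omega>) A = of_nat k"
      using suminf_of_nat[of "\<lambda>j. emeasure (translate (U j \<omega>) (flip (S j \<omega>) (K j \<omega>))) A"] fin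
      by simp
  qed
qed

lemma point_process_N:
  assumes fin: "(\<integral>\<^sup>+\<omega>. emeasure (C \<omega>) UNIV \<partial>P) < \<top>"
  shows "point_process M N"
  unfolding point_process_def
proof
  show "N \<in> measurable M measure_algebra" by measurable
  have "AE \<omega> in M. \<forall>n::nat. emeasure (N \<omega>) {- real n..real n} \<noteq> \<infinity>"
    unfolding AE_all_countable
  proof
    fix n :: nat
    have "(\<integral>\<^sup>+\<omega>. emeasure (N \<omega>) {- real n..real n} \<partial>M) < \<top>"
      using fin by (simp add: emeasure_mean_N ennreal_mult_less_top)
    then show "AE \<omega> in M. emeasure (N \<omega>) {- real n..real n} \<noteq> \<infinity>"
      by (intro nn_integral_PInf_AE)
        (auto intro: measurable_compose[OF measurable_N measurable_emeasure_measure_algebra])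
  qed
  then show "AE \<omega> in M. locally_finite_counting (N \<omega>)"
    using AE_space by eventually_elim (simp add: locally_finite_N_iff)
qed

end

section \<open>Atoms of counting measures\<close>

definition atoms :: "real measure \<Rightarrow> real set" where
  "atoms \<mu> = {x. emeasure \<mu> {x} \<noteq> 0}"

text \<open>An atom of an integer-valued measure weighs at least 1, so the mass of B bounds the size
  of every finite set of atoms in B.\<close>

lemma card_atoms_le:
  assumes sets: "sets \<mu> = sets borel"
    and nat: "\<And>x. \<exists>k::nat. emeasure \<mu> {x} = of_nat k"
    and B: "B \<in> sets borel" "emeasure \<mu> B = of_nat k"
  shows "finite (atoms \<mu> \<inter> B) \<and> card (atoms \<mu> \<inter> B) \<le> k"
proof (rule finite_if_finite_subsets_card_bdd)
  fix F assume F: "F \<subseteq> atoms \<mu> \<inter> B" "finite F"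
  have "(of_nat (card F) :: ennreal) = (\<Sum>x\<in>F. 1)" by simp
  also have "\<dots> \<le> (\<Sum>x\<in>F. emeasure \<mu> {x})"
  proof (rule sum_mono)
    fix x assume "x \<in> F"
    then have "emeasure \<mu> {x} \<noteq> 0" using F by (auto simp: atoms_def)
    moreover obtain n :: nat where "emeasure \<mu> {x} = of_nat n" using nat by blast
    ultimately show "1 \<le> emeasure \<mu> {x}" by (cases n) auto
  qed
  also have "\<dots> = emeasure \<mu> F"
    using F(2) by (intro emeasure_eq_sum_singleton[symmetric]) (auto simp: sets)
  also have "\<dots> \<le> emeasure \<mu> B"
    using F B(1) by (intro emeasure_mono) (auto simp: sets)
  finally show "card F \<le> k" by (simp add: B(2))
qed

lemma finite_atoms:
  assumes \<mu>: "locally_finite_counting \<mu>" and A: "bounded A"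
  shows "finite (atoms \<mu> \<inter> A)"
proof -
  obtain r where r: "\<And>x. x \<in> A \<Longrightarrow> \<bar>x\<bar> \<le> r" using A by (auto simp: bounded_real)
  have sets: "sets \<mu> = sets borel"
    and nat: "\<And>B. B \<in> sets borel \<Longrightarrow> bounded B \<Longrightarrow> \<exists>k::nat. emeasure \<mu> B = of_nat k"
    using \<mu> by (auto simp: locally_finite_counting_def)
  obtain k :: nat where k: "emeasure \<mu> {- r..r} = of_nat k" using nat[of "{- r..r}"] by auto
  have "finite (atoms \<mu> \<inter> {- r..r})"
    using card_atoms_le[OF sets _ _ k] nat by simp
  moreover have "atoms \<mu> \<inter> A \<subseteq> atoms \<mu> \<inter> {- r..r}"
    using r by (auto simp: abs_le_iff minus_le_iff)
  ultimately show ?thesis by (rule finite_subset[rotated])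
qed

lemma countable_atoms:
  assumes "locally_finite_counting \<mu>"
  shows "countable (atoms \<mu>)"
proof -
  have "atoms \<mu> = (\<Union>n. atoms \<mu> \<inter> {- real n..real n})"
  proof
    show "atoms \<mu> \<subseteq> (\<Union>n. atoms \<mu> \<inter> {- real n..real n})"
    proof
      fix x assume "x \<in> atoms \<mu>"
      moreover obtain n where "\<bar>x\<bar> \<le> real n" using real_arch_simple by blast
      ultimately have "x \<in> atoms \<mu> \<inter> {- real n..real n}" by auto
      then show "x \<in> (\<Union>n. atoms \<mu> \<inter> {- real n..real n})" by blast
    qed
  qed auto
  moreover have "countable (atoms \<mu> \<inter> {- real n..real n})" for n
    by (rule countable_finite[OF finite_atoms[OF assms]]) simp
  then have "countable (\<Union>n. atoms \<mu> \<inter> {- real n..real n})" by (intro countable_UN) auto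
  ultimately show ?thesis by simp
qed

text \<open>An integer-valued measure vanishes on a punctured neighbourhood of every point, so by the
  Lindelof property it is carried by its atoms.\<close>

lemma AE_atoms:
  assumes \<mu>: "locally_finite_counting \<mu>"
  shows "AE x in \<mu>. x \<in> atoms \<mu>"
proof -
  have sets: "sets \<mu> = sets borel"
    and nat: "\<And>B. B \<in> sets borel \<Longrightarrow> bounded B \<Longrightarrow> \<exists>k::nat. emeasure \<mu> B = of_nat k"
    using \<mu> by (auto simp: locally_finite_counting_def)
  have atoms_sets: "- atoms \<mu> \<in> sets borel"
    by (rule borel_comp, rule sets.countable[OF _ countable_atoms[OF \<mu>]]) simp
  have "\<exists>r>0. emeasure \<mu> (ball x r - {x}) = 0" for x
  proof -
    \<comment> \<open>Punctured balls shrink to the empty set. Their masses are finite and tend to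
      0, so one of them is an integer below 1, hence 0.\<close>
    define B where "B n = ball x (inverse (real (Suc n))) - {x}" for n
    have B: "B n \<in> sets borel" "bounded (B n)" for n
      by (auto simp: B_def intro: bounded_subset[OF bounded_ball])
    have "(\<lambda>n. emeasure \<mu> (B n)) \<longlonglongrightarrow> emeasure \<mu> (\<Inter>n. B n)"
    proof (rule Lim_emeasure_decseq)
      show "range B \<subseteq> sets \<mu>" using B sets by auto
      show "decseq B"
        unfolding B_def by (intro decseq_SucI Diff_mono subset_ball le_imp_inverse_le) auto
      show "emeasure \<mu> (B n) \<noteq> \<infinity>" for n
        using nat[OF B[of n]] by auto
    qed
    moreover have "(\<Inter>n. B n) = {}"
    proof -
      have False if "\<And>n. y \<in> B n" for y
      proof -
        have "y \<noteq> x" using that[of 0] by (auto simp: B_def)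
        then obtain n where "inverse (real (Suc n)) < dist x y"
          using reals_Archimedean[of "dist x y"] by auto
        with that[of n] show False by (auto simp: B_def)
      qed
      then show ?thesis by blast
    qed
    ultimately have "(\<lambda>n. emeasure \<mu> (B n)) \<longlonglongrightarrow> 0" by simp
    then have "eventually (\<lambda>n. emeasure \<mu> (B n) < 1) sequentially" by (rule order_tendstoD) simp
    then obtain n where n: "emeasure \<mu> (B n) < 1" by (auto simp: eventually_sequentially)
    moreover obtain k :: nat where "emeasure \<mu> (B n) = of_nat k" using nat[OF B[of n]] by auto
    ultimately have "emeasure \<mu> (B n) = 0" by (cases k) auto
    then show ?thesis unfolding B_def by (intro exI[of _ "inverse (real (Suc n))"]) simp
  qed
  then obtain r where r: "\<And>x. 0 < r x" "\<And>x. emeasure \<mu> (ball x (r x) - {x}) = 0" by metis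
  obtain \<F> where \<F>: "\<F> \<subseteq> range (\<lambda>x. ball x (r x))" "countable \<F>" "\<Union>\<F> = (\<Union>x. ball x (r x))"
    using Lindelof[of "range (\<lambda>x. ball x (r x))"] by auto
  have "(\<Union>W\<in>\<F>. W - atoms \<mu>) \<in> null_sets \<mu>"
  proof (rule null_sets_UN')
    fix W assume "W \<in> \<F>"
    then obtain x where W: "W = ball x (r x)" using \<F> by auto
    have "W - atoms \<mu> \<subseteq> (ball x (r x) - {x}) \<union> ({x} - atoms \<mu>)" using W by auto
    moreover have X: "{x} - atoms \<mu> = (if x \<in> atoms \<mu> then {} else {x})" by auto
    then have "emeasure \<mu> ({x} - atoms \<mu>) = 0" by (simp add: atoms_def)
    moreover have "{x} - atoms \<mu> \<in> sets \<mu>" unfolding X by (simp add: sets)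
    ultimately have sub: "W - atoms \<mu> \<subseteq> (ball x (r x) - {x}) \<union> ({x} - atoms \<mu>)"
      and "{x} - atoms \<mu> \<in> null_sets \<mu>"
      by (auto intro: null_setsI)
    moreover have "ball x (r x) - {x} \<in> null_sets \<mu>"
      using r(2)[of x] by (intro null_setsI) (auto simp: sets)
    ultimately have "(ball x (r x) - {x}) \<union> ({x} - atoms \<mu>) \<in> null_sets \<mu>"
      by (intro null_sets.Un)
    moreover have "W - atoms \<mu> \<in> sets \<mu>"
      using sets.Int[of W borel "- atoms \<mu>"] atoms_sets W by (auto simp: sets Diff_eq)
    ultimately show "W - atoms \<mu> \<in> null_sets \<mu>" using sub by (blast intro: null_sets_subset)
  qed (fact \<F>(2))
  moreover have "(\<Union>W\<in>\<F>. W - atoms \<mu>) = - atoms \<mu>"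
  proof -
    have "x \<in> \<Union>\<F>" for x using r(1)[of x] \<F>(3) centre_in_ball[of x "r x"] by blast
    then show ?thesis by blast
  qed
  ultimately show ?thesis by (intro AE_I[of _ _ "- atoms \<mu>"]) auto
qed

lemma nn_integral_counting:
  assumes \<mu>: "locally_finite_counting \<mu>" and g: "g \<in> borel_measurable borel"
    and F: "finite F" "F \<subseteq> atoms \<mu>" "\<And>x. x \<in> atoms \<mu> \<Longrightarrow> g x \<noteq> 0 \<Longrightarrow> x \<in> F"
  shows "(\<integral>\<^sup>+x. g x \<partial>\<mu>) = (\<Sum>x\<in>F. g x * emeasure \<mu> {x})"
proof -
  have sets: "sets \<mu> = sets borel" using \<mu> by (simp add: locally_finite_counting_def)
  have "(\<integral>\<^sup>+x. g x \<partial>\<mu>) = (\<integral>\<^sup>+x. (\<Sum>y\<in>F. g y * indicator {y} x) \<partial>\<mu>)"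
    using AE_atoms[OF \<mu>]
  proof (intro nn_integral_cong_AE, eventually_elim)
    case (elim x)
    have "(\<Sum>y\<in>F. g y * indicator {y} x) = (\<Sum>y\<in>F. if y = x then g y else 0)"
      by (intro sum.cong) (auto simp: indicator_def)
    with elim F show ?case by (auto simp: sum.delta)
  qed
  also have "\<dots> = (\<Sum>x\<in>F. g x * emeasure \<mu> {x})"
    by (subst nn_integral_sum) (auto simp: sets nn_integral_cmult_indicator cong: measurable_cong_sets)
  finally show ?thesis .
qed

lemma finite_simple_counting_locally_finite:
  "finite_simple_counting \<mu> \<Longrightarrow> locally_finite_counting \<mu>"
  by (simp add: finite_simple_counting_def locally_finite_counting_def)

lemma finite_atoms_finite_simple_counting:
  assumes "finite_simple_counting \<mu>"
  shows "finite (atoms \<mu>)"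
proof -
  have \<mu>: "sets \<mu> = sets borel" "\<forall>A\<in>sets borel. \<exists>k::nat. emeasure \<mu> A = of_nat k"
    using assms by (simp_all add: finite_simple_counting_def)
  have "\<exists>k::nat. emeasure \<mu> UNIV = of_nat k" using \<mu>(2) by (rule bspec) simp
  then obtain k :: nat where "emeasure \<mu> UNIV = of_nat k" ..
  from card_atoms_le[OF \<mu>(1) _ _ this] \<mu>(2) show ?thesis by simp
qed

lemma emeasure_atom:
  assumes "finite_simple_counting \<mu>" "x \<in> atoms \<mu>"
  shows "emeasure \<mu> {x} = 1"
proof -
  have "\<exists>k::nat. emeasure \<mu> {x} = of_nat k" "emeasure \<mu> {x} \<le> 1"
    using assms(1) by (simp_all add: finite_simple_counting_def)
  then obtain k :: nat where "emeasure \<mu> {x} = of_nat k" "k \<le> 1" by auto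
  with assms(2) show ?thesis by (cases k) (auto simp: atoms_def)
qed

lemma nn_integral_finite_simple_counting:
  assumes \<mu>: "finite_simple_counting \<mu>" and g: "g \<in> borel_measurable borel"
  shows "(\<integral>\<^sup>+x. g x \<partial>\<mu>) = (\<Sum>x\<in>atoms \<mu>. g x)"
  using nn_integral_counting[OF finite_simple_counting_locally_finite[OF \<mu>] g
      finite_atoms_finite_simple_counting[OF \<mu>]]
  by (simp add: emeasure_atom[OF \<mu>])

lemma emeasure_UNIV_finite_simple_counting:
  assumes "finite_simple_counting \<mu>"
  shows "emeasure \<mu> UNIV = of_nat (card (atoms \<mu>))"
  using nn_integral_finite_simple_counting[OF assms, of "\<lambda>_. 1"]
    sets_eq_imp_space_eq[OF sets_finite_simple_counting[OF assms]] by simp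

text \<open>The bridge from generating functionals to Laplace functionals: the test function is -ln
  h, nonnegative because h lies in (0, 1]. Bounded support of h - 1 leaves finitely many atoms to
  multiply over.\<close>

lemma point_product_eq_eneg:
  assumes \<mu>: "locally_finite_counting \<mu>" and h: "h \<in> borel_measurable borel"
    and h1: "\<And>x. 0 < h x" "\<And>x. h x \<le> 1" and bd: "bounded {x. h x \<noteq> 1}"
  shows "ennreal (point_product \<mu> h) = eneg (\<integral>\<^sup>+x. ennreal (- ln (h x)) \<partial>\<mu>)"
proof -
  define F where "F = {x. emeasure \<mu> {x} \<noteq> 0 \<and> h x \<noteq> 1}"
  have F: "finite F" "F \<subseteq> atoms \<mu>"
    using finite_atoms[OF \<mu> bd] by (auto simp: F_def atoms_def Int_def)
  have "(\<integral>\<^sup>+x. ennreal (- ln (h x)) \<partial>\<mu>) = (\<Sum>x\<in>F. ennreal (- ln (h x)) * emeasure \<mu> {x})"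
    using h F by (intro nn_integral_counting[OF \<mu>]) (auto simp: F_def atoms_def)
  then have "eneg (\<integral>\<^sup>+x. ennreal (- ln (h x)) \<partial>\<mu>) = (\<Prod>x\<in>F. eneg (ennreal (- ln (h x)) * emeasure \<mu> {x}))"
    by (simp add: eneg_sum)
  also have "\<dots> = (\<Prod>x\<in>F. ennreal (h x ^ nat \<lfloor>measure \<mu> {x}\<rfloor>))"
  proof (rule prod.cong[OF refl])
    fix x
    have "\<exists>n::nat. emeasure \<mu> {x} = of_nat n" using \<mu> by (simp add: locally_finite_counting_def)
    then obtain n :: nat where n: "emeasure \<mu> {x} = of_nat n" ..
    then have "measure \<mu> {x} = real n" by (simp add: measure_def)
    moreover have "eneg (of_nat n * ennreal (- ln (h x))) = ennreal (h x) ^ n"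
      using h1[of x] by (simp add: eneg_of_nat_mult)
    ultimately show "eneg (ennreal (- ln (h x)) * emeasure \<mu> {x}) = ennreal (h x ^ nat \<lfloor>measure \<mu> {x}\<rfloor>)"
      using n h1[of x] by (simp add: mult.commute ennreal_power)
  qed
  also have "\<dots> = ennreal (point_product \<mu> h)"
    using \<mu> h1 less_imp_le[OF h1(1)] by (simp add: prod_ennreal point_product_def F_def)
  finally show ?thesis by simp
qed

section \<open>Mixed left derivatives\<close>

lemma has_left_derivative_iff:
  "(G has_real_derivative D) (at 0 within {..0}) \<longleftrightarrow> ((\<lambda>z. (G z - G 0) / z) \<longlongrightarrow> D) (at_left (0::real))"
  by (simp add: has_field_derivative_iff at_within_Iic_at_left)

lemma has_left_derivative_unique:
  assumes "(G has_real_derivative D) (at 0 within {..0})" "(G' has_real_derivative D') (at 0 within {..0})"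
    and "0 < \<epsilon>" "\<And>x. x \<in> {-\<epsilon><..0} \<Longrightarrow> G x = G' x"
  shows "D = D'"
proof -
  have "eventually (\<lambda>x. x \<in> {- \<epsilon><..<0}) (at_left 0)" using assms(3) by (intro eventually_at_leftI[of "- \<epsilon>"]) auto
  then have "eventually (\<lambda>x. (G x - G 0) / x = (G' x - G' 0) / x) (at_left 0)"
    by eventually_elim (use assms(3,4) in auto)
  with assms(1) have "((\<lambda>x. (G' x - G' 0) / x) \<longlongrightarrow> D) (at_left 0)"
    unfolding has_left_derivative_iff by (rule Lim_transform_eventually)
  then show ?thesis using assms(2) unfolding has_left_derivative_iff
    by (intro tendsto_unique[OF trivial_limit_at_left_real])
qed

text \<open>Through this lemma the generating functional determines the integral of products of test
  functions against any cumulant measure, even if two such measures are given as different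
  pairs.\<close>

lemma mixed_left_deriv_unique:
  "mixed_left_deriv n L s D \<Longrightarrow> mixed_left_deriv n L s D' \<Longrightarrow> D = D'"
proof (induction n arbitrary: s D D')
  case (Suc n)
  from Suc.prems(1) obtain G \<epsilon> where G: "0 < \<epsilon>" "\<And>x. x \<in> {-\<epsilon><..0} \<Longrightarrow> mixed_left_deriv n L (s(n := x)) (G x)"
    "(G has_real_derivative D) (at 0 within {..0})" unfolding mixed_left_deriv.simps by blast
  from Suc.prems(2) obtain G' \<epsilon>' where G': "0 < \<epsilon>'" "\<And>x. x \<in> {-\<epsilon>'<..0} \<Longrightarrow> mixed_left_deriv n L (s(n := x)) (G' x)"
    "(G' has_real_derivative D') (at 0 within {..0})" unfolding mixed_left_deriv.simps by blast
  show ?case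
  proof (rule has_left_derivative_unique[OF G(3) G'(3)])
    show "0 < min \<epsilon> \<epsilon>'" using G G' by simp
    show "G x = G' x" if "x \<in> {- min \<epsilon> \<epsilon>'<..0}" for x
      using that by (intro Suc.IH[OF G(2) G'(2)]) auto
  qed
qed simp

lemma mixed_left_deriv_linear:
  "mixed_left_deriv n L s D \<Longrightarrow> mixed_left_deriv n L' s D' \<Longrightarrow>
    mixed_left_deriv n (\<lambda>s. a * L s + b * L' s) s (a * D + b * D')"
proof (induction n arbitrary: s D D')
  case (Suc n)
  from Suc.prems(1) obtain G \<epsilon> where G: "0 < \<epsilon>" "\<And>x. x \<in> {-\<epsilon><..0} \<Longrightarrow> mixed_left_deriv n L (s(n := x)) (G x)"
    "(G has_real_derivative D) (at 0 within {..0})" unfolding mixed_left_deriv.simps by blast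
  from Suc.prems(2) obtain G' \<epsilon>' where G': "0 < \<epsilon>'" "\<And>x. x \<in> {-\<epsilon>'<..0} \<Longrightarrow> mixed_left_deriv n L' (s(n := x)) (G' x)"
    "(G' has_real_derivative D') (at 0 within {..0})" unfolding mixed_left_deriv.simps by blast
  show ?case unfolding mixed_left_deriv.simps
  proof (intro exI conjI ballI)
    show "0 < min \<epsilon> \<epsilon>'" using G G' by simp
    show "mixed_left_deriv n (\<lambda>s. a * L s + b * L' s) (s(n := x)) (a * G x + b * G' x)"
      if "x \<in> {- min \<epsilon> \<epsilon>'<..0}" for x
      using that by (intro Suc.IH G(2) G'(2)) auto
    show "((\<lambda>x. a * G x + b * G' x) has_real_derivative a * D + b * D') (at 0 within {..0})"
      by (intro derivative_intros DERIV_cmult G(3) G'(3))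
  qed
qed simp

text \<open>The derivative at the origin sees only small nonpositive parameters. The closed form of
  the generating functional is available only there, so this localization is needed to use
  it.\<close>

lemma mixed_left_deriv_cong:
  assumes "0 < \<delta>"
  shows "mixed_left_deriv n L s D \<Longrightarrow>
    (\<And>t. (\<And>j. j < n \<Longrightarrow> t j \<in> {-\<delta><..0}) \<Longrightarrow> (\<And>j. n \<le> j \<Longrightarrow> t j = s j) \<Longrightarrow> L t = L' t) \<Longrightarrow>
    mixed_left_deriv n L' s D"
proof (induction n arbitrary: s D)
  case (Suc n)
  from Suc.prems(1) obtain G \<epsilon> where G: "0 < \<epsilon>" "\<And>x. x \<in> {-\<epsilon><..0} \<Longrightarrow> mixed_left_deriv n L (s(n := x)) (G x)"
    "(G has_real_derivative D) (at 0 within {..0})" unfolding mixed_left_deriv.simps by blast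
  show ?case unfolding mixed_left_deriv.simps
  proof (intro exI conjI ballI)
    show "0 < min \<epsilon> \<delta>" using G(1) assms by simp
    show "mixed_left_deriv n L' (s(n := x)) (G x)" if x: "x \<in> {- min \<epsilon> \<delta><..0}" for x
    proof (rule Suc.IH)
      show "mixed_left_deriv n L (s(n := x)) (G x)" using x by (intro G(2)) auto
      fix t assume t: "\<And>j. j < n \<Longrightarrow> t j \<in> {-\<delta><..0}" "\<And>j. n \<le> j \<Longrightarrow> t j = (s(n := x)) j"
      show "L t = L' t"
      proof (rule Suc.prems(2))
        show "t j \<in> {-\<delta><..0}" if "j < Suc n" for j
          using that t(1)[of j] t(2)[of n] x by (cases "j = n") auto
        show "t j = s j" if "Suc n \<le> j" for j using that t(2)[of j] by auto
      qed
    qed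
  qed (fact G(3))
qed simp

text \<open>The lower bound 1/2 keeps -ln of the factor at most ln 2, which makes the cluster rate
  finite; the upper bound 1 makes it nonnegative.\<close>

lemma test_functions_factor_bounds:
  fixes n :: nat
  assumes f: "\<And>j. j < n \<Longrightarrow> test_function (f j)"
  shows "\<exists>\<delta>>0. \<forall>s x. (\<forall>j<n. s j \<in> {-\<delta><..0}) \<longrightarrow>
      1 / 2 \<le> 1 + (\<Sum>j<n. s j * f j x) \<and> 1 + (\<Sum>j<n. s j * f j x) \<le> 1"
proof -
  obtain b where b: "\<And>j x. j < n \<Longrightarrow> 0 \<le> f j x \<and> f j x \<le> b j"
    using f unfolding test_function_def by metis
  define B where "B = 1 + (\<Sum>j<n. \<bar>b j\<bar>)"
  have B: "f j x \<le> B" if "j < n" for j x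
  proof -
    have "f j x \<le> \<bar>b j\<bar>" using b[OF that, of x] by linarith
    also have "\<dots> \<le> (\<Sum>j<n. \<bar>b j\<bar>)" using that by (intro member_le_sum) auto
    finally show ?thesis by (simp add: B_def)
  qed
  have B1: "1 \<le> B" unfolding B_def by (simp add: sum_nonneg)
  \<comment> \<open>With values of the f j at most B, each summand is at least -1/(2 (n + 1)), and n
    of them stay above -1/2. Using n + 1 avoids a division by zero for n = 0.\<close>
  show ?thesis
  proof (intro exI[of _ "1 / (2 * (real n + 1) * B)"] conjI[of "0 < _"] allI impI)
    show "0 < 1 / (2 * (real n + 1) * B)" using B1 by simp
    fix s x assume "\<forall>j<n. s j \<in> {- (1 / (2 * (real n + 1) * B))<..0}"
    then have s: "\<And>j. j < n \<Longrightarrow> s j \<in> {- (1 / (2 * (real n + 1) * B))<..0}" by blast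
    have "- (1 / (2 * (real n + 1))) \<le> s j * f j x" if "j < n" for j
    proof -
      have "- (s j * f j x) \<le> (1 / (2 * (real n + 1) * B)) * B"
        using s[OF that] b[OF that, of x] B[OF that, of x] B1
        by (subst mult_minus_left[symmetric]) (intro mult_mono, auto)
      then show ?thesis using B1 by simp
    qed
    then have "(\<Sum>j<n. - (1 / (2 * (real n + 1)))) \<le> (\<Sum>j<n. s j * f j x)" by (intro sum_mono) auto
    moreover have "(\<Sum>j<n. - (1 / (2 * (real n + 1)))) \<ge> - (1 / 2)" by (simp add: field_simps)
    moreover have "(\<Sum>j<n. s j * f j x) \<le> 0"
      using s b by (intro sum_nonpos mult_nonpos_nonneg) auto
    ultimately show "1 / 2 \<le> 1 + (\<Sum>j<n. s j * f j x) \<and> 1 + (\<Sum>j<n. s j * f j x) \<le> 1" by linarith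
  qed
qed

lemma test_functions_bounded_support:
  fixes n :: nat
  assumes "\<And>j. j < n \<Longrightarrow> test_function (f j)"
  shows "bounded {x. 1 + (\<Sum>j<n. s j * f j x) \<noteq> (1::real)}"
proof (rule bounded_subset)
  show "bounded (\<Union>j\<in>{..<n}. {x. f j x \<noteq> 0})"
    using assms by (intro bounded_UN) (auto simp: test_function_def)
  show "{x. 1 + (\<Sum>j<n. s j * f j x) \<noteq> 1} \<subseteq> (\<Union>j\<in>{..<n}. {x. f j x \<noteq> 0})"
    by (force intro: sum.neutral)
qed

lemma test_function_uminus: "test_function f \<Longrightarrow> test_function (\<lambda>x. f (- x))"
  unfolding test_function_def bounded_real by (auto intro: measurable_compose[rotated]) (metis minus_minus abs_minus)

section \<open>The probability generating functional of a cluster process\<close>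

text \<open>Multiplied by -\<nu>, this is the logarithm of the probability generating functional for
  \<theta> = 1, for factors h between 1/2 and 1 with h - 1 a combination of test functions. There
  the rate is finite, so \<open>enn2real\<close> loses nothing.\<close>

definition pgfl_rate :: "'p measure \<Rightarrow> ('p \<Rightarrow> real measure) \<Rightarrow> (real \<Rightarrow> real) \<Rightarrow> real" where
  "pgfl_rate P C h = enn2real (cluster_rate P C (\<lambda>x. ennreal (- ln (h x))))"

locale cluster_model_mean = cluster_model M \<nu> U P C K S \<theta>
  for M :: "'a measure" and \<nu> U and P :: "'p measure" and C K S \<theta> +
  assumes finite_mean: "(\<integral>\<^sup>+\<omega>. emeasure (C \<omega>) UNIV \<partial>P) < \<top>"
begin

text \<open>By 1 - exp(-x) \<le> x the rate is at most the mean cluster size times the integral of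
  -ln h, which is bounded by ln 2 on a bounded interval.\<close>

lemma cluster_rate_finite:
  assumes h [measurable]: "h \<in> borel_measurable borel"
    and h1: "\<And>x. 1 / 2 \<le> h x" and bd: "bounded {x. h x \<noteq> 1}"
  shows "cluster_rate P C (\<lambda>x. ennreal (- ln (h x))) < \<top>"
proof -
  obtain r where r: "\<And>x. h x \<noteq> 1 \<Longrightarrow> \<bar>x\<bar> \<le> r" using bd by (auto simp: bounded_real)
  have le: "ennreal (- ln (h x)) \<le> ennreal (ln 2) * indicator {- r..r} x" for x
  proof (cases "h x = 1")
    case False
    have "ln (1 / 2) \<le> ln (h x)" using h1[of x] by (subst ln_le_cancel_iff) auto
    then have "- ln (h x) \<le> ln 2" by (simp add: ln_div)
    moreover have "x \<in> {- r..r}" using r[OF False] by (auto simp: abs_le_iff)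
    ultimately show ?thesis by (simp add: ennreal_leI)
  qed simp
  have "cluster_rate P C (\<lambda>x. ennreal (- ln (h x))) \<le>
      (\<integral>\<^sup>+u. \<integral>\<^sup>+\<omega>. \<integral>\<^sup>+x. ennreal (- ln (h (1 * x + u))) \<partial>C \<omega> \<partial>P \<partial>lborel)"
    unfolding cluster_rate_def by (intro nn_integral_mono) (simp add: one_minus_eneg_le)
  also have "\<dots> = (\<integral>\<^sup>+\<omega>. emeasure (C \<omega>) UNIV \<partial>P) * (\<integral>\<^sup>+x. ennreal (- ln (h x)) \<partial>lborel)"
    by (rule nn_integral_shifted_cluster) measurable
  also have "\<dots> \<le> (\<integral>\<^sup>+\<omega>. emeasure (C \<omega>) UNIV \<partial>P) * (\<integral>\<^sup>+x. ennreal (ln 2) * indicator {- r..r} x \<partial>lborel)"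
    by (intro mult_left_mono nn_integral_mono le) auto
  also have "\<dots> < \<top>"
    using finite_mean by (simp add: nn_integral_cmult_indicator ennreal_mult_less_top emeasure_lborel_Icc_eq)
  finally show ?thesis .
qed

text \<open>The logarithm of the generating functional is affine in \<theta> exactly, not just to
  some order, so each of its derivatives is the same mixture. Besides the Laplace functional this
  requires measurability of the point product, as it occurs in a Bochner integral.\<close>

lemma log_pgfl_N:
  assumes f: "\<And>j. j < n \<Longrightarrow> test_function (f j)"
    and h: "\<And>x. h x = 1 + (\<Sum>j<n. s j * f j x)" and h1: "\<And>x. 1 / 2 \<le> h x" "\<And>x. h x \<le> 1"
  shows "log_pgfl M N n f s =
    - \<nu> * ((1 + \<theta>) / 2 * pgfl_rate P C h + (1 - \<theta>) / 2 * pgfl_rate P C (\<lambda>x. h (- x)))"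
proof -
  have hm [measurable]: "h \<in> borel_measurable borel"
  proof -
    have "(\<lambda>x. 1 + (\<Sum>j<n. s j * f j x)) \<in> borel_measurable borel"
      using f by (intro borel_measurable_add borel_measurable_sum borel_measurable_times) (auto simp: test_function_def)
    then show ?thesis by (simp add: h[abs_def])
  qed
  have bd: "bounded {x. h x \<noteq> 1}" using test_functions_bounded_support[of n f s] f by (simp add: h)
  then have bd': "bounded {x. h (- x) \<noteq> 1}"
    unfolding bounded_real by (metis (mono_tags) abs_minus mem_Collect_eq)
  have pos: "0 < h x" for x using h1(1)[of x] by simp
  define X where "X = p * cluster_rate P C (\<lambda>x. ennreal (- ln (h x))) +
    q * cluster_rate P C (\<lambda>x. ennreal (- ln (h (- x))))"
  define a where "a = pgfl_rate P C h"
  define b where "b = pgfl_rate P C (\<lambda>x. h (- x))"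
  have ab: "cluster_rate P C (\<lambda>x. ennreal (- ln (h x))) = ennreal a" "0 \<le> a"
    "cluster_rate P C (\<lambda>x. ennreal (- ln (h (- x)))) = ennreal b" "0 \<le> b"
    using cluster_rate_finite[OF hm h1(1) bd] cluster_rate_finite[of "\<lambda>x. h (- x)"] h1(1) bd'
    by (auto simp: a_def b_def pgfl_rate_def)
  have X: "ennreal \<nu> * X = ennreal (\<nu> * ((1 + \<theta>) / 2 * a + (1 - \<theta>) / 2 * b))"
    using ab(2,4) \<theta> \<nu>_pos unfolding X_def ab(1,3)
    by (subst ennreal_mult) (auto simp: ennreal_mult simp del: times_divide_eq_left)
  have int: "(\<integral>\<^sup>+\<omega>. ennreal (point_product (N \<omega>) h) \<partial>M) = ennreal (exp (- (\<nu> * ((1 + \<theta>) / 2 * a + (1 - \<theta>) / 2 * b))))"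
  proof -
    have "(\<integral>\<^sup>+\<omega>. ennreal (point_product (N \<omega>) h) \<partial>M) = (\<integral>\<^sup>+\<omega>. eneg (\<integral>\<^sup>+x. ennreal (- ln (h x)) \<partial>N \<omega>) \<partial>M)"
      using point_process_N[OF finite_mean] unfolding point_process_def
      by (intro nn_integral_cong_AE) (auto elim!: eventually_mono simp: point_product_eq_eneg hm pos h1 bd)
    also have "\<dots> = eneg (ennreal \<nu> * X)" unfolding X_def by (rule laplace_N) measurable
    also have "\<dots> = ennreal (exp (- (\<nu> * ((1 + \<theta>) / 2 * a + (1 - \<theta>) / 2 * b))))"
      unfolding X using ab \<theta> \<nu>_pos by (intro eneg_ennreal) auto
    finally show ?thesis .
  qed
  have nonneg: "0 \<le> point_product \<mu> h" for \<mu>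
    using less_imp_le[OF pos] by (auto simp: point_product_def intro!: prod_nonneg)
  have [measurable]: "(\<lambda>\<omega>. \<integral>\<^sup>+x. ennreal (- ln (h x)) \<partial>N \<omega>) \<in> borel_measurable M"
    "\<And>A. A \<in> sets borel \<Longrightarrow> (\<lambda>\<omega>. emeasure (N \<omega>) A) \<in> borel_measurable M"
    by (auto intro!: measurable_compose[OF measurable_N measurable_nn_integral_measure_algebra]
        measurable_compose[OF measurable_N measurable_emeasure_measure_algebra])
  \<comment> \<open>A measurable version of the point product that agrees with it for every outcome:
    where local finiteness fails, \<open>point_product\<close> has the default value 1.\<close>
  have "(\<lambda>\<omega>. if \<forall>n::nat. emeasure (N \<omega>) {- real n..real n} \<noteq> \<top>
      then enn2real (eneg (\<integral>\<^sup>+x. ennreal (- ln (h x)) \<partial>N \<omega>)) else 1) \<in> borel_measurable M"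
    by measurable
  moreover have "point_product (N \<omega>) h = (if \<forall>n::nat. emeasure (N \<omega>) {- real n..real n} \<noteq> \<top>
      then enn2real (eneg (\<integral>\<^sup>+x. ennreal (- ln (h x)) \<partial>N \<omega>)) else 1)" if "\<omega> \<in> space M" for \<omega>
  proof (cases "locally_finite_counting (N \<omega>)")
    case True
    have "point_product (N \<omega>) h = enn2real (ennreal (point_product (N \<omega>) h))" using nonneg by simp
    also have "\<dots> = enn2real (eneg (\<integral>\<^sup>+x. ennreal (- ln (h x)) \<partial>N \<omega>))"
      by (simp only: point_product_eq_eneg[OF True hm pos h1(2) bd])
    finally show ?thesis using True by (simp add: locally_finite_N_iff[OF that])
  next
    case False
    then have "point_product (N \<omega>) h = 1" by (simp add: point_product_def)
    then show ?thesis using False by (auto simp: locally_finite_N_iff[OF that])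
  qed
  ultimately have "(\<lambda>\<omega>. point_product (N \<omega>) h) \<in> borel_measurable M"
    by (simp cong: measurable_cong)
  then have "(\<integral>\<omega>. point_product (N \<omega>) h \<partial>M) = exp (- (\<nu> * ((1 + \<theta>) / 2 * a + (1 - \<theta>) / 2 * b)))"
    using int nonneg by (simp add: integral_eq_nn_integral)
  then show ?thesis
    by (simp add: log_pgfl_def h[abs_def, symmetric] a_def b_def)
qed

end

section \<open>Reduced measures\<close>

text \<open>The inverse of reduction: the measure on n-tuples invariant under diagonal translation,
  with Lebesgue measure for the first coordinate and m for the differences from it.\<close>

definition unreduce ::
  "nat \<Rightarrow> ('v::euclidean_space \<Rightarrow> nat \<Rightarrow> real) \<Rightarrow> 'v measure \<Rightarrow> (nat \<Rightarrow> real) measure" where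
  "unreduce n e m = distr (lborel \<Otimes>\<^sub>M m) (PiM {..<n} (\<lambda>_. borel))
     (\<lambda>(t, \<tau>). \<lambda>i\<in>{..<n}. if i = 0 then t else t + e \<tau> i)"

lemma sets_unreduce [simp, measurable_cong]: "sets (unreduce n e m) = sets (PiM {..<n} (\<lambda>_. borel))"
  and space_unreduce [simp]: "space (unreduce n e m) = space (PiM {..<n} (\<lambda>_. borel))"
  by (simp_all add: unreduce_def)

text \<open>Second and third order are treated at once. The boundedness axiom says that the n - 1
  coordinates control the norm on the Euclidean space, so boxes of n-tuples correspond to bounded
  sets of differences.\<close>

locale reduced_coordinates =
  fixes n :: nat and e :: "'v::euclidean_space \<Rightarrow> nat \<Rightarrow> real"
  assumes n_pos: "0 < n"
    and coordinate: "\<And>i. (\<lambda>\<tau>. e \<tau> i) \<in> borel_measurable borel"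
    and coordinates_bounded: "\<And>R. \<exists>r. \<forall>\<tau>. (\<forall>i. 0 < i \<longrightarrow> i < n \<longrightarrow> \<bar>e \<tau> i\<bar> \<le> R) \<longrightarrow> norm \<tau> \<le> r"
begin

definition locally_finite :: "'v measure \<Rightarrow> bool" where
  "locally_finite m \<longleftrightarrow> sets m = sets borel \<and> (\<forall>r. emeasure m (cball 0 r) < \<infinity>)"

lemma sigma_finite_locally_finite:
  assumes "locally_finite m" shows "sigma_finite_measure m"
proof
  have sets: "sets m = sets borel" and fin: "\<And>r. emeasure m (cball 0 r) < \<infinity>"
    using assms by (auto simp: locally_finite_def)
  have "(\<Union>k::nat. cball 0 (real k)) = (UNIV :: 'v set)"
    using real_arch_simple by fastforce
  then show "\<exists>A. countable A \<and> A \<subseteq> sets m \<and> \<Union> A = space m \<and> (\<forall>a\<in>A. emeasure m a \<noteq> \<infinity>)"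
    using sets fin sets_eq_imp_space_eq[OF sets]
    by (intro exI[of _ "range (\<lambda>k::nat. cball 0 (real k))"]) (auto simp: less_top)
qed

abbreviation point :: "real \<Rightarrow> 'v \<Rightarrow> nat \<Rightarrow> real" where
  "point t \<tau> \<equiv> (\<lambda>i\<in>{..<n}. if i = 0 then t else t + e \<tau> i)"

lemma measurable_point:
  assumes [measurable_cong]: "sets m = sets borel"
  shows "(\<lambda>(t, \<tau>). point t \<tau>) \<in> measurable (lborel \<Otimes>\<^sub>M m) (PiM {..<n} (\<lambda>_. borel))"
proof -
  note [measurable] = coordinate
  show ?thesis unfolding split_beta by measurable
qed

lemma nn_integral_unreduce:
  assumes m: "locally_finite m" and F: "F \<in> borel_measurable (PiM {..<n} (\<lambda>_. borel))"
  shows "(\<integral>\<^sup>+x. F x \<partial>unreduce n e m) = (\<integral>\<^sup>+t. \<integral>\<^sup>+\<tau>. F (point t \<tau>) \<partial>m \<partial>lborel)"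
proof -
  interpret m: sigma_finite_measure m by (rule sigma_finite_locally_finite[OF m])
  have sets: "sets m = sets borel" using m by (simp add: locally_finite_def)
  note p = measurable_point[OF sets]
  have "(\<integral>\<^sup>+x. F x \<partial>unreduce n e m) = (\<integral>\<^sup>+z. F (case z of (t, \<tau>) \<Rightarrow> point t \<tau>) \<partial>(lborel \<Otimes>\<^sub>M m))"
    unfolding unreduce_def by (rule nn_integral_distr[OF p]) (use F in simp)
  also have "\<dots> = (\<integral>\<^sup>+t. \<integral>\<^sup>+\<tau>. F (point t \<tau>) \<partial>m \<partial>lborel)"
    using m.nn_integral_fst[OF measurable_compose[OF p F]] by simp
  finally show ?thesis .
qed

lemma point_bounded_support:
  obtains r' where "\<And>t \<tau>. (\<And>i. i < n \<Longrightarrow> \<bar>point t \<tau> i\<bar> \<le> r) \<Longrightarrow> t \<in> {- r..r} \<and> \<tau> \<in> cball 0 r'"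
proof -
  \<comment> \<open>The bound is 2 r because each coordinate of \<tau> is a difference of two
    numbers in [-r, r].\<close>
  obtain r' where r': "\<And>\<tau>. (\<forall>i. 0 < i \<longrightarrow> i < n \<longrightarrow> \<bar>e \<tau> i\<bar> \<le> 2 * r) \<Longrightarrow> norm \<tau> \<le> r'"
    using coordinates_bounded[of "2 * r"] by blast
  show ?thesis
  proof (rule that[of r'])
    fix t \<tau> assume p: "\<And>i. i < n \<Longrightarrow> \<bar>point t \<tau> i\<bar> \<le> r"
    have t: "\<bar>t\<bar> \<le> r" using p[OF n_pos] n_pos by simp
    have "\<bar>e \<tau> i\<bar> \<le> 2 * r" if "0 < i" "i < n" for i
      using p[OF that(2)] that t by simp
    then have "norm \<tau> \<le> r'" using r' by blast
    with t show "t \<in> {- r..r} \<and> \<tau> \<in> cball 0 r'" by (auto simp: abs_le_iff)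
  qed
qed

lemma emeasure_unreduce_bounded:
  assumes m: "locally_finite m"
  shows "emeasure (unreduce n e m) {t \<in> space (unreduce n e m). \<forall>i<n. \<bar>t i\<bar> \<le> r} < \<infinity>"
proof -
  obtain r' where r': "\<And>t \<tau>. (\<And>i. i < n \<Longrightarrow> \<bar>point t \<tau> i\<bar> \<le> r) \<Longrightarrow> t \<in> {- r..r} \<and> \<tau> \<in> cball 0 r'"
    using point_bounded_support by metis
  let ?A = "{t \<in> space (PiM {..<n} (\<lambda>_. borel)). \<forall>i\<in>{..<n}. \<bar>t i :: real\<bar> \<le> r}"
  have A: "?A \<in> sets (PiM {..<n} (\<lambda>_. borel))" by measurable
  have "emeasure (unreduce n e m) ?A = (\<integral>\<^sup>+x. indicator ?A x \<partial>unreduce n e m)"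
    using A by simp
  also have "\<dots> = (\<integral>\<^sup>+t. \<integral>\<^sup>+\<tau>. indicator ?A (point t \<tau>) \<partial>m \<partial>lborel)"
    by (rule nn_integral_unreduce[OF m]) (use A in simp)
  also have "\<dots> \<le> (\<integral>\<^sup>+t. \<integral>\<^sup>+\<tau>. indicator {- r..r} t * indicator (cball 0 r') \<tau> \<partial>m \<partial>lborel)"
  proof (intro nn_integral_mono)
    fix t \<tau>
    show "(indicator ?A (point t \<tau>) :: ennreal) \<le> indicator {- r..r} t * indicator (cball 0 r') \<tau>"
    proof (cases "point t \<tau> \<in> ?A")
      case True
      then have "\<bar>point t \<tau> i\<bar> \<le> r" if "i < n" for i using that by blast
      from r'[OF this] show ?thesis by (simp add: indicator_def)
    qed simp
  qed
  also have "\<dots> = emeasure lborel {- r..r} * emeasure m (cball 0 r')"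
  proof -
    have "cball 0 r' \<in> sets m" using m by (simp add: locally_finite_def)
    then have "(\<integral>\<^sup>+\<tau>. indicator {- r..r} t * indicator (cball 0 r') \<tau> \<partial>m) =
        indicator {- r..r} t * emeasure m (cball 0 r')" for t :: real
      by (rule nn_integral_cmult_indicator)
    then show ?thesis by (simp add: nn_integral_multc)
  qed
  also have "\<dots> < \<infinity>"
    using m by (simp add: locally_finite_def ennreal_mult_less_top emeasure_lborel_Icc_eq)
  finally show ?thesis by (simp add: Ball_def)
qed

text \<open>Bounded support confines (t, \<tau>) to a set of finite product measure, so Fubini's
  theorem applies to the bounded F. Integrability of the outer function is recorded because the two
  parts of a signed measure are subtracted under that integral.\<close>

lemma integral_unreduce:
  fixes F :: "(nat \<Rightarrow> real) \<Rightarrow> real"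
  assumes m: "locally_finite m" and F: "F \<in> borel_measurable (PiM {..<n} (\<lambda>_. borel))"
    and bd: "bounded (range F)" and supp: "\<And>t. F t \<noteq> 0 \<Longrightarrow> \<forall>i<n. \<bar>t i\<bar> \<le> r"
  shows "(\<integral>x. F x \<partial>unreduce n e m) = (\<integral>t. \<integral>\<tau>. F (point t \<tau>) \<partial>m \<partial>lborel)"
    and "integrable lborel (\<lambda>t. \<integral>\<tau>. F (point t \<tau>) \<partial>m)"
    and "integrable m (\<lambda>\<tau>. F (point t \<tau>))"
proof -
  interpret m: sigma_finite_measure m by (rule sigma_finite_locally_finite[OF m])
  interpret pair_sigma_finite lborel m ..
  have sets [measurable_cong]: "sets m = sets borel" using m by (simp add: locally_finite_def)
  note p = measurable_point[OF sets]
  obtain r' where r': "\<And>t \<tau>. (\<And>i. i < n \<Longrightarrow> \<bar>point t \<tau> i\<bar> \<le> r) \<Longrightarrow> t \<in> {- r..r} \<and> \<tau> \<in> cball 0 r'"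
    using point_bounded_support by metis
  obtain B where B: "\<And>x. \<bar>F x\<bar> \<le> B" using bd by (auto simp: bounded_iff)
  have le: "\<bar>F (point t \<tau>)\<bar> \<le> B * indicator ({- r..r} \<times> cball 0 r') (t, \<tau>)" for t \<tau>
  proof (cases "F (point t \<tau>) = 0")
    case True
    have "0 \<le> B" using B[of "\<lambda>_. 0"] by linarith
    with True show ?thesis by simp
  next
    case False
    from supp[OF this] have "t \<in> {- r..r} \<and> \<tau> \<in> cball 0 r'" by (intro r') blast
    with B show ?thesis by simp
  qed
  let ?F = "\<lambda>(t, \<tau>). F (point t \<tau>)"
  have Fm: "?F \<in> borel_measurable (lborel \<Otimes>\<^sub>M m)"
    using measurable_compose[OF p F] by (simp add: split_beta)
  have int: "integrable (lborel \<Otimes>\<^sub>M m) ?F"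
  proof (rule Bochner_Integration.integrable_bound)
    have "emeasure (lborel \<Otimes>\<^sub>M m) ({- r..r} \<times> cball 0 r') = emeasure lborel {- r..r} * emeasure m (cball 0 r')"
      by (rule m.emeasure_pair_measure_Times) (auto simp: sets)
    also have "\<dots> < \<infinity>"
      using m by (simp add: locally_finite_def ennreal_mult_less_top emeasure_lborel_Icc_eq)
    finally show "integrable (lborel \<Otimes>\<^sub>M m) (\<lambda>z. B * indicator ({- r..r} \<times> cball 0 r') z)"
      by (intro integrable_mult_right integrable_real_indicator) (auto simp: sets)
    show "AE z in lborel \<Otimes>\<^sub>M m. norm (?F z) \<le> norm (B * indicator ({- r..r} \<times> cball 0 r') z)"
      using le by (intro AE_I2) (auto intro: order_trans[OF _ abs_ge_self])
  qed (rule Fm)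
  have "(\<integral>x. F x \<partial>unreduce n e m) = (\<integral>z. ?F z \<partial>(lborel \<Otimes>\<^sub>M m))"
    unfolding unreduce_def by (subst integral_distr[OF p F]) (simp add: case_prod_unfold)
  also have "\<dots> = (\<integral>t. \<integral>\<tau>. F (point t \<tau>) \<partial>m \<partial>lborel)"
    using integral_fst'[OF int] by simp
  finally show "(\<integral>x. F x \<partial>unreduce n e m) = (\<integral>t. \<integral>\<tau>. F (point t \<tau>) \<partial>m \<partial>lborel)" .
  show "integrable lborel (\<lambda>t. \<integral>\<tau>. F (point t \<tau>) \<partial>m)"
    using integrable_fst'[OF int] by simp
  show "integrable m (\<lambda>\<tau>. F (point t \<tau>))"
  proof (rule Bochner_Integration.integrable_bound)
    show "integrable m (\<lambda>\<tau>. B * indicator (cball 0 r') \<tau>)"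
      using m by (intro integrable_mult_right integrable_real_indicator) (auto simp: locally_finite_def)
    show "(\<lambda>\<tau>. F (point t \<tau>)) \<in> borel_measurable m"
      using measurable_Pair2[OF Fm, of t] by simp
    show "AE \<tau> in m. norm (F (point t \<tau>)) \<le> norm (B * indicator (cball 0 r') \<tau>)"
    proof (rule AE_I2)
      fix \<tau>
      show "norm (F (point t \<tau>)) \<le> norm (B * indicator (cball 0 r') \<tau>)"
        using le[of t \<tau>] B[of "point t \<tau>"] by (auto simp: indicator_def split: if_splits)
    qed
  qed
qed

lemma reduced_measure_unreduce:
  assumes "locally_finite (fst \<rho>)" "locally_finite (snd \<rho>)"
  shows "reduced_measure n e (unreduce n e (fst \<rho>), unreduce n e (snd \<rho>)) \<rho>"
  unfolding reduced_measure_def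
proof (intro conjI ballI impI)
  show "sets \<sigma> = sets borel" "\<forall>r. emeasure \<sigma> (cball 0 r) < \<infinity>" if "\<sigma> \<in> {fst \<rho>, snd \<rho>}" for \<sigma>
    using that assms by (auto simp: locally_finite_def)
  fix F :: "(nat \<Rightarrow> real) \<Rightarrow> real"
  assume F: "F \<in> borel_measurable (PiM {..<n} (\<lambda>_. borel))" "bounded (range F)"
    and "\<exists>r. \<forall>t. F t \<noteq> 0 \<longrightarrow> (\<forall>i<n. \<bar>t i\<bar> \<le> r)"
  then obtain r where r: "\<And>t. F t \<noteq> 0 \<Longrightarrow> \<forall>i<n. \<bar>t i\<bar> \<le> r" by blast
  note I = integral_unreduce[OF assms(1) F r] integral_unreduce[OF assms(2) F r]
  show "signed_integral (unreduce n e (fst \<rho>), unreduce n e (snd \<rho>)) F =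
      (\<integral>t. signed_integral \<rho> (\<lambda>\<tau>. F (point t \<tau>)) \<partial>lborel)"
    using Bochner_Integration.integral_diff[OF I(2) I(5)]
    by (simp add: signed_integral_def I(1) I(4))
qed

lemma product_test_function:
  assumes f: "\<And>j. j < n \<Longrightarrow> test_function (f j)"
  shows "(\<lambda>t. \<Prod>j<n. f j (t j)) \<in> borel_measurable (PiM {..<n} (\<lambda>_. borel))"
    and "bounded (range (\<lambda>t. \<Prod>j<n. f j (t j)))"
    and "\<exists>r. \<forall>t. (\<Prod>j<n. f j (t j)) \<noteq> 0 \<longrightarrow> (\<forall>i<n. \<bar>t i\<bar> \<le> r)"
proof -
  have fm: "f j \<in> borel_measurable borel" if "j < n" for j
    using f[OF that] by (simp add: test_function_def)
  show "(\<lambda>t. \<Prod>j<n. f j (t j)) \<in> borel_measurable (PiM {..<n} (\<lambda>_. borel))"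
    by (intro borel_measurable_prod measurable_compose[OF measurable_component_singleton _] fm) auto
  obtain b where b: "\<And>j x. j < n \<Longrightarrow> 0 \<le> f j x \<and> f j x \<le> b j"
    using f unfolding test_function_def by metis
  have "norm (\<Prod>j<n. f j (t j)) \<le> (\<Prod>j<n. b j)" for t
    using b by (auto simp: abs_prod intro!: prod_mono)
  then show "bounded (range (\<lambda>t. \<Prod>j<n. f j (t j)))" by (auto simp: bounded_iff)
  have "\<exists>r. \<forall>x. f j x \<noteq> 0 \<longrightarrow> \<bar>x\<bar> \<le> r" if "j < n" for j
    using f[OF that] by (auto simp: test_function_def bounded_real)
  then obtain R where R: "\<And>j x. j < n \<Longrightarrow> f j x \<noteq> 0 \<Longrightarrow> \<bar>x\<bar> \<le> R j" by metis
  have "\<bar>t i\<bar> \<le> (\<Sum>j<n. \<bar>R j\<bar>)" if "(\<Prod>j<n. f j (t j)) \<noteq> 0" "i < n" for t i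
  proof -
    have "f i (t i) \<noteq> 0" using that by auto
    from R[OF that(2) this] have "\<bar>t i\<bar> \<le> \<bar>R i\<bar>" by linarith
    also have "\<dots> \<le> (\<Sum>j<n. \<bar>R j\<bar>)" using that by (intro member_le_sum) auto
    finally show ?thesis .
  qed
  then show "\<exists>r. \<forall>t. (\<Prod>j<n. f j (t j)) \<noteq> 0 \<longrightarrow> (\<forall>i<n. \<bar>t i\<bar> \<le> r)" by blast
qed

end

section \<open>The second factorial cumulant measure\<close>

text \<open>The image of counting measure on ordered pairs of distinct atoms. Pairs with equal
  differences are thus counted with multiplicity.\<close>

definition difference_measure :: "real measure \<Rightarrow> real measure" where
  "difference_measure \<mu> = distr (count_space (SIGMA x:atoms \<mu>. atoms \<mu> - {x})) borel (\<lambda>(x, y). y - x)"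

text \<open>In a Poisson cluster process points of different clusters do not contribute to the
  second factorial cumulant. What is left is the mean pair count within one cluster, times the
  immigrant rate.\<close>

definition second_cumulant :: "real \<Rightarrow> 'p measure \<Rightarrow> ('p \<Rightarrow> real measure) \<Rightarrow> real measure" where
  "second_cumulant \<nu> P C = scale_measure (ennreal \<nu>) (mixture P (\<lambda>\<omega>. difference_measure (C \<omega>)))"

lemma sets_difference_measure [simp]: "sets (difference_measure \<mu>) = sets borel"
  by (simp add: difference_measure_def)

lemma sets_second_cumulant [simp, measurable_cong]: "sets (second_cumulant \<nu> P C) = sets borel"
  by (simp add: second_cumulant_def)

lemma nn_integral_difference_measure:
  assumes \<mu>: "finite_simple_counting \<mu>" and g: "g \<in> borel_measurable borel"
  shows "(\<integral>\<^sup>+\<tau>. g \<tau> \<partial>difference_measure \<mu>) = (\<Sum>x\<in>atoms \<mu>. \<Sum>y\<in>atoms \<mu> - {x}. g (y - x))"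
proof -
  have fin: "finite (atoms \<mu>)" by (rule finite_atoms_finite_simple_counting[OF \<mu>])
  have "(\<integral>\<^sup>+\<tau>. g \<tau> \<partial>difference_measure \<mu>) =
      (\<integral>\<^sup>+z. g (case z of (x, y) \<Rightarrow> y - x) \<partial>count_space (SIGMA x:atoms \<mu>. atoms \<mu> - {x}))"
    unfolding difference_measure_def using g by (intro nn_integral_distr) auto
  also have "\<dots> = (\<Sum>z\<in>(SIGMA x:atoms \<mu>. atoms \<mu> - {x}). g (case z of (x, y) \<Rightarrow> y - x))"
    using fin by (intro nn_integral_count_space_finite) auto
  also have "\<dots> = (\<Sum>x\<in>atoms \<mu>. \<Sum>y\<in>atoms \<mu> - {x}. g (y - x))"
    using fin by (subst sum.Sigma) (auto simp: case_prod_unfold)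
  finally show ?thesis .
qed

lemma sum_off_diagonal_swap:
  fixes h :: "'a \<Rightarrow> 'a \<Rightarrow> 'b::comm_monoid_add"
  assumes "finite A"
  shows "(\<Sum>x\<in>A. \<Sum>y\<in>A - {x}. h x y) = (\<Sum>x\<in>A. \<Sum>y\<in>A - {x}. h y x)"
proof -
  have "(\<Sum>x\<in>A. \<Sum>y\<in>A - {x}. k x y) = (\<Sum>x\<in>A. \<Sum>y\<in>A. if x = y then 0 else k x y)"
    for k :: "'a \<Rightarrow> 'a \<Rightarrow> 'b"
    using assms by (intro sum.cong refl sum.mono_neutral_cong_left) auto
  then show ?thesis by (simp add: sum.swap[of "\<lambda>x y. if x = y then 0 else h y x"] eq_commute)
qed

section \<open>One-sided differentiation under the integral\<close>

text \<open>The Lipschitz bound makes w dominate all difference quotients. A left limit may be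
  tested along sequences, to which dominated convergence applies, and one such sequence already
  shows that F' is measurable.\<close>

lemma has_left_derivative_integral:
  fixes F :: "real \<Rightarrow> 'b \<Rightarrow> real"
  assumes \<epsilon>: "0 < \<epsilon>" and meas: "\<And>z. z \<in> {-\<epsilon><..0} \<Longrightarrow> F z \<in> borel_measurable Q"
    and int: "integrable Q (F 0)" and w: "integrable Q w"
    and le: "\<And>z q. z \<in> {-\<epsilon><..0} \<Longrightarrow> q \<in> space Q \<Longrightarrow> \<bar>F z q - F 0 q\<bar> \<le> \<bar>z\<bar> * w q"
    and deriv: "\<And>q. q \<in> space Q \<Longrightarrow> ((\<lambda>z. F z q) has_real_derivative F' q) (at 0 within {..0})"
  shows "F' \<in> borel_measurable Q" and "integrable Q F'"
    and "((\<lambda>z. \<integral>q. F z q \<partial>Q) has_real_derivative (\<integral>q. F' q \<partial>Q)) (at 0 within {..0})"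
proof -
  have diff_int: "integrable Q (\<lambda>q. F z q - F 0 q)" if z: "z \<in> {-\<epsilon><..0}" for z
  proof (rule Bochner_Integration.integrable_bound)
    show "integrable Q (\<lambda>q. \<bar>z\<bar> * w q)" using w by simp
    show "(\<lambda>q. F z q - F 0 q) \<in> borel_measurable Q" using meas[OF z] meas[of 0] \<epsilon> by simp
    show "AE q in Q. norm (F z q - F 0 q) \<le> norm (\<bar>z\<bar> * w q)"
      using le[OF z] by (intro AE_I2) (auto intro: order_trans[OF _ abs_ge_self])
  qed
  have F_int: "integrable Q (F z)" if "z \<in> {-\<epsilon><..0}" for z
    using Bochner_Integration.integrable_add[OF diff_int[OF that] int] by simp
  have seq: "(\<lambda>n. (F (S n) q - F 0 q) / S n) \<longlonglongrightarrow> F' q"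
    if "\<And>n. S n < 0" "S \<longlonglongrightarrow> 0" "q \<in> space Q" for S :: "nat \<Rightarrow> real" and q
  proof -
    have "filterlim S (at_left 0) sequentially"
      using that by (intro tendsto_imp_filterlim_at_left) auto
    with deriv[OF that(3)] show ?thesis
      unfolding has_left_derivative_iff by (rule filterlim_compose)
  qed
  have meas': "(\<lambda>q. (F z q - F 0 q) / z) \<in> borel_measurable Q" if "z \<in> {-\<epsilon><..0}" for z
    using borel_measurable_integrable[OF diff_int[OF that]] by simp
  have le': "\<bar>(F z q - F 0 q) / z\<bar> \<le> w q" if "z \<in> {-\<epsilon><..<0}" "q \<in> space Q" for z q
  proof -
    have "0 < \<bar>z\<bar>" using that by auto
    moreover have "\<bar>F z q - F 0 q\<bar> \<le> w q * \<bar>z\<bar>" using le[of z q] that by (simp add: mult.commute)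
    ultimately show ?thesis unfolding abs_divide by (simp only: pos_divide_le_eq)
  qed
  \<comment> \<open>The denominator n + 2 keeps the sequence strictly between -\<epsilon> and 0 from
    its first term on.\<close>
  define S where "S n = - \<epsilon> / real (Suc (Suc n))" for n
  have S: "S n < 0" "S n \<in> {-\<epsilon><..0}" for n
    using \<epsilon> by (auto simp: S_def divide_simps)
  have S_lim: "S \<longlonglongrightarrow> 0"
    unfolding S_def using LIMSEQ_Suc[OF LIMSEQ_Suc[OF lim_const_over_n[of "- \<epsilon>"]]] by simp
  show F': "F' \<in> borel_measurable Q"
    by (rule borel_measurable_LIMSEQ_real[OF seq[OF S(1) S_lim] meas'[OF S(2)]])
  show "integrable Q F'"
    using integrable_dominated_convergence[OF F' meas'[OF S(2)] w AE_I2[OF seq[OF S(1) S_lim]]]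
      le' S by (auto simp: order_less_imp_le)
  show "((\<lambda>z. \<integral>q. F z q \<partial>Q) has_real_derivative (\<integral>q. F' q \<partial>Q)) (at 0 within {..0})"
    unfolding has_left_derivative_iff
  proof (rule tendsto_at_left_sequentially[of "- \<epsilon>"])
    fix T :: "nat \<Rightarrow> real" assume T: "\<And>n. T n < 0" "\<And>n. - \<epsilon> < T n" "T \<longlonglongrightarrow> 0"
    then have T': "T n \<in> {-\<epsilon><..0}" "T n \<in> {-\<epsilon><..<0}" for n
      by (auto simp: order_less_imp_le)
    have "(\<lambda>n. \<integral>q. (F (T n) q - F 0 q) / T n \<partial>Q) \<longlonglongrightarrow> (\<integral>q. F' q \<partial>Q)"
      using le' T'
      by (intro integral_dominated_convergence[OF F' meas'[OF T'(1)] w AE_I2[OF seq[OF T(1,3)]]]) auto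
    moreover have "(\<integral>q. (F (T n) q - F 0 q) / T n \<partial>Q) = ((\<integral>q. F (T n) q \<partial>Q) - (\<integral>q. F 0 q \<partial>Q)) / T n" for n
      using F_int[OF T'(1)] int by simp
    ultimately show "(\<lambda>n. ((\<integral>q. F (T n) q \<partial>Q) - (\<integral>q. F 0 q \<partial>Q)) / T n) \<longlonglongrightarrow> (\<integral>q. F' q \<partial>Q)"
      by (simp only:)
  qed (use \<epsilon> in simp)
qed

lemma has_derivative_prod_affine:
  fixes a b :: "'b \<Rightarrow> real"
  shows "((\<lambda>z. \<Prod>x\<in>A. a x + z * b x) has_real_derivative (\<Sum>x\<in>A. b x * (\<Prod>y\<in>A - {x}. a y))) (at 0 within X)"
proof -
  have "((\<lambda>z. \<Prod>x\<in>A. a x + z * b x) has_real_derivative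
      (\<Sum>x\<in>A. b x * (\<Prod>y\<in>A - {x}. a y + 0 * b y))) (at 0)"
    by (rule has_field_derivative_prod) (auto intro!: derivative_eq_intros)
  then show ?thesis by (simp add: has_field_derivative_at_within)
qed

text \<open>A product of numbers in [-1, 1] changes by at most the sum of the changes of its
  factors. The bound is therefore linear in the sum of b and does not grow exponentially with the
  number of points.\<close>

lemma prod_affine_diff_le:
  fixes a b :: "'b \<Rightarrow> real"
  assumes "\<And>x. x \<in> A \<Longrightarrow> \<bar>a x\<bar> \<le> 1" "\<And>x. x \<in> A \<Longrightarrow> \<bar>a x + z * b x\<bar> \<le> 1" "\<And>x. x \<in> A \<Longrightarrow> 0 \<le> b x"
  shows "\<bar>(\<Prod>x\<in>A. a x + z * b x) - (\<Prod>x\<in>A. a x)\<bar> \<le> \<bar>z\<bar> * (\<Sum>x\<in>A. b x)"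
proof -
  have "\<bar>(\<Prod>x\<in>A. a x + z * b x) - (\<Prod>x\<in>A. a x)\<bar> \<le> (\<Sum>x\<in>A. \<bar>(a x + z * b x) - a x\<bar>)"
    using norm_prod_diff[of A "\<lambda>x. a x + z * b x" a] assms by simp
  also have "\<dots> = \<bar>z\<bar> * (\<Sum>x\<in>A. b x)"
    using assms(3) by (simp add: sum_distrib_left abs_mult)
  finally show ?thesis .
qed

lemma eneg_neg_ln_prod:
  assumes \<mu>: "finite_simple_counting \<mu>" and h [measurable]: "h \<in> borel_measurable borel"
    and h1: "\<And>x. 0 < h x" "\<And>x. h x \<le> 1"
  shows "eneg (\<integral>\<^sup>+x. ennreal (- ln (h (x + u))) \<partial>\<mu>) = ennreal (\<Prod>x\<in>atoms \<mu>. h (x + u))"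
proof -
  have "(\<integral>\<^sup>+x. ennreal (- ln (h (x + u))) \<partial>\<mu>) = (\<Sum>x\<in>atoms \<mu>. ennreal (- ln (h (x + u))))"
    by (rule nn_integral_finite_simple_counting[OF \<mu>]) measurable
  moreover have "eneg (ennreal (- ln (h y))) = ennreal (h y)" for y using h1[of y] by simp
  ultimately show ?thesis using less_imp_le[OF h1(1)] by (simp add: eneg_sum prod_ennreal)
qed

section \<open>Second-order derivatives of the rate and the second cumulant\<close>

locale cluster_model_square = cluster_model_mean M \<nu> U P C K S \<theta>
  for M :: "'a measure" and \<nu> U and P :: "'p measure" and C K S \<theta> +
  assumes finite_square: "(\<integral>\<^sup>+\<omega>. emeasure (C \<omega>) UNIV ^ 2 \<partial>P) < \<top>"
begin

lemma atoms_C: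
  assumes "\<omega> \<in> space P"
  shows "finite (atoms (C \<omega>))" "emeasure (C \<omega>) UNIV = of_nat (card (atoms (C \<omega>)))"
    "\<And>g. g \<in> borel_measurable borel \<Longrightarrow> (\<integral>\<^sup>+x. g x \<partial>C \<omega>) = (\<Sum>x\<in>atoms (C \<omega>). g x)"
  using C_counting[OF assms] by (simp_all add: finite_atoms_finite_simple_counting
      emeasure_UNIV_finite_simple_counting nn_integral_finite_simple_counting)

text \<open>The atoms come without a measurable enumeration. Ordered pairs of distinct atoms are
  instead counted by a double integral against the cluster with the diagonal removed, and
  measurability of cluster integrals is used twice.\<close>

lemma measurable_emeasure_difference [measurable]:
  assumes A [measurable]: "A \<in> sets borel"
  shows "(\<lambda>\<omega>. emeasure (difference_measure (C \<omega>)) A) \<in> borel_measurable P"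
proof -
  have [measurable]: "(\<lambda>(\<omega>, x). \<integral>\<^sup>+y. (if x = y then 0 else indicator A (y - x)) \<partial>C \<omega>) \<in> borel_measurable (P \<Otimes>\<^sub>M borel)"
    unfolding split_beta by (rule measurable_nn_integral_cluster) measurable
  have "(\<lambda>\<omega>. \<integral>\<^sup>+x. \<integral>\<^sup>+y. (if x = y then 0 else indicator A (y - x)) \<partial>C \<omega> \<partial>C \<omega>) \<in> borel_measurable P"
    by (rule measurable_nn_integral_cluster) measurable
  moreover have "emeasure (difference_measure (C \<omega>)) A =
      (\<integral>\<^sup>+x. \<integral>\<^sup>+y. (if x = y then 0 else indicator A (y - x)) \<partial>C \<omega> \<partial>C \<omega>)" if \<omega>: "\<omega> \<in> space P" for \<omega>
  proof -
    have inner: "(\<integral>\<^sup>+y. (if x = y then 0 else indicator A (y - x)) \<partial>C \<omega>) =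
        (\<Sum>y\<in>atoms (C \<omega>) - {x}. indicator A (y - x))" for x
    proof -
      have "(\<integral>\<^sup>+y. (if x = y then 0 else indicator A (y - x)) \<partial>C \<omega>) =
          (\<Sum>y\<in>atoms (C \<omega>). if x = y then 0 else indicator A (y - x))"
        by (rule atoms_C(3)[OF \<omega>]) measurable
      also have "\<dots> = (\<Sum>y\<in>atoms (C \<omega>) - {x}. indicator A (y - x))"
        using atoms_C(1)[OF \<omega>] by (intro sum.mono_neutral_cong_right) auto
      finally show ?thesis .
    qed
    have "(\<lambda>x. \<integral>\<^sup>+y. (if x = y then 0 else indicator A (y - x)) \<partial>C \<omega>) \<in> borel_measurable borel"
      using measurable_compose[OF measurable_Pair1'[OF \<omega>, of borel]
          \<open>(\<lambda>(\<omega>, x). \<integral>\<^sup>+y. (if x = y then 0 else indicator A (y - x)) \<partial>C \<omega>) \<in> _\<close>] by simp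
    from atoms_C(3)[OF \<omega> this]
    have "(\<integral>\<^sup>+x. \<integral>\<^sup>+y. (if x = y then 0 else indicator A (y - x)) \<partial>C \<omega> \<partial>C \<omega>) =
        (\<Sum>x\<in>atoms (C \<omega>). \<Sum>y\<in>atoms (C \<omega>) - {x}. indicator A (y - x))"
      by (simp add: inner)
    also have "\<dots> = (\<integral>\<^sup>+\<tau>. indicator A \<tau> \<partial>difference_measure (C \<omega>))"
      by (rule nn_integral_difference_measure[OF C_counting[OF \<omega>], symmetric]) measurable
    finally show ?thesis by simp
  qed
  ultimately show ?thesis by (simp cong: measurable_cong)
qed

lemma nn_integral_second_cumulant:
  assumes g [measurable]: "g \<in> borel_measurable borel"
  shows "(\<integral>\<^sup>+\<tau>. g \<tau> \<partial>second_cumulant \<nu> P C) =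
      ennreal \<nu> * (\<integral>\<^sup>+\<omega>. (\<Sum>x\<in>atoms (C \<omega>). \<Sum>y\<in>atoms (C \<omega>) - {x}. g (y - x)) \<partial>P)"
    and "(\<lambda>\<omega>. \<Sum>x\<in>atoms (C \<omega>). \<Sum>y\<in>atoms (C \<omega>) - {x}. g (y - x)) \<in> borel_measurable P"
proof -
  have eq: "(\<integral>\<^sup>+\<tau>. g \<tau> \<partial>difference_measure (C \<omega>)) = (\<Sum>x\<in>atoms (C \<omega>). \<Sum>y\<in>atoms (C \<omega>) - {x}. g (y - x))"
    if "\<omega> \<in> space P" for \<omega>
    by (rule nn_integral_difference_measure[OF C_counting[OF that] g])
  have "(\<integral>\<^sup>+\<tau>. g \<tau> \<partial>second_cumulant \<nu> P C) = ennreal \<nu> * (\<integral>\<^sup>+\<tau>. g \<tau> \<partial>mixture P (\<lambda>\<omega>. difference_measure (C \<omega>)))"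
    unfolding second_cumulant_def by (rule nn_integral_scale_measure) (simp cong: measurable_cong_sets)
  also have "(\<integral>\<^sup>+\<tau>. g \<tau> \<partial>mixture P (\<lambda>\<omega>. difference_measure (C \<omega>))) = (\<integral>\<^sup>+\<omega>. \<integral>\<^sup>+\<tau>. g \<tau> \<partial>difference_measure (C \<omega>) \<partial>P)"
    by (rule nn_integral_mixture) auto
  also have "\<dots> = (\<integral>\<^sup>+\<omega>. (\<Sum>x\<in>atoms (C \<omega>). \<Sum>y\<in>atoms (C \<omega>) - {x}. g (y - x)) \<partial>P)"
    by (intro nn_integral_cong eq)
  finally show "(\<integral>\<^sup>+\<tau>. g \<tau> \<partial>second_cumulant \<nu> P C) =
      ennreal \<nu> * (\<integral>\<^sup>+\<omega>. (\<Sum>x\<in>atoms (C \<omega>). \<Sum>y\<in>atoms (C \<omega>) - {x}. g (y - x)) \<partial>P)" .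
  have "(\<lambda>\<omega>. \<integral>\<^sup>+\<tau>. g \<tau> \<partial>difference_measure (C \<omega>)) \<in> borel_measurable P"
    by (rule borel_measurable_nn_integral_kernel[OF _ _ g]) auto
  then show "(\<lambda>\<omega>. \<Sum>x\<in>atoms (C \<omega>). \<Sum>y\<in>atoms (C \<omega>) - {x}. g (y - x)) \<in> borel_measurable P"
    by (simp add: eq cong: measurable_cong)
qed

lemma finite_measure_second_cumulant: "finite_measure (second_cumulant \<nu> P C)"
proof
  have "emeasure (second_cumulant \<nu> P C) (space (second_cumulant \<nu> P C)) = (\<integral>\<^sup>+\<tau>. 1 \<partial>second_cumulant \<nu> P C)"
    by simp
  also have "\<dots> = ennreal \<nu> * (\<integral>\<^sup>+\<omega>. (\<Sum>x\<in>atoms (C \<omega>). \<Sum>y\<in>atoms (C \<omega>) - {x}. 1) \<partial>P)"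
    by (rule nn_integral_second_cumulant) measurable
  also have "\<dots> \<le> ennreal \<nu> * (\<integral>\<^sup>+\<omega>. emeasure (C \<omega>) UNIV ^ 2 \<partial>P)"
  proof (intro mult_left_mono nn_integral_mono)
    fix \<omega> assume \<omega>: "\<omega> \<in> space P"
    have "(\<Sum>x\<in>atoms (C \<omega>). \<Sum>y\<in>atoms (C \<omega>) - {x}. (1::ennreal)) \<le> (\<Sum>x\<in>atoms (C \<omega>). of_nat (card (atoms (C \<omega>))))"
      using atoms_C(1)[OF \<omega>] by (intro sum_mono) (auto intro: of_nat_mono card_mono)
    then show "(\<Sum>x\<in>atoms (C \<omega>). \<Sum>y\<in>atoms (C \<omega>) - {x}. (1::ennreal)) \<le> emeasure (C \<omega>) UNIV ^ 2"
      by (simp add: atoms_C(2)[OF \<omega>] power2_eq_square)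
  qed auto
  also have "\<dots> < \<infinity>" using finite_square by (simp add: ennreal_mult_less_top)
  finally show "emeasure (second_cumulant \<nu> P C) (space (second_cumulant \<nu> P C)) \<noteq> \<infinity>" by simp
qed

text \<open>Exchanging the two points of an ordered pair negates their difference. This is the
  reason that second-order statistics cannot see the orientation of a cluster.\<close>

lemma second_cumulant_symmetric:
  assumes g [measurable]: "g \<in> borel_measurable borel"
  shows "(\<integral>\<^sup>+\<tau>. g (- \<tau>) \<partial>second_cumulant \<nu> P C) = (\<integral>\<^sup>+\<tau>. g \<tau> \<partial>second_cumulant \<nu> P C)"
proof -
  have "(\<integral>\<^sup>+\<omega>. (\<Sum>x\<in>atoms (C \<omega>). \<Sum>y\<in>atoms (C \<omega>) - {x}. g (- (y - x))) \<partial>P) =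
      (\<integral>\<^sup>+\<omega>. (\<Sum>x\<in>atoms (C \<omega>). \<Sum>y\<in>atoms (C \<omega>) - {x}. g (y - x)) \<partial>P)"
    by (intro nn_integral_cong) (simp add: sum_off_diagonal_swap[OF atoms_C(1), of _ "\<lambda>x y. g (y - x)"])
  then show ?thesis by (simp add: nn_integral_second_cumulant)
qed

text \<open>Supplies the dominating function for the first differentiation. Its integral is the mean
  cluster size times the integral of f.\<close>

lemma integrable_cluster_sum:
  assumes f: "test_function f"
  shows "integrable (lborel \<Otimes>\<^sub>M P) (\<lambda>(u, \<omega>). \<Sum>x\<in>atoms (C \<omega>). f (x + u))"
proof (rule integrableI_bounded)
  have fm [measurable]: "f \<in> borel_measurable borel" and f0: "\<And>x. 0 \<le> f x"
    using f by (auto simp: test_function_def)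
  obtain b r where b: "\<And>x. f x \<le> b" and r: "\<And>x. f x \<noteq> 0 \<Longrightarrow> \<bar>x\<bar> \<le> r"
    using f unfolding test_function_def bounded_real by auto
  have m: "(\<lambda>(u, \<omega>). \<integral>\<^sup>+x. ennreal (f (x + u)) \<partial>C \<omega>) \<in> borel_measurable (lborel \<Otimes>\<^sub>M P)"
    using measurable_shifted_cluster_integral[of "\<lambda>x. ennreal (f x)" 1] by simp
  have eq: "(\<integral>\<^sup>+x. ennreal (f (x + u)) \<partial>C \<omega>) = ennreal (\<Sum>x\<in>atoms (C \<omega>). f (x + u))"
    if "\<omega> \<in> space P" for u \<omega>
    using f0 by (simp add: atoms_C(3)[OF that])
  have "(\<lambda>z. enn2real (case z of (u, \<omega>) \<Rightarrow> \<integral>\<^sup>+x. ennreal (f (x + u)) \<partial>C \<omega>)) \<in> borel_measurable (lborel \<Otimes>\<^sub>M P)"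
    using m by measurable
  moreover have "enn2real (case z of (u, \<omega>) \<Rightarrow> \<integral>\<^sup>+x. ennreal (f (x + u)) \<partial>C \<omega>) =
      (case z of (u, \<omega>) \<Rightarrow> \<Sum>x\<in>atoms (C \<omega>). f (x + u))" if "z \<in> space (lborel \<Otimes>\<^sub>M P)" for z
    using that f0 by (auto simp: space_pair_measure eq sum_nonneg)
  ultimately show "(\<lambda>(u, \<omega>). \<Sum>x\<in>atoms (C \<omega>). f (x + u)) \<in> borel_measurable (lborel \<Otimes>\<^sub>M P)"
    by (simp cong: measurable_cong)
  have "(\<integral>\<^sup>+z. ennreal (norm (case z of (u, \<omega>) \<Rightarrow> \<Sum>x\<in>atoms (C \<omega>). f (x + u))) \<partial>(lborel \<Otimes>\<^sub>M P)) =
      (\<integral>\<^sup>+z. (case z of (u, \<omega>) \<Rightarrow> \<integral>\<^sup>+x. ennreal (f (x + u)) \<partial>C \<omega>) \<partial>(lborel \<Otimes>\<^sub>M P))"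
    using f0 by (intro nn_integral_cong) (auto simp: space_pair_measure eq sum_nonneg)
  also have "\<dots> = (\<integral>\<^sup>+u. \<integral>\<^sup>+\<omega>. \<integral>\<^sup>+x. ennreal (f (x + u)) \<partial>C \<omega> \<partial>P \<partial>lborel)"
    using P.nn_integral_fst[OF m] by simp
  also have "\<dots> = (\<integral>\<^sup>+\<omega>. emeasure (C \<omega>) UNIV \<partial>P) * (\<integral>\<^sup>+x. ennreal (f x) \<partial>lborel)"
    using nn_integral_shifted_cluster[of "\<lambda>x. ennreal (f x)" 1] by simp
  also have "\<dots> \<le> (\<integral>\<^sup>+\<omega>. emeasure (C \<omega>) UNIV \<partial>P) * (\<integral>\<^sup>+x. ennreal b * indicator {- r..r} x \<partial>lborel)"
  proof (intro mult_left_mono nn_integral_mono)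
    show "ennreal (f x) \<le> ennreal b * indicator {- r..r} x" for x
      using b[of x] r[of x] by (cases "f x = 0") (auto simp: ennreal_leI abs_le_iff)
  qed auto
  also have "\<dots> < \<infinity>"
    using finite_mean by (simp add: nn_integral_cmult_indicator ennreal_mult_less_top emeasure_lborel_Icc_eq)
  finally show "(\<integral>\<^sup>+z. ennreal (norm (case z of (u, \<omega>) \<Rightarrow> \<Sum>x\<in>atoms (C \<omega>). f (x + u))) \<partial>(lborel \<Otimes>\<^sub>M P)) < \<infinity>" .
qed

text \<open>The rate as a single Bochner integral over position and cluster, the form in which it is
  differentiated. The integrand lies in [0, 1], and an infinite integral would give the value 0 on
  both sides.\<close>

lemma pgfl_rate_eq_integral:
  assumes h [measurable]: "h \<in> borel_measurable borel" and h1: "\<And>x. 1 / 2 \<le> h x" "\<And>x. h x \<le> 1"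
  shows "(\<lambda>(u, \<omega>). \<Prod>x\<in>atoms (C \<omega>). h (x + u)) \<in> borel_measurable (lborel \<Otimes>\<^sub>M P)"
    and "pgfl_rate P C h = (\<integral>(u, \<omega>). 1 - (\<Prod>x\<in>atoms (C \<omega>). h (x + u)) \<partial>(lborel \<Otimes>\<^sub>M P))"
proof -
  have pos: "0 < h x" for x using h1(1)[of x] by simp
  have eq: "eneg (\<integral>\<^sup>+x. ennreal (- ln (h (x + u))) \<partial>C \<omega>) = ennreal (\<Prod>x\<in>atoms (C \<omega>). h (x + u))"
    if "\<omega> \<in> space P" for u \<omega>
    using eneg_neg_ln_prod[OF C_counting[OF that] h pos h1(2)] by simp
  have m [measurable]: "(\<lambda>(u, \<omega>). eneg (\<integral>\<^sup>+x. ennreal (- ln (h (x + u))) \<partial>C \<omega>)) \<in> borel_measurable (lborel \<Otimes>\<^sub>M P)"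
    using measurable_compose[OF measurable_shifted_cluster_integral[of "\<lambda>x. ennreal (- ln (h x))" 1] measurable_eneg]
    by (simp add: split_beta)
  have p0: "0 \<le> (\<Prod>x\<in>A. h (x + u))" and p1: "(\<Prod>x\<in>A. h (x + u)) \<le> 1" for A u
    using less_imp_le[OF pos] h1(2) by (auto intro: prod_nonneg prod_le_1)
  have "(\<lambda>z. enn2real (case z of (u, \<omega>) \<Rightarrow> eneg (\<integral>\<^sup>+x. ennreal (- ln (h (x + u))) \<partial>C \<omega>))) \<in> borel_measurable (lborel \<Otimes>\<^sub>M P)"
    by measurable
  moreover have "enn2real (case z of (u, \<omega>) \<Rightarrow> eneg (\<integral>\<^sup>+x. ennreal (- ln (h (x + u))) \<partial>C \<omega>)) =
      (case z of (u, \<omega>) \<Rightarrow> \<Prod>x\<in>atoms (C \<omega>). h (x + u))" if "z \<in> space (lborel \<Otimes>\<^sub>M P)" for z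
    using that p0 by (auto simp: space_pair_measure eq)
  ultimately show meas: "(\<lambda>(u, \<omega>). \<Prod>x\<in>atoms (C \<omega>). h (x + u)) \<in> borel_measurable (lborel \<Otimes>\<^sub>M P)"
    by (simp cong: measurable_cong)
  have "cluster_rate P C (\<lambda>x. ennreal (- ln (h x))) =
      (\<integral>\<^sup>+u. \<integral>\<^sup>+\<omega>. (1 - eneg (\<integral>\<^sup>+x. ennreal (- ln (h (x + u))) \<partial>C \<omega>)) \<partial>P \<partial>lborel)"
    by (simp add: cluster_rate_def)
  also have "\<dots> = (\<integral>\<^sup>+z. (case z of (u, \<omega>) \<Rightarrow> 1 - eneg (\<integral>\<^sup>+x. ennreal (- ln (h (x + u))) \<partial>C \<omega>)) \<partial>(lborel \<Otimes>\<^sub>M P))"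
    by (subst P.nn_integral_fst[symmetric]) auto
  also have "\<dots> = (\<integral>\<^sup>+z. ennreal (case z of (u, \<omega>) \<Rightarrow> 1 - (\<Prod>x\<in>atoms (C \<omega>). h (x + u))) \<partial>(lborel \<Otimes>\<^sub>M P))"
    using p0 p1 by (intro nn_integral_cong)
      (auto simp: space_pair_measure eq ennreal_minus simp flip: ennreal_1)
  finally show "pgfl_rate P C h = (\<integral>(u, \<omega>). 1 - (\<Prod>x\<in>atoms (C \<omega>). h (x + u)) \<partial>(lborel \<Otimes>\<^sub>M P))"
    unfolding pgfl_rate_def using p1 meas
    by (subst integral_eq_nn_integral) (auto simp: case_prod_unfold)
qed

text \<open>Substituting t = x + u turns the integral over positions into a function of y - x alone,
  and averaging over clusters then gives the second cumulant measure. Integrability comes from its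
  total mass, that is, from the second moment of the cluster size.\<close>

lemma integrable_cluster_pair_sum:
  assumes f0: "test_function f0" and f1: "test_function f1"
  shows "integrable (lborel \<Otimes>\<^sub>M P)
      (\<lambda>(u, \<omega>). \<Sum>x\<in>atoms (C \<omega>). \<Sum>y\<in>atoms (C \<omega>) - {x}. f0 (x + u) * f1 (y + u))" (is "integrable ?Q ?G")
    and "\<nu> * (\<integral>(u, \<omega>). (\<Sum>x\<in>atoms (C \<omega>). \<Sum>y\<in>atoms (C \<omega>) - {x}. f0 (x + u) * f1 (y + u)) \<partial>(lborel \<Otimes>\<^sub>M P)) =
      enn2real (\<integral>\<^sup>+\<tau>. \<integral>\<^sup>+t. ennreal (f0 t * f1 (t + \<tau>)) \<partial>lborel \<partial>second_cumulant \<nu> P C)"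
proof -
  interpret Q: pair_sigma_finite lborel P ..
  interpret R: finite_measure "second_cumulant \<nu> P C" by (rule finite_measure_second_cumulant)
  have [measurable]: "f0 \<in> borel_measurable borel" "f1 \<in> borel_measurable borel"
    and nonneg: "\<And>x. 0 \<le> f0 x" "\<And>x. 0 \<le> f1 x"
    using f0 f1 by (auto simp: test_function_def)
  obtain b0 where b0: "\<And>x. f0 x \<le> b0" using f0 unfolding test_function_def by auto
  obtain b1 where b1: "\<And>x. f1 x \<le> b1" using f1 unfolding test_function_def by auto
  obtain r where r: "\<And>x. f0 x \<noteq> 0 \<Longrightarrow> \<bar>x\<bar> \<le> r" using f0 unfolding test_function_def bounded_real by auto
  note b = b0 b1
  have f01: "test_function (\<lambda>x. f0 x * f1 x)"
    unfolding test_function_def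
  proof (intro conjI exI allI)
    show "f0 x * f1 x \<le> b0 * b1" for x using nonneg b by (intro mult_mono order_trans[OF nonneg(1) b(1)]) auto
    show "bounded {x. f0 x * f1 x \<noteq> 0}"
      using f0 by (rule_tac bounded_subset[of "{x. f0 x \<noteq> 0}"]) (auto simp: test_function_def)
  qed (use nonneg in auto)
  \<comment> \<open>The correlation of the two test functions at lag \<tau>; it is bounded because
    f0 and f1 are bounded and f0 has bounded support.\<close>
  define g where "g \<tau> = (\<integral>\<^sup>+t. ennreal (f0 t * f1 (t + \<tau>)) \<partial>lborel)" for \<tau>
  have g [measurable]: "g \<in> borel_measurable borel" unfolding g_def by measurable
  define V where "V = (\<integral>\<^sup>+\<omega>. (\<Sum>x\<in>atoms (C \<omega>). \<Sum>y\<in>atoms (C \<omega>) - {x}. g (y - x)) \<partial>P)"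
  have V: "ennreal \<nu> * V = (\<integral>\<^sup>+\<tau>. g \<tau> \<partial>second_cumulant \<nu> P C)"
    unfolding V_def by (simp add: nn_integral_second_cumulant)
  have "g \<tau> \<le> ennreal (b0 * b1) * emeasure lborel {- r..r}" for \<tau>
  proof -
    have "g \<tau> \<le> (\<integral>\<^sup>+t. ennreal (b0 * b1) * indicator {- r..r} t \<partial>lborel)"
      unfolding g_def
    proof (rule nn_integral_mono)
      fix t
      have "f0 t * f1 (t + \<tau>) \<le> b0 * b1"
        using nonneg b by (intro mult_mono order_trans[OF nonneg(1) b(1)]) auto
      then show "ennreal (f0 t * f1 (t + \<tau>)) \<le> ennreal (b0 * b1) * indicator {- r..r} t"
        using r[of t] by (cases "f0 t = 0") (auto simp: ennreal_leI abs_le_iff)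
    qed
    then show ?thesis by (simp add: nn_integral_cmult_indicator)
  qed
  then have "(\<integral>\<^sup>+\<tau>. g \<tau> \<partial>second_cumulant \<nu> P C) \<le>
      (\<integral>\<^sup>+\<tau>. ennreal (b0 * b1) * emeasure lborel {- r..r} \<partial>second_cumulant \<nu> P C)"
    by (intro nn_integral_mono)
  also have "\<dots> < \<top>"
    by (auto simp: less_top[symmetric] ennreal_mult_eq_top_iff emeasure_lborel_Icc_eq)
  finally have V_fin: "V < \<top>" using \<nu>_pos by (auto simp: V[symmetric] ennreal_mult_less_top)
  \<comment> \<open>The sum over distinct pairs is a product of single sums minus the diagonal,
    which reduces its measurability to that of cluster sums.\<close>
  have "?G z = (case z of (u, \<omega>) \<Rightarrow> \<Sum>x\<in>atoms (C \<omega>). f0 (x + u)) * (case z of (u, \<omega>) \<Rightarrow> \<Sum>x\<in>atoms (C \<omega>). f1 (x + u)) -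
      (case z of (u, \<omega>) \<Rightarrow> \<Sum>x\<in>atoms (C \<omega>). f0 (x + u) * f1 (x + u))" if z: "z \<in> space ?Q" for z
  proof -
    obtain u \<omega> where z': "z = (u, \<omega>)" "\<omega> \<in> space P" using z by (auto simp: space_pair_measure)
    have "(\<Sum>y\<in>atoms (C \<omega>) - {x}. f0 (x + u) * f1 (y + u)) =
        f0 (x + u) * (\<Sum>y\<in>atoms (C \<omega>). f1 (y + u)) - f0 (x + u) * f1 (x + u)" if "x \<in> atoms (C \<omega>)" for x
      using that atoms_C(1)[OF z'(2)] by (simp add: sum_diff1 sum_distrib_left)
    then show ?thesis by (simp add: z' sum_subtractf sum_distrib_right)
  qed
  moreover have "(\<lambda>z. (case z of (u, \<omega>) \<Rightarrow> \<Sum>x\<in>atoms (C \<omega>). f0 (x + u)) * (case z of (u, \<omega>) \<Rightarrow> \<Sum>x\<in>atoms (C \<omega>). f1 (x + u)) -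
      (case z of (u, \<omega>) \<Rightarrow> \<Sum>x\<in>atoms (C \<omega>). f0 (x + u) * f1 (x + u))) \<in> borel_measurable ?Q"
    by (intro borel_measurable_diff borel_measurable_times borel_measurable_integrable integrable_cluster_sum f0 f1 f01)
  ultimately have G: "?G \<in> borel_measurable ?Q" by (simp cong: measurable_cong)
  have G0: "0 \<le> ?G z" for z using nonneg by (auto intro!: sum_nonneg split: prod.split)
  have nn: "(\<integral>\<^sup>+z. ennreal (?G z) \<partial>?Q) = V"
  proof -
    have "(\<integral>\<^sup>+z. ennreal (?G z) \<partial>?Q) = (\<integral>\<^sup>+\<omega>. \<integral>\<^sup>+u. ennreal (?G (u, \<omega>)) \<partial>lborel \<partial>P)"
      by (rule Q.nn_integral_snd[symmetric]) (use G in measurable)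
    also have "\<dots> = V"
      unfolding V_def
    proof (rule nn_integral_cong)
      fix \<omega> assume \<omega>: "\<omega> \<in> space P"
      have "(\<integral>\<^sup>+u. ennreal (?G (u, \<omega>)) \<partial>lborel) =
          (\<integral>\<^sup>+u. (\<Sum>x\<in>atoms (C \<omega>). \<Sum>y\<in>atoms (C \<omega>) - {x}. ennreal (f0 (x + u) * f1 (y + u))) \<partial>lborel)"
        using nonneg by (simp add: sum_ennreal sum_nonneg)
      also have "\<dots> = (\<Sum>x\<in>atoms (C \<omega>). \<Sum>y\<in>atoms (C \<omega>) - {x}. \<integral>\<^sup>+u. ennreal (f0 (x + u) * f1 (y + u)) \<partial>lborel)"
        by (simp add: nn_integral_sum)
      also have "\<dots> = (\<Sum>x\<in>atoms (C \<omega>). \<Sum>y\<in>atoms (C \<omega>) - {x}. g (y - x))"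
      proof (intro sum.cong refl)
        fix x y
        have "g (y - x) = (\<integral>\<^sup>+u. ennreal (f0 (x + 1 * u) * f1 (x + 1 * u + (y - x))) \<partial>lborel)"
          unfolding g_def by (subst nn_integral_real_affine[where c=1 and t=x]) auto
        then show "(\<integral>\<^sup>+u. ennreal (f0 (x + u) * f1 (y + u)) \<partial>lborel) = g (y - x)"
          by (simp add: algebra_simps)
      qed
      finally show "(\<integral>\<^sup>+u. ennreal (?G (u, \<omega>)) \<partial>lborel) = (\<Sum>x\<in>atoms (C \<omega>). \<Sum>y\<in>atoms (C \<omega>) - {x}. g (y - x))" .
    qed
    finally show ?thesis .
  qed
  show "integrable ?Q ?G"
    by (rule integrableI_nonneg[OF G]) (use G0 nn V_fin in auto)
  have "(\<integral>z. ?G z \<partial>?Q) = enn2real V"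
    using integral_eq_nn_integral[OF G AE_I2[OF G0]] nn by simp
  then have "\<nu> * (\<integral>z. ?G z \<partial>?Q) = enn2real (ennreal \<nu> * V)"
    using \<nu>_pos by (simp add: enn2real_mult)
  then show "\<nu> * (\<integral>z. ?G z \<partial>?Q) =
      enn2real (\<integral>\<^sup>+\<tau>. \<integral>\<^sup>+t. ennreal (f0 t * f1 (t + \<tau>)) \<partial>lborel \<partial>second_cumulant \<nu> P C)"
    by (simp add: V g_def)
qed

text \<open>In the product of 1 + y f 1 + z f 0 over the cluster, the derivative in z singles out
  one point and the derivative in y a second, different one; hence the sum over ordered pairs. The
  inner derivative is needed for all small y, since the outer one acts on it as a function of
  y.\<close>

lemma mixed_left_deriv_pgfl_rate:
  assumes f: "\<And>j. j < 2 \<Longrightarrow> test_function (f j)"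
  shows "mixed_left_deriv 2 (\<lambda>s. - \<nu> * pgfl_rate P C (\<lambda>x. 1 + (\<Sum>j<2. s j * f j x))) (\<lambda>_. 0)
    (enn2real (\<integral>\<^sup>+\<tau>. \<integral>\<^sup>+t. ennreal (f 0 t * f 1 (t + \<tau>)) \<partial>lborel \<partial>second_cumulant \<nu> P C))"
proof -
  let ?Q = "lborel \<Otimes>\<^sub>M P"
  have f0: "test_function (f 0)" and f1: "test_function (f 1)" using f by auto
  have [measurable]: "f 0 \<in> borel_measurable borel" "f 1 \<in> borel_measurable borel"
    and nonneg: "\<And>x. 0 \<le> f 0 x" "\<And>x. 0 \<le> f 1 x"
    using f0 f1 by (auto simp: test_function_def)
  have "\<exists>\<delta>>0. \<forall>s x. (\<forall>j<2. s j \<in> {-\<delta><..0}) \<longrightarrow>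
      1 / 2 \<le> 1 + (\<Sum>j<2. s j * f j x) \<and> 1 + (\<Sum>j<2. s j * f j x) \<le> 1"
    by (rule test_functions_factor_bounds) (rule f)
  then obtain \<delta> where \<delta>: "0 < \<delta>"
    "\<forall>s x. (\<forall>j<2. s j \<in> {-\<delta><..0}) \<longrightarrow>
      1 / 2 \<le> 1 + (\<Sum>j<2. s j * f j x) \<and> 1 + (\<Sum>j<2. s j * f j x) \<le> 1"
    by (elim exE conjE)
  have sum2: "(\<Sum>j<2. s j * f j x) = s 0 * f 0 x + s 1 * f 1 x" for s x
    by (simp add: numeral_2_eq_2)
  define a where "a y v = 1 + y * f 1 v" for y v
  define F where "F y z = (\<lambda>(u, \<omega>). \<Prod>x\<in>atoms (C \<omega>). a y (x + u) + z * f 0 (x + u))" for y z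
  define G where "G y = (\<lambda>(u, \<omega>). \<Sum>x\<in>atoms (C \<omega>). f 0 (x + u) * (\<Prod>x'\<in>atoms (C \<omega>) - {x}. a y (x' + u)))" for y
  define H where "H = (\<lambda>(u, \<omega>). \<Sum>x\<in>atoms (C \<omega>). \<Sum>y\<in>atoms (C \<omega>) - {x}. f 0 (x + u) * f 1 (y + u))"
  have bound: "1 / 2 \<le> a y v + z * f 0 v" "a y v + z * f 0 v \<le> 1" if "y \<in> {-\<delta><..0}" "z \<in> {-\<delta><..0}" for y z v
    using \<delta>(2)[rule_format, of "\<lambda>j. if j = 0 then z else y" v] that by (auto simp: sum2 a_def add_ac)
  have rate: "pgfl_rate P C (\<lambda>x. 1 + (\<Sum>j<2. s j * f j x)) = (\<integral>q. 1 - F (s 1) (s 0) q \<partial>?Q)"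
    and F_meas: "F (s 1) (s 0) \<in> borel_measurable ?Q"
    if "s 1 \<in> {-\<delta><..0}" "s 0 \<in> {-\<delta><..0}" for s :: "nat \<Rightarrow> real"
  proof -
    have h: "(\<lambda>x. 1 + (\<Sum>j<2. s j * f j x)) = (\<lambda>v. a (s 1) v + s 0 * f 0 v)"
      by (auto simp: sum2 a_def)
    have "(\<lambda>v. a (s 1) v + s 0 * f 0 v) \<in> borel_measurable borel" unfolding a_def by measurable
    from pgfl_rate_eq_integral[OF this bound[OF that]]
    show "pgfl_rate P C (\<lambda>x. 1 + (\<Sum>j<2. s j * f j x)) = (\<integral>q. 1 - F (s 1) (s 0) q \<partial>?Q)"
      "F (s 1) (s 0) \<in> borel_measurable ?Q"
      unfolding h F_def by (simp_all add: case_prod_unfold)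
  qed
  \<comment> \<open>Differences of the products in z are at most |z| times the cluster sum of f 0,
    uniformly in y, so the first moment suffices here. The factor -\<nu> and the minus sign in 1 - F
    cancel.\<close>
  have step1: "integrable ?Q (G y) \<and>
      ((\<lambda>z. - \<nu> * (\<integral>q. 1 - F y z q \<partial>?Q)) has_real_derivative \<nu> * (\<integral>q. G y q \<partial>?Q)) (at 0 within {..0})"
    if y: "y \<in> {-\<delta><..0}" for y
  proof -
    have a1: "\<bar>a y v\<bar> \<le> 1" for v using bound[OF y, of 0 v] \<delta>(1) by simp
    note I = has_left_derivative_integral[where F="\<lambda>z q. 1 - F y z q" and F'="\<lambda>q. - G y q" and Q="?Q"
        and w="\<lambda>(u, \<omega>). \<Sum>x\<in>atoms (C \<omega>). f 0 (x + u)", OF \<delta>(1)]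
    have m: "(\<lambda>q. 1 - F y z q) \<in> borel_measurable ?Q" if "z \<in> {-\<delta><..0}" for z
      using F_meas[of "\<lambda>j. if j = 0 then z else y"] y that by simp
    have i: "integrable ?Q (\<lambda>q. 1 - F y 0 q)"
    proof (rule Bochner_Integration.integrable_bound)
      show "integrable ?Q (\<lambda>q. \<bar>y\<bar> * (case q of (u, \<omega>) \<Rightarrow> \<Sum>x\<in>atoms (C \<omega>). f 1 (x + u)))"
        by (intro integrable_mult_right integrable_cluster_sum f1)
      show "(\<lambda>q. 1 - F y 0 q) \<in> borel_measurable ?Q" using m \<delta>(1) by simp
      have "\<bar>1 - F y 0 (u, \<omega>)\<bar> \<le> \<bar>y\<bar> * (\<Sum>x\<in>atoms (C \<omega>). f 1 (x + u))" for u \<omega>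
        using prod_affine_diff_le[of "atoms (C \<omega>)" "\<lambda>_. 1" y "\<lambda>x. f 1 (x + u)"] a1 nonneg
        by (simp add: F_def a_def abs_minus_commute)
      then show "AE q in ?Q. norm (1 - F y 0 q) \<le> norm (\<bar>y\<bar> * (case q of (u, \<omega>) \<Rightarrow> \<Sum>x\<in>atoms (C \<omega>). f 1 (x + u)))"
        by (intro AE_I2) (auto intro: order_trans[OF _ abs_ge_self])
    qed
    have l: "\<bar>(1 - F y z q) - (1 - F y 0 q)\<bar> \<le> \<bar>z\<bar> * (case q of (u, \<omega>) \<Rightarrow> \<Sum>x\<in>atoms (C \<omega>). f 0 (x + u))"
      if z: "z \<in> {-\<delta><..0}" for z q
    proof (cases q)
      case (Pair u \<omega>)
      have "\<bar>a y v + z * f 0 v\<bar> \<le> 1" for v using bound[OF y z, of v] by simp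
      then show ?thesis
        using prod_affine_diff_le[of "atoms (C \<omega>)" "\<lambda>x. a y (x + u)" z "\<lambda>x. f 0 (x + u)"] a1 nonneg
        by (simp add: F_def Pair abs_minus_commute)
    qed
    have d: "((\<lambda>z. 1 - F y z q) has_real_derivative - G y q) (at 0 within {..0})" for q
    proof (cases q)
      case (Pair u \<omega>)
      have "((\<lambda>z. 1 - (\<Prod>x\<in>atoms (C \<omega>). a y (x + u) + z * f 0 (x + u))) has_real_derivative
          0 - (\<Sum>x\<in>atoms (C \<omega>). f 0 (x + u) * (\<Prod>x'\<in>atoms (C \<omega>) - {x}. a y (x' + u)))) (at 0 within {..0})"
        by (intro DERIV_diff DERIV_const has_derivative_prod_affine)
      then show ?thesis by (simp add: F_def G_def Pair)
    qed
    note J = I[OF m i integrable_cluster_sum[OF f0] l d]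
    have "((\<lambda>z. - \<nu> * (\<integral>q. 1 - F y z q \<partial>?Q)) has_real_derivative - \<nu> * (\<integral>q. - G y q \<partial>?Q)) (at 0 within {..0})"
      by (rule DERIV_cmult[OF J(3)])
    with J(2) show ?thesis by simp
  qed
  have H: "integrable ?Q H" and H_int: "\<nu> * (\<integral>q. H q \<partial>?Q) =
      enn2real (\<integral>\<^sup>+\<tau>. \<integral>\<^sup>+t. ennreal (f 0 t * f 1 (t + \<tau>)) \<partial>lborel \<partial>second_cumulant \<nu> P C)"
    unfolding H_def by (fact integrable_cluster_pair_sum[OF f0 f1])+
  \<comment> \<open>The second moment enters here. A product over the points other than x differs
    from 1 by at most |y| times the sum of f 1 over them, so the derivative H at 0 is its own
    dominating function.\<close>
  have "((\<lambda>y. \<integral>q. G y q \<partial>?Q) has_real_derivative (\<integral>q. H q \<partial>?Q)) (at 0 within {..0})"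
  proof (rule has_left_derivative_integral(3)[OF \<delta>(1) _ _ H])
    show "G y \<in> borel_measurable ?Q" if "y \<in> {-\<delta><..0}" for y
      using step1[OF that] by auto
    show "integrable ?Q (G 0)" using step1[of 0] \<delta>(1) by simp
    fix q :: "real \<times> 'p"
    obtain u \<omega> where q: "q = (u, \<omega>)" by (cases q)
    show "\<bar>G y q - G 0 q\<bar> \<le> \<bar>y\<bar> * H q" if y: "y \<in> {-\<delta><..0}" for y
    proof -
      have a1: "\<bar>a y v\<bar> \<le> 1" for v using bound[OF y, of 0 v] \<delta>(1) by simp
      have le: "\<bar>(\<Prod>x'\<in>A. a y (x' + u)) - 1\<bar> \<le> \<bar>y\<bar> * (\<Sum>x'\<in>A. f 1 (x' + u))" for A
        using prod_affine_diff_le[of A "\<lambda>_. 1" y "\<lambda>x. f 1 (x + u)"] a1 nonneg by (simp add: a_def)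
      have "\<bar>G y q - G 0 q\<bar> = \<bar>\<Sum>x\<in>atoms (C \<omega>). f 0 (x + u) * ((\<Prod>x'\<in>atoms (C \<omega>) - {x}. a y (x' + u)) - 1)\<bar>"
        by (simp add: G_def q a_def sum_subtractf right_diff_distrib)
      also have "\<dots> \<le> (\<Sum>x\<in>atoms (C \<omega>). f 0 (x + u) * (\<bar>y\<bar> * (\<Sum>x'\<in>atoms (C \<omega>) - {x}. f 1 (x' + u))))"
        using nonneg by (intro order_trans[OF sum_abs] sum_mono) (auto simp: abs_mult intro!: mult_left_mono le[unfolded One_nat_def])
      also have "\<dots> = \<bar>y\<bar> * H q"
        by (simp add: H_def q sum_distrib_left mult_ac)
      finally show ?thesis .
    qed
    have "((\<lambda>y. \<Sum>x\<in>atoms (C \<omega>). f 0 (x + u) * (\<Prod>x'\<in>atoms (C \<omega>) - {x}. 1 + y * f 1 (x' + u))) has_real_derivative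
        (\<Sum>x\<in>atoms (C \<omega>). f 0 (x + u) * (\<Sum>x'\<in>atoms (C \<omega>) - {x}. f 1 (x' + u) * (\<Prod>_\<in>atoms (C \<omega>) - {x} - {x'}. 1)))) (at 0 within {..0})"
      by (intro DERIV_sum DERIV_cmult has_derivative_prod_affine)
    then show "((\<lambda>y. G y q) has_real_derivative H q) (at 0 within {..0})"
      by (simp add: G_def H_def q a_def sum_distrib_left)
  qed
  then have step2: "((\<lambda>y. \<nu> * (\<integral>q. G y q \<partial>?Q)) has_real_derivative \<nu> * (\<integral>q. H q \<partial>?Q)) (at 0 within {..0})"
    by (rule DERIV_cmult)
  have inner: "mixed_left_deriv (Suc 0) (\<lambda>s. - \<nu> * pgfl_rate P C (\<lambda>x. 1 + (\<Sum>j<2. s j * f j x)))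
      ((\<lambda>_. 0)(Suc 0 := y)) (\<nu> * (\<integral>q. G y q \<partial>?Q))" if y: "y \<in> {-\<delta><..0}" for y
    unfolding mixed_left_deriv.simps
  proof (intro exI[of _ "\<lambda>z. - \<nu> * (\<integral>q. 1 - F y z q \<partial>?Q)"] exI[of _ \<delta>] conjI ballI)
    fix z assume z: "z \<in> {-\<delta><..0}"
    show "- \<nu> * pgfl_rate P C (\<lambda>x. 1 + (\<Sum>j<2. (((\<lambda>_. 0)(Suc 0 := y))(0 := z)) j * f j x)) = - \<nu> * (\<integral>q. 1 - F y z q \<partial>?Q)"
      using rate[of "((\<lambda>_. 0)(Suc 0 := y))(0 := z)"] y z by simp
  qed (use \<delta>(1) step1[OF y] in auto)
  show ?thesis
    unfolding numeral_2_eq_2 mixed_left_deriv.simps(2)[of "Suc 0"]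
    unfolding numeral_2_eq_2[symmetric] H_int[symmetric]
    by (intro exI[of _ "\<lambda>y. \<nu> * (\<integral>q. G y q \<partial>?Q)"] exI[of _ \<delta>] conjI ballI \<delta>(1) inner step2)
qed

end

section \<open>Derivatives of the logarithm of the generating functional\<close>

context cluster_model_mean
begin

text \<open>Linearity of the derivative, applied to the mixture formula, which is valid for small
  nonpositive parameters. Reflection of h amounts to reflecting every test function.\<close>

lemma mixed_left_deriv_log_pgfl:
  assumes f: "\<And>j. j < n \<Longrightarrow> test_function (f j)"
    and D: "mixed_left_deriv n (\<lambda>s. - \<nu> * pgfl_rate P C (\<lambda>x. 1 + (\<Sum>j<n. s j * f j x))) (\<lambda>_. 0) D"
    and D': "mixed_left_deriv n (\<lambda>s. - \<nu> * pgfl_rate P C (\<lambda>x. 1 + (\<Sum>j<n. s j * f j (- x)))) (\<lambda>_. 0) D'"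
  shows "mixed_left_deriv n (log_pgfl M N n f) (\<lambda>_. 0) ((1 + \<theta>) / 2 * D + (1 - \<theta>) / 2 * D')"
proof -
  have "\<exists>\<delta>>0. \<forall>s x. (\<forall>j<n. s j \<in> {-\<delta><..0}) \<longrightarrow>
      1 / 2 \<le> 1 + (\<Sum>j<n. s j * f j x) \<and> 1 + (\<Sum>j<n. s j * f j x) \<le> 1"
    by (rule test_functions_factor_bounds) (rule f)
  then obtain \<delta> where \<delta>: "0 < \<delta>" "\<forall>s x. (\<forall>j<n. s j \<in> {-\<delta><..0}) \<longrightarrow>
      1 / 2 \<le> 1 + (\<Sum>j<n. s j * f j x) \<and> 1 + (\<Sum>j<n. s j * f j x) \<le> 1"
    by (elim exE conjE)
  show ?thesis
  proof (rule mixed_left_deriv_cong[OF \<delta>(1) mixed_left_deriv_linear[OF D D']])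
    fix s :: "nat \<Rightarrow> real" assume s: "\<And>j. j < n \<Longrightarrow> s j \<in> {-\<delta><..0}"
    define h where "h x = 1 + (\<Sum>j<n. s j * f j x)" for x
    have h: "1 / 2 \<le> h x" "h x \<le> 1" for x
      using \<delta>(2)[rule_format, of s x] s by (simp_all add: h_def)
    have "log_pgfl M N n f s =
        - \<nu> * ((1 + \<theta>) / 2 * pgfl_rate P C h + (1 - \<theta>) / 2 * pgfl_rate P C (\<lambda>x. h (- x)))"
      by (rule log_pgfl_N[OF f h_def h])
    moreover have "(1 + \<theta>) / 2 * (- \<nu> * X) + (1 - \<theta>) / 2 * (- \<nu> * Y) =
        - \<nu> * ((1 + \<theta>) / 2 * X + (1 - \<theta>) / 2 * Y)" for X Y
      by (simp add: field_simps)
    ultimately show "(1 + \<theta>) / 2 * (- \<nu> * pgfl_rate P C (\<lambda>x. 1 + (\<Sum>j<n. s j * f j x))) +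
        (1 - \<theta>) / 2 * (- \<nu> * pgfl_rate P C (\<lambda>x. 1 + (\<Sum>j<n. s j * f j (- x)))) = log_pgfl M N n f s"
      by (simp only: h_def[abs_def])
  qed
qed

end

interpretation coordinates2: reduced_coordinates 2 "\<lambda>\<tau> i. \<tau> :: real"
proof
  show "\<exists>r. \<forall>\<tau>::real. (\<forall>i. 0 < i \<longrightarrow> i < (2::nat) \<longrightarrow> \<bar>\<tau>\<bar> \<le> R) \<longrightarrow> norm \<tau> \<le> r" for R
    by (intro exI[of _ R]) (auto dest: spec[of _ "1::nat"])
qed auto

context cluster_model_square
begin

lemma locally_finite_second_cumulant: "coordinates2.locally_finite (second_cumulant \<nu> P C)"
proof -
  interpret R: finite_measure "second_cumulant \<nu> P C" by (rule finite_measure_second_cumulant)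
  show ?thesis by (simp add: coordinates2.locally_finite_def less_top[symmetric])
qed

text \<open>The witness is positive, so the null measure is its negative part, and it is built from
  \<nu>, P and C alone. The reflected rate has the same derivative as the original one, by symmetry
  of the second cumulant.\<close>

theorem reduced_cumulant2_N:
  "reduced_cumulant2 M N (second_cumulant \<nu> P C, null_measure borel)"
proof -
  let ?\<rho> = "(second_cumulant \<nu> P C, null_measure borel :: real measure)"
  let ?U = "unreduce 2 (\<lambda>\<tau> i. \<tau> :: real)"
  let ?\<kappa> = "(?U (fst ?\<rho>), ?U (snd ?\<rho>))"
  interpret R: finite_measure "second_cumulant \<nu> P C" by (rule finite_measure_second_cumulant)
  interpret LR: pair_sigma_finite lborel "second_cumulant \<nu> P C" ..
  have lf: "coordinates2.locally_finite (fst ?\<rho>)" "coordinates2.locally_finite (snd ?\<rho>)"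
    using locally_finite_second_cumulant by (simp_all add: coordinates2.locally_finite_def)
  have red: "reduced_measure 2 (\<lambda>\<tau> i. \<tau>) ?\<kappa> ?\<rho>"
    by (rule coordinates2.reduced_measure_unreduce[OF lf])
  have "factorial_cumulant M N 2 ?\<kappa>"
    unfolding factorial_cumulant_def
  proof (intro conjI ballI allI impI)
    fix \<rho>' assume "\<rho>' \<in> {fst ?\<kappa>, snd ?\<kappa>}"
    then obtain m where m: "\<rho>' = ?U m" "coordinates2.locally_finite m" using lf by auto
    show "sets \<rho>' = sets (PiM {..<2} (\<lambda>_. borel))" by (simp add: m(1))
    show "emeasure \<rho>' {t \<in> space \<rho>'. \<forall>i<2. \<bar>t i\<bar> \<le> r} < \<infinity>" for r
      unfolding m(1) by (rule coordinates2.emeasure_unreduce_bounded[OF m(2)])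
  next
    fix f :: "nat \<Rightarrow> real \<Rightarrow> real" assume "\<forall>j<2. test_function (f j)"
    then have f: "\<And>j. j < 2 \<Longrightarrow> test_function (f j)" by blast
    have f': "test_function (\<lambda>x. f j (- x))" if "j < 2" for j
      using test_function_uminus[OF f[OF that]] .
    have f01: "test_function (f 0)" "test_function (f 1)" by (rule f, simp)+
    have [measurable]: "f 0 \<in> borel_measurable borel" "f 1 \<in> borel_measurable borel"
      and nonneg: "\<And>x. 0 \<le> f 0 x" "\<And>x. 0 \<le> f 1 x"
      using f01 by (auto simp: test_function_def)
    let ?F = "\<lambda>t. \<Prod>j<2. f j (t j)"
    define I where "I = (\<integral>\<^sup>+\<tau>. \<integral>\<^sup>+t. ennreal (f 0 t * f 1 (t + \<tau>)) \<partial>lborel \<partial>second_cumulant \<nu> P C)"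
    have D: "mixed_left_deriv 2 (\<lambda>s. - \<nu> * pgfl_rate P C (\<lambda>x. 1 + (\<Sum>j<2. s j * f j x))) (\<lambda>_. 0) (enn2real I)"
      unfolding I_def by (rule mixed_left_deriv_pgfl_rate[OF f])
    have "(\<integral>\<^sup>+t. ennreal (f 0 (- t) * f 1 (- (t + \<tau>))) \<partial>lborel) = (\<integral>\<^sup>+t. ennreal (f 0 t * f 1 (t + - \<tau>)) \<partial>lborel)" for \<tau>
    proof -
      \<comment> \<open>Replacing t by -t moves the reflection from the test functions to the lag
        \<tau>, where symmetry can absorb it.\<close>
      have "(\<lambda>t. ennreal (f 0 t * f 1 (t + - \<tau>))) \<in> borel_measurable borel" by measurable
      from nn_integral_real_affine[OF this, of "- 1" 0] show ?thesis by simp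
    qed
    then have "(\<integral>\<^sup>+\<tau>. \<integral>\<^sup>+t. ennreal (f 0 (- t) * f 1 (- (t + \<tau>))) \<partial>lborel \<partial>second_cumulant \<nu> P C) =
        (\<integral>\<^sup>+\<tau>. \<integral>\<^sup>+t. ennreal (f 0 t * f 1 (t + - \<tau>)) \<partial>lborel \<partial>second_cumulant \<nu> P C)"
      by (simp only:)
    also have "\<dots> = I"
      unfolding I_def by (rule second_cumulant_symmetric) measurable
    finally have I': "(\<integral>\<^sup>+\<tau>. \<integral>\<^sup>+t. ennreal (f 0 (- t) * f 1 (- (t + \<tau>))) \<partial>lborel \<partial>second_cumulant \<nu> P C) = I" .
    have D': "mixed_left_deriv 2 (\<lambda>s. - \<nu> * pgfl_rate P C (\<lambda>x. 1 + (\<Sum>j<2. s j * f j (- x)))) (\<lambda>_. 0) (enn2real I)"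
      using mixed_left_deriv_pgfl_rate[of "\<lambda>j x. f j (- x)", OF f'] unfolding I' by simp
    have "mixed_left_deriv 2 (log_pgfl M N 2 f) (\<lambda>_. 0) ((1 + \<theta>) / 2 * enn2real I + (1 - \<theta>) / 2 * enn2real I)"
      by (rule mixed_left_deriv_log_pgfl[OF f D D'])
    \<comment> \<open>Here \<theta> drops out: equal derivatives are mixed with weights that sum to
      1.\<close>
    moreover have "(1 + \<theta>) / 2 * enn2real I + (1 - \<theta>) / 2 * enn2real I = enn2real I"
      by (simp add: field_simps)
    moreover have "signed_integral ?\<kappa> ?F = enn2real I"
    proof -
      note F = coordinates2.product_test_function[OF f]
      have F0: "0 \<le> ?F t" for t using nonneg by (simp add: numeral_2_eq_2)
      have int: "(\<integral>t. ?F t \<partial>?U m) = enn2real (\<integral>\<^sup>+t. \<integral>\<^sup>+\<tau>. ennreal (f 0 t * f 1 (t + \<tau>)) \<partial>m \<partial>lborel)"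
        if m: "coordinates2.locally_finite m" for m
      proof -
        have "(\<integral>t. ?F t \<partial>?U m) = enn2real (\<integral>\<^sup>+t. ennreal (?F t) \<partial>?U m)"
          using F(1) F0 by (intro integral_eq_nn_integral) (simp_all cong: measurable_cong_sets)
        also have "(\<integral>\<^sup>+t. ennreal (?F t) \<partial>?U m) =
            (\<integral>\<^sup>+t. \<integral>\<^sup>+\<tau>. ennreal (?F (coordinates2.point t \<tau>)) \<partial>m \<partial>lborel)"
          using F(1) by (intro coordinates2.nn_integral_unreduce[OF m]) simp
        finally show ?thesis by (simp add: numeral_2_eq_2)
      qed
      have "(\<integral>\<^sup>+t. \<integral>\<^sup>+\<tau>. ennreal (f 0 t * f 1 (t + \<tau>)) \<partial>second_cumulant \<nu> P C \<partial>lborel) = I"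
        unfolding I_def by (rule LR.Fubini'[symmetric]) measurable
      then show ?thesis
        using int[OF lf(1)] int[OF lf(2)] by (simp add: signed_integral_def)
    qed
    ultimately show "mixed_left_deriv 2 (log_pgfl M N 2 f) (\<lambda>_. 0) (signed_integral ?\<kappa> ?F)" by simp
  qed
  with red show ?thesis unfolding reduced_cumulant2_def by blast
qed

section \<open>The Bartlett spectrum\<close>

text \<open>The identity is known for nonnegative integrands. A function bounded by 1 becomes
  nonnegative after adding 1, and the constant is subtracted again by linearity, all masses being
  finite.\<close>

lemma integral_second_cumulant:
  fixes g :: "real \<Rightarrow> real"
  assumes g [measurable]: "g \<in> borel_measurable borel" and bd: "\<And>x. \<bar>g x\<bar> \<le> 1"
  shows "integrable P (\<lambda>\<omega>. \<Sum>x\<in>atoms (C \<omega>). \<Sum>y\<in>atoms (C \<omega>) - {x}. g (y - x))"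
    and "(\<integral>\<tau>. g \<tau> \<partial>second_cumulant \<nu> P C) =
      \<nu> * (\<integral>\<omega>. (\<Sum>x\<in>atoms (C \<omega>). \<Sum>y\<in>atoms (C \<omega>) - {x}. g (y - x)) \<partial>P)"
proof -
  interpret R: finite_measure "second_cumulant \<nu> P C" by (rule finite_measure_second_cumulant)
  let ?S = "\<lambda>h \<omega>. \<Sum>x\<in>atoms (C \<omega>). \<Sum>y\<in>atoms (C \<omega>) - {x}. h (y - x) :: real"
  have nonneg: "integrable P (?S h) \<and> (\<integral>\<tau>. h \<tau> \<partial>second_cumulant \<nu> P C) = \<nu> * (\<integral>\<omega>. ?S h \<omega> \<partial>P)"
    if h [measurable]: "h \<in> borel_measurable borel" and h0: "\<And>x. 0 \<le> h x" "\<And>x. h x \<le> 2" for h :: "real \<Rightarrow> real"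
  proof -
    have S0: "0 \<le> ?S h \<omega>" for \<omega> by (intro sum_nonneg h0(1))
    have eq: "(\<Sum>x\<in>atoms (C \<omega>). \<Sum>y\<in>atoms (C \<omega>) - {x}. ennreal (h (y - x))) = ennreal (?S h \<omega>)" for \<omega>
    proof -
      have "(\<Sum>y\<in>atoms (C \<omega>) - {x}. ennreal (h (y - x))) = ennreal (\<Sum>y\<in>atoms (C \<omega>) - {x}. h (y - x))" for x
        by (rule sum_ennreal) (rule h0(1))
      moreover have "(\<Sum>x\<in>atoms (C \<omega>). ennreal (\<Sum>y\<in>atoms (C \<omega>) - {x}. h (y - x))) = ennreal (?S h \<omega>)"
        by (rule sum_ennreal) (intro sum_nonneg h0(1))
      ultimately show ?thesis by (simp only:)
    qed
    have hm: "(\<lambda>x. ennreal (h x)) \<in> borel_measurable borel" by measurable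
    note nn = nn_integral_second_cumulant[OF hm, unfolded eq]
    have m: "(\<lambda>\<omega>. ?S h \<omega>) \<in> borel_measurable P"
    proof -
      have "(\<lambda>\<omega>. enn2real (ennreal (?S h \<omega>))) \<in> borel_measurable P" using nn(2) by measurable
      then show ?thesis using S0 by simp
    qed
    have "(\<integral>\<^sup>+\<tau>. ennreal (h \<tau>) \<partial>second_cumulant \<nu> P C) \<le> (\<integral>\<^sup>+\<tau>. 2 \<partial>second_cumulant \<nu> P C)"
      using h0 by (intro nn_integral_mono) (metis ennreal_leI ennreal_numeral zero_le_numeral)
    also have "\<dots> < \<top>" by (simp add: less_top[symmetric] ennreal_mult_eq_top_iff)
    finally have "(\<integral>\<^sup>+\<omega>. ennreal (?S h \<omega>) \<partial>P) < \<top>"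
      using nn(1) \<nu>_pos by (auto simp: ennreal_mult_less_top)
    then have int: "integrable P (?S h)" using m S0 by (intro integrableI_nonneg) auto
    have "(\<integral>\<tau>. h \<tau> \<partial>second_cumulant \<nu> P C) = enn2real (ennreal \<nu> * (\<integral>\<^sup>+\<omega>. ennreal (?S h \<omega>) \<partial>P))"
      using nn(1) h0 by (subst integral_eq_nn_integral) auto
    also have "\<dots> = \<nu> * (\<integral>\<omega>. ?S h \<omega> \<partial>P)"
      using \<nu>_pos m S0 by (simp add: enn2real_mult integral_eq_nn_integral)
    finally show ?thesis using int by simp
  qed
  have gb: "0 \<le> 1 + g x" "1 + g x \<le> 2" for x using bd[of x] by auto
  have one: "integrable P (?S (\<lambda>_. 1))" "(\<integral>\<tau>. 1 \<partial>second_cumulant \<nu> P C) = \<nu> * (\<integral>\<omega>. ?S (\<lambda>_. 1) \<omega> \<partial>P)"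
    using nonneg[of "\<lambda>_. 1"] by simp_all
  have two: "integrable P (?S (\<lambda>x. 1 + g x))"
    "(\<integral>\<tau>. 1 + g \<tau> \<partial>second_cumulant \<nu> P C) = \<nu> * (\<integral>\<omega>. ?S (\<lambda>x. 1 + g x) \<omega> \<partial>P)"
    using nonneg[of "\<lambda>x. 1 + g x"] gb by simp_all
  have split: "?S g \<omega> = ?S (\<lambda>x. 1 + g x) \<omega> - ?S (\<lambda>_. 1) \<omega>" for \<omega>
    by (simp only: sum_subtractf[symmetric] add_diff_cancel_left')
  show "integrable P (?S g)"
    unfolding split by (rule Bochner_Integration.integrable_diff[OF two(1) one(1)])
  have gi: "integrable (second_cumulant \<nu> P C) g"
    using bd by (intro R.integrable_const_bound[of _ 1]) auto
  have "(\<integral>\<tau>. g \<tau> \<partial>second_cumulant \<nu> P C) =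
      (\<integral>\<tau>. 1 + g \<tau> \<partial>second_cumulant \<nu> P C) - (\<integral>\<tau>. 1 \<partial>second_cumulant \<nu> P C)"
    using gi by simp
  also have "\<dots> = \<nu> * ((\<integral>\<omega>. ?S (\<lambda>x. 1 + g x) \<omega> \<partial>P) - (\<integral>\<omega>. ?S (\<lambda>_. 1) \<omega> \<partial>P))"
    unfolding one(2) two(2) by (simp only: right_diff_distrib)
  also have "\<dots> = \<nu> * (\<integral>\<omega>. ?S g \<omega> \<partial>P)"
    unfolding split by (simp only: Bochner_Integration.integral_diff[OF two(1) one(1)])
  finally show "(\<integral>\<tau>. g \<tau> \<partial>second_cumulant \<nu> P C) = \<nu> * (\<integral>\<omega>. ?S g \<omega> \<partial>P)" .
qed

lemma fourier_measure_cluster: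
  assumes \<omega>: "\<omega> \<in> space P"
  shows "fourier_measure (C \<omega>) w = (\<Sum>x\<in>atoms (C \<omega>). exp (- (\<i> * complex_of_real (w * x))))"
proof -
  note \<mu> = C_counting[OF \<omega>]
  have meas: "g \<in> borel_measurable (C \<omega>)" if "g \<in> borel_measurable borel" for g :: "real \<Rightarrow> complex"
    using that measurable_cong_sets[OF sets_finite_simple_counting[OF \<mu>] refl] by blast
  let ?f = "\<lambda>x::real. exp (- (\<i> * complex_of_real (w * x)))"
  have "fourier_measure (C \<omega>) w = (\<integral>x. (\<Sum>y\<in>atoms (C \<omega>). indicator {y} x *\<^sub>R ?f y) \<partial>C \<omega>)"
    unfolding fourier_measure_def
  proof (rule integral_cong_AE)
    have "AE x in C \<omega>. x \<in> atoms (C \<omega>)"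
      by (rule AE_atoms[OF finite_simple_counting_locally_finite[OF \<mu>]])
    then show "AE x in C \<omega>. exp (- (\<i> * complex_of_real (w \<bullet> x))) = (\<Sum>y\<in>atoms (C \<omega>). indicator {y} x *\<^sub>R ?f y)"
    proof eventually_elim
      case (elim x)
      have "(\<Sum>y\<in>atoms (C \<omega>). indicator {y} x *\<^sub>R ?f y) = (\<Sum>y\<in>atoms (C \<omega>). if y = x then ?f y else 0)"
        by (intro sum.cong) (auto simp: indicator_def)
      with elim atoms_C(1)[OF \<omega>] show ?case by (simp add: sum.delta)
    qed
    show "(\<lambda>x. exp (- (\<i> * complex_of_real (w \<bullet> x)))) \<in> borel_measurable (C \<omega>)"
      by (rule meas) measurable
    show "(\<lambda>x. \<Sum>y\<in>atoms (C \<omega>). indicator {y} x *\<^sub>R ?f y) \<in> borel_measurable (C \<omega>)"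
      by (rule meas) measurable
  qed
  also have "\<dots> = (\<Sum>y\<in>atoms (C \<omega>). \<integral>x. indicator {y} x *\<^sub>R ?f y \<partial>C \<omega>)"
  proof (rule Bochner_Integration.integral_sum)
    fix y assume "y \<in> atoms (C \<omega>)"
    then have "emeasure (C \<omega>) {y} < \<infinity>" by (simp add: emeasure_atom[OF \<mu>])
    moreover have "{y} \<in> sets (C \<omega>)" by (simp add: sets_finite_simple_counting[OF \<mu>])
    ultimately show "integrable (C \<omega>) (\<lambda>x. indicator {y} x *\<^sub>R ?f y)"
      by (rule_tac integrable_scaleR_left, rule_tac integrable_real_indicator)
  qed
  also have "\<dots> = (\<Sum>y\<in>atoms (C \<omega>). ?f y)"
  proof (intro sum.cong refl)
    fix y assume "y \<in> atoms (C \<omega>)"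
    then have fin: "integrable (C \<omega>) (indicator {y} :: real \<Rightarrow> real)"
      by (intro integrable_real_indicator) (simp_all add: emeasure_atom[OF \<mu>] sets_finite_simple_counting[OF \<mu>])
    have "measure (C \<omega>) {y} = 1" using \<open>y \<in> atoms (C \<omega>)\<close> by (simp add: measure_def emeasure_atom[OF \<mu>])
    then show "(\<integral>x. indicator {y} x *\<^sub>R ?f y \<partial>C \<omega>) = ?f y"
      using sets_eq_imp_space_eq[OF sets_finite_simple_counting[OF \<mu>]] fin by (subst integral_scaleR_left) auto
  qed
  finally show ?thesis .
qed

text \<open>The squared modulus is a double sum of cos(w (y - x)). Its diagonal counts the points
  and becomes the intensity term of the spectrum; the rest is the cosine transform of the pair
  differences.\<close>

lemma cmod_fourier_cluster:
  assumes \<omega>: "\<omega> \<in> space P"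
  shows "(cmod (fourier_measure (C \<omega>) w))\<^sup>2 = measure (C \<omega>) UNIV +
    (\<Sum>x\<in>atoms (C \<omega>). \<Sum>y\<in>atoms (C \<omega>) - {x}. cos (w * (y - x)))"
proof -
  let ?A = "atoms (C \<omega>)"
  have A: "finite ?A" by (rule atoms_C(1)[OF \<omega>])
  have Re: "Re (fourier_measure (C \<omega>) w) = (\<Sum>x\<in>?A. cos (w * x))"
    and Im: "Im (fourier_measure (C \<omega>) w) = - (\<Sum>x\<in>?A. sin (w * x))"
    by (simp_all add: fourier_measure_cluster[OF \<omega>] Re_exp Im_exp sum_negf)
  have "(cmod (fourier_measure (C \<omega>) w))\<^sup>2 = (\<Sum>x\<in>?A. cos (w * x))\<^sup>2 + (\<Sum>x\<in>?A. sin (w * x))\<^sup>2"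
    by (simp add: cmod_power2 Re Im)
  also have "\<dots> = (\<Sum>x\<in>?A. \<Sum>y\<in>?A. cos (w * (y - x)))"
    by (simp add: power2_eq_square sum_product right_diff_distrib cos_diff sum.distrib mult_ac)
  also have "\<dots> = (\<Sum>x\<in>?A. 1 + (\<Sum>y\<in>?A - {x}. cos (w * (y - x))))"
    using A by (intro sum.cong refl) (simp add: sum.remove)
  also have "\<dots> = real (card ?A) + (\<Sum>x\<in>?A. \<Sum>y\<in>?A - {x}. cos (w * (y - x)))"
    by (simp add: sum.distrib)
  finally show ?thesis by (simp add: measure_def atoms_C(2)[OF \<omega>])
qed

lemma integrable_cluster_size: "integrable P (\<lambda>\<omega>. measure (C \<omega>) UNIV)"
  and nn_integral_cluster_size: "(\<integral>\<^sup>+\<omega>. emeasure (C \<omega>) UNIV \<partial>P) = ennreal (\<integral>\<omega>. measure (C \<omega>) UNIV \<partial>P)"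
proof -
  have [measurable]: "(\<lambda>\<omega>. emeasure (C \<omega>) UNIV) \<in> borel_measurable P"
    by (rule measurable_compose[OF C measurable_emeasure_cluster_algebra]) simp
  have eq: "(\<integral>\<^sup>+\<omega>. ennreal (measure (C \<omega>) UNIV) \<partial>P) = (\<integral>\<^sup>+\<omega>. emeasure (C \<omega>) UNIV \<partial>P)"
    by (intro nn_integral_cong) (simp add: measure_def atoms_C(2) ennreal_of_nat_eq_real_of_nat)
  show int: "integrable P (\<lambda>\<omega>. measure (C \<omega>) UNIV)"
    using finite_mean by (intro integrableI_nonneg) (simp_all add: eq, simp add: measure_def)
  show "(\<integral>\<^sup>+\<omega>. emeasure (C \<omega>) UNIV \<partial>P) = ennreal (\<integral>\<omega>. measure (C \<omega>) UNIV \<partial>P)"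
    unfolding eq[symmetric] by (rule nn_integral_eq_integral[OF int]) simp
qed

lemma has_intensity_N: "has_intensity M N (\<nu> * (\<integral>\<omega>. measure (C \<omega>) UNIV \<partial>P))"
  unfolding has_intensity_def
  using \<nu>_pos by (auto simp: emeasure_mean_N nn_integral_cluster_size ennreal_mult mult.assoc
      intro!: mult_nonneg_nonneg integral_nonneg_AE)

theorem bartlett_spectrum_N:
  "bartlett_spectrum M N (\<lambda>w. complex_of_real (\<nu> * (\<integral>\<omega>. (cmod (fourier_measure (C \<omega>) w))\<^sup>2 \<partial>P)))"
  unfolding bartlett_spectrum_def
proof (intro exI[of _ "\<nu> * (\<integral>\<omega>. measure (C \<omega>) UNIV \<partial>P)"]
    exI[of _ "(second_cumulant \<nu> P C, null_measure borel :: real measure)"] conjI allI)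
  interpret R: finite_measure "second_cumulant \<nu> P C" by (rule finite_measure_second_cumulant)
  show "has_intensity M N (\<nu> * (\<integral>\<omega>. measure (C \<omega>) UNIV \<partial>P))" by (rule has_intensity_N)
  show "reduced_cumulant2 M N (second_cumulant \<nu> P C, null_measure borel)" by (rule reduced_cumulant2_N)
  show "finite_measure (fst (second_cumulant \<nu> P C, null_measure borel :: real measure))"
    by (simp add: finite_measure_second_cumulant)
  show "finite_measure (snd (second_cumulant \<nu> P C, null_measure borel :: real measure))"
    by (rule finite_measureI) simp
  fix w
  let ?f = "\<lambda>\<tau>::real. exp (- (\<i> * complex_of_real (w \<bullet> \<tau>)))"
  let ?S = "\<lambda>h \<omega>. \<Sum>x\<in>atoms (C \<omega>). \<Sum>y\<in>atoms (C \<omega>) - {x}. h (w * (y - x)) :: real"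
  have fi: "integrable (second_cumulant \<nu> P C) ?f"
    by (intro R.integrable_const_bound[of _ 1]) auto
  have cos: "integrable P (?S cos)" "(\<integral>\<tau>. cos (w * \<tau>) \<partial>second_cumulant \<nu> P C) = \<nu> * (\<integral>\<omega>. ?S cos \<omega> \<partial>P)"
    using integral_second_cumulant[of "\<lambda>\<tau>. cos (w * \<tau>)"] by simp_all
  \<comment> \<open>The sine is odd and the set of ordered pairs symmetric, so the transform of the
    second cumulant is real.\<close>
  have "?S sin \<omega> = 0" if "\<omega> \<in> space P" for \<omega>
  proof -
    have "?S sin \<omega> = (\<Sum>x\<in>atoms (C \<omega>). \<Sum>y\<in>atoms (C \<omega>) - {x}. sin (w * (x - y)))"
      by (rule sum_off_diagonal_swap[OF atoms_C(1)[OF that]])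
    also have "\<dots> = - ?S sin \<omega>"
      by (simp add: sum_negf[symmetric] sin_minus[symmetric] algebra_simps del: sin_minus)
    finally show ?thesis by simp
  qed
  then have "(\<integral>\<omega>. ?S sin \<omega> \<partial>P) = 0" by (simp cong: Bochner_Integration.integral_cong)
  then have sin: "(\<integral>\<tau>. sin (w * \<tau>) \<partial>second_cumulant \<nu> P C) = 0"
    using integral_second_cumulant(2)[of "\<lambda>\<tau>. sin (w * \<tau>)"] by simp
  have "fourier_measure (second_cumulant \<nu> P C) w = complex_of_real (\<nu> * (\<integral>\<omega>. ?S cos \<omega> \<partial>P))"
  proof (rule complex_eqI)
    show "Re (fourier_measure (second_cumulant \<nu> P C) w) = Re (complex_of_real (\<nu> * (\<integral>\<omega>. ?S cos \<omega> \<partial>P)))"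
      using integral_Re[OF fi] cos(2) by (simp add: fourier_measure_def Re_exp)
    show "Im (fourier_measure (second_cumulant \<nu> P C) w) = Im (complex_of_real (\<nu> * (\<integral>\<omega>. ?S cos \<omega> \<partial>P)))"
      using integral_Im[OF fi] sin by (simp add: fourier_measure_def Im_exp)
  qed
  moreover have "(\<integral>\<omega>. (cmod (fourier_measure (C \<omega>) w))\<^sup>2 \<partial>P) = (\<integral>\<omega>. measure (C \<omega>) UNIV + ?S cos \<omega> \<partial>P)"
    by (intro Bochner_Integration.integral_cong refl cmod_fourier_cluster)
  moreover have "\<dots> = (\<integral>\<omega>. measure (C \<omega>) UNIV \<partial>P) + (\<integral>\<omega>. ?S cos \<omega> \<partial>P)"
    by (intro Bochner_Integration.integral_add integrable_cluster_size cos(1))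
  ultimately show "complex_of_real (\<nu> * (\<integral>\<omega>. (cmod (fourier_measure (C \<omega>) w))\<^sup>2 \<partial>P)) =
      complex_of_real (\<nu> * (\<integral>\<omega>. measure (C \<omega>) UNIV \<partial>P)) +
      (fourier_measure (fst (second_cumulant \<nu> P C, null_measure borel)) w -
       fourier_measure (snd (second_cumulant \<nu> P C, null_measure borel)) w)"
    by (simp add: fourier_measure_def[of "null_measure _"] distrib_left)
qed

end

section \<open>Third factorial cumulant densities\<close>

abbreviation coordinate3 :: "real \<times> real \<Rightarrow> nat \<Rightarrow> real" where
  "coordinate3 \<equiv> (\<lambda>\<tau> i. if i = 1 then fst \<tau> else snd \<tau>)"

interpretation coordinates3: reduced_coordinates 3 coordinate3
proof
  show "(\<lambda>\<tau>. coordinate3 \<tau> i) \<in> borel_measurable borel" for i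
  proof -
    have "fst \<in> borel_measurable (borel :: (real \<times> real) measure)" "snd \<in> borel_measurable (borel :: (real \<times> real) measure)"
      by (intro borel_measurable_continuous_onI continuous_on_fst continuous_on_snd continuous_on_id)+
    then show ?thesis by (cases "i = 1") simp_all
  qed
  show "\<exists>r. \<forall>\<tau>. (\<forall>i. 0 < i \<longrightarrow> i < (3::nat) \<longrightarrow> \<bar>coordinate3 \<tau> i\<bar> \<le> R) \<longrightarrow> norm \<tau> \<le> r" for R
  proof (intro exI[of _ "R + R"] allI impI)
    fix \<tau> :: "real \<times> real" assume a: "\<forall>i. 0 < i \<longrightarrow> i < (3::nat) \<longrightarrow> \<bar>coordinate3 \<tau> i\<bar> \<le> R"
    have "\<bar>fst \<tau>\<bar> \<le> R" "\<bar>snd \<tau>\<bar> \<le> R" using a[THEN spec, of 1] a[THEN spec, of 2] by simp_all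
    then show "norm \<tau> \<le> R + R" using norm_Pair_le[of "fst \<tau>" "snd \<tau>"] by simp
  qed
qed simp

abbreviation signed_density :: "('v::euclidean_space \<Rightarrow> real) \<Rightarrow> 'v signed_measure" where
  "signed_density c \<equiv> (density lborel (\<lambda>\<tau>. ennreal (c \<tau>)), density lborel (\<lambda>\<tau>. ennreal (- c \<tau>)))"

lemma lborel_uminus: "distr lborel borel uminus = (lborel :: 'v::euclidean_space measure)"
proof -
  have "(lborel :: 'v measure) = density (distr lborel borel (\<lambda>x. 0 + (- 1) *\<^sub>R x)) (\<lambda>_. \<bar>- 1 :: real\<bar> ^ DIM('v))"
    by (rule lborel_affine) simp
  also have "\<dots> = distr lborel borel uminus" by (simp add: density_1)
  finally show ?thesis by simp
qed

lemma integral_lborel_uminus: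
  fixes f :: "'v::euclidean_space \<Rightarrow> 'b::{banach, second_countable_topology}"
  assumes "f \<in> borel_measurable borel"
  shows "(\<integral>x. f (- x) \<partial>lborel) = (\<integral>x. f x \<partial>lborel)"
  using integral_distr[of uminus lborel borel f] assms by (simp add: lborel_uminus)

lemma integrable_lborel_uminus:
  fixes f :: "'v::euclidean_space \<Rightarrow> 'b::{banach, second_countable_topology}"
  assumes f: "integrable lborel f"
  shows "integrable lborel (\<lambda>x. f (- x))"
proof -
  have "integrable (distr lborel borel uminus) f" using f by (simp add: lborel_uminus)
  then show ?thesis by (subst (asm) integrable_distr_eq) (use f in auto)
qed

text \<open>The pair of densities stands for the positive and negative parts of c. With c integrable
  and g bounded both integrals are finite, so their difference is the integral against c.\<close>

lemma signed_integral_density: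
  fixes g c :: "'v::euclidean_space \<Rightarrow> real"
  assumes c: "integrable lborel c" and g: "g \<in> borel_measurable borel" "bounded (range g)"
  shows "signed_integral (signed_density c) g = (\<integral>\<tau>. g \<tau> * c \<tau> \<partial>lborel)"
    and "integrable lborel (\<lambda>\<tau>. g \<tau> * c \<tau>)"
proof -
  obtain B where B: "\<And>x. \<bar>g x\<bar> \<le> B" using g(2) by (auto simp: bounded_iff)
  have int: "integrable lborel (\<lambda>\<tau>. g \<tau> * d \<tau>)" if d: "integrable lborel d" for d :: "'v \<Rightarrow> real"
  proof (rule Bochner_Integration.integrable_bound)
    show "integrable lborel (\<lambda>\<tau>. B * d \<tau>)" using d by simp
    show "(\<lambda>\<tau>. g \<tau> * d \<tau>) \<in> borel_measurable lborel" using g(1) d by measurable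
    show "AE \<tau> in lborel. norm (g \<tau> * d \<tau>) \<le> norm (B * d \<tau>)"
      using B by (intro AE_I2) (auto simp: abs_mult intro!: mult_right_mono order_trans[OF B abs_ge_self])
  qed
  have d: "(\<integral>\<tau>. g \<tau> \<partial>density lborel (\<lambda>\<tau>. ennreal (d \<tau>))) = (\<integral>\<tau>. g \<tau> * max 0 (d \<tau>) \<partial>lborel)"
    if d: "integrable lborel d" for d :: "'v \<Rightarrow> real"
  proof -
    \<comment> \<open>As \<open>ennreal\<close> truncates at 0, the density is that of the positive
      part, to which the integral formula for nonnegative densities applies.\<close>
    have "(\<lambda>\<tau>. ennreal (d \<tau>)) = (\<lambda>\<tau>. ennreal (max 0 (d \<tau>)))" by (auto simp: max_def ennreal_neg)
    then have "(\<integral>\<tau>. g \<tau> \<partial>density lborel (\<lambda>\<tau>. ennreal (d \<tau>))) = (\<integral>\<tau>. max 0 (d \<tau>) *\<^sub>R g \<tau> \<partial>lborel)"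
      using g(1) d by (simp only:) (intro integral_density, auto)
    then show ?thesis by (simp add: mult.commute)
  qed
  show "integrable lborel (\<lambda>\<tau>. g \<tau> * c \<tau>)" by (rule int[OF c])
  have "signed_integral (signed_density c) g = (\<integral>\<tau>. g \<tau> * max 0 (c \<tau>) \<partial>lborel) - (\<integral>\<tau>. g \<tau> * max 0 (- c \<tau>) \<partial>lborel)"
    using c by (simp add: signed_integral_def d)
  also have "\<dots> = (\<integral>\<tau>. g \<tau> * max 0 (c \<tau>) - g \<tau> * max 0 (- c \<tau>) \<partial>lborel)"
    using c by (intro Bochner_Integration.integral_diff[symmetric] int integrable_max) auto
  also have "\<dots> = (\<integral>\<tau>. g \<tau> * c \<tau> \<partial>lborel)"
    by (intro Bochner_Integration.integral_cong) (auto simp: max_def)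
  finally show "signed_integral (signed_density c) g = (\<integral>\<tau>. g \<tau> * c \<tau> \<partial>lborel)" .
qed

section \<open>Uniqueness of reduced densities\<close>

context reduced_coordinates
begin

lemma locally_finite_density:
  assumes c: "integrable lborel c"
  shows "locally_finite (density lborel (\<lambda>\<tau>. ennreal (c \<tau>)))"
  unfolding locally_finite_def
proof (intro conjI allI)
  fix r
  have "emeasure (density lborel (\<lambda>\<tau>. ennreal (c \<tau>))) (cball 0 r) =
      (\<integral>\<^sup>+\<tau>. ennreal (c \<tau>) * indicator (cball 0 r) \<tau> \<partial>lborel)"
    using c by (intro emeasure_density) auto
  also have "\<dots> \<le> (\<integral>\<^sup>+\<tau>. ennreal (norm (c \<tau>)) \<partial>lborel)"
    by (intro nn_integral_mono) (auto simp: indicator_def intro: ennreal_leI)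
  also have "\<dots> < \<infinity>" using c by (simp add: integrable_iff_bounded)
  finally show "emeasure (density lborel (\<lambda>\<tau>. ennreal (c \<tau>))) (cball 0 r) < \<infinity>" .
qed simp

text \<open>Test functions reach only boxes with bounded sides. Arbitrary boxes are increasing
  limits of these, and boxes generate the product algebra; bounded ones have finite mass and exhaust
  the space.\<close>

lemma unreduce_eqI:
  assumes m: "locally_finite m" and m': "locally_finite m'"
    and eq: "\<And>A. (\<And>i. i < n \<Longrightarrow> A i \<in> sets borel \<and> bounded (A i)) \<Longrightarrow>
      emeasure (unreduce n e m) (PiE {..<n} A) = emeasure (unreduce n e m') (PiE {..<n} A)"
  shows "unreduce n e m = unreduce n e m'"
proof -
  let ?B = "\<lambda>A k i. A i \<inter> {- real k..real k}"
  have UB: "(\<Union>k. PiE {..<n} (?B A k)) = PiE {..<n} A" for A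
  proof
    show "PiE {..<n} A \<subseteq> (\<Union>k. PiE {..<n} (?B A k))"
    proof
      fix x assume x: "x \<in> PiE {..<n} A"
      obtain k where "(\<Sum>i<n. \<bar>x i\<bar>) \<le> real k" using real_arch_simple by blast
      moreover have "\<bar>x i\<bar> \<le> (\<Sum>i<n. \<bar>x i\<bar>)" if "i < n" for i
        using that by (intro member_le_sum) auto
      ultimately have "\<bar>x i\<bar> \<le> real k" if "i < n" for i using that by fastforce
      then have "x i \<in> {- real k..real k}" if "i < n" for i using that by (fastforce simp: abs_le_iff)
      with x have "x \<in> PiE {..<n} (?B A k)" by (auto simp: PiE_iff)
      then show "x \<in> (\<Union>k. PiE {..<n} (?B A k))" by blast
    qed
  qed (auto simp: PiE_iff)
  show ?thesis
  proof (rule measure_eqI_PiM_finite)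
    fix A :: "nat \<Rightarrow> real set" assume A: "\<And>i. i \<in> {..<n} \<Longrightarrow> A i \<in> sets borel"
    have B: "PiE {..<n} (?B A k) \<in> sets (PiM {..<n} (\<lambda>_. borel))" for k
      using A by (intro sets_PiM_I_finite) auto
    have inc: "incseq (\<lambda>k. PiE {..<n} (?B A k))"
      by (intro incseq_SucI PiE_mono) auto
    have "emeasure (unreduce n e m) (PiE {..<n} (?B A k)) = emeasure (unreduce n e m') (PiE {..<n} (?B A k))" for k
      using A by (intro eq) (auto intro: bounded_subset[of "{- real k..real k}"])
    with Lim_emeasure_incseq[OF _ inc, of "unreduce n e m"] Lim_emeasure_incseq[OF _ inc, of "unreduce n e m'"] B
    show "emeasure (unreduce n e m) (PiE {..<n} A) = emeasure (unreduce n e m') (PiE {..<n} A)"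
      by (simp add: UB image_subset_iff LIMSEQ_unique)
  next
    show "range (\<lambda>k. PiE {..<n} (?B (\<lambda>_. UNIV) k)) \<subseteq> prod_algebra {..<n} (\<lambda>_. borel)"
      by (auto intro!: prod_algebraI_finite)
    show "(\<Union>k. PiE {..<n} (?B (\<lambda>_. UNIV) k)) = space (PiM {..<n} (\<lambda>_. borel))"
      unfolding UB by (simp add: space_PiM)
    show "emeasure (unreduce n e m) (PiE {..<n} (?B (\<lambda>_. UNIV) k)) \<noteq> \<infinity>" for k
    proof -
      have abs: "a \<in> {- real k..real k} \<longleftrightarrow> \<bar>a\<bar> \<le> real k" for a by auto
      have "PiE {..<n} (?B (\<lambda>_. UNIV) k) = {t \<in> space (unreduce n e m). \<forall>i<n. \<bar>t i\<bar> \<le> real k}"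
        by (rule set_eqI) (auto simp: space_PiM PiE_iff abs simp del: atLeastAtMost_iff)
      then show ?thesis using emeasure_unreduce_bounded[OF m, of "real k"] by simp
    qed
  qed simp_all
qed

text \<open>The map R reads the differences off an n-tuple. Restricting the first coordinate to an
  interval of length 1 leaves exactly the mass that the reduced measure gives to A.\<close>

lemma unreduce_inject:
  assumes m: "locally_finite m" and m': "locally_finite m'"
    and eq: "unreduce n e m = unreduce n e m'"
    and R: "R \<in> measurable (PiM {..<n} (\<lambda>_. borel)) borel" "\<And>t \<tau>. R (point t \<tau>) = \<tau>"
  shows "m = m'"
proof (rule measure_eqI)
  have sets: "sets m = sets borel" "sets m' = sets borel" using m m' by (auto simp: locally_finite_def)
  then show "sets m = sets m'" by simp
  fix A assume "A \<in> sets m"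
  then have A: "A \<in> sets borel" using sets by simp
  let ?F = "\<lambda>x. indicator {0..1::real} (x 0) * indicator A (R x) :: ennreal"
  have F: "?F \<in> borel_measurable (PiM {..<n} (\<lambda>_. borel))"
  proof -
    have [measurable]: "(\<lambda>x. indicator {0..1::real} (x 0) :: ennreal) \<in> borel_measurable (PiM {..<n} (\<lambda>_. borel))"
      by (rule measurable_compose[OF measurable_component_singleton[of 0]]) (use n_pos in auto)
    have [measurable]: "(\<lambda>x. indicator A (R x) :: ennreal) \<in> borel_measurable (PiM {..<n} (\<lambda>_. borel))"
      by (rule measurable_compose[OF R(1)]) (use A in simp)
    show ?thesis by measurable
  qed
  have "(\<integral>\<^sup>+x. ?F x \<partial>unreduce n e k) = emeasure k A" if k: "locally_finite k" for k
  proof -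
    have Ak: "A \<in> sets k" using A k by (simp add: locally_finite_def)
    have "(\<integral>\<^sup>+x. ?F x \<partial>unreduce n e k) = (\<integral>\<^sup>+t. \<integral>\<^sup>+\<tau>. ?F (point t \<tau>) \<partial>k \<partial>lborel)"
      by (rule nn_integral_unreduce[OF k F])
    also have "\<dots> = (\<integral>\<^sup>+t. \<integral>\<^sup>+\<tau>. indicator {0..1::real} t * indicator A \<tau> \<partial>k \<partial>lborel)"
      unfolding R(2) using n_pos by simp
    also have "\<dots> = (\<integral>\<^sup>+t. indicator {0..1::real} t * emeasure k A \<partial>lborel)"
      by (intro nn_integral_cong nn_integral_cmult_indicator Ak)
    also have "\<dots> = emeasure k A" by (simp add: nn_integral_multc)
    finally show ?thesis .
  qed
  from this[OF m] this[OF m'] eq show "emeasure m A = emeasure m' A" by simp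
qed

lemma nn_integral_unreduce_density:
  assumes lf: "locally_finite (density lborel g)" and g [measurable]: "g \<in> borel_measurable borel"
    and F: "F \<in> borel_measurable (PiM {..<n} (\<lambda>_. borel))"
  shows "(\<integral>\<^sup>+x. F x \<partial>unreduce n e (density lborel g)) = (\<integral>\<^sup>+t. \<integral>\<^sup>+\<tau>. g \<tau> * F (point t \<tau>) \<partial>lborel \<partial>lborel)"
    and "(\<lambda>t. \<integral>\<^sup>+\<tau>. g \<tau> * F (point t \<tau>) \<partial>lborel) \<in> borel_measurable lborel"
proof -
  have Fp [measurable]: "(\<lambda>(t, \<tau>). F (point t \<tau>)) \<in> borel_measurable (lborel \<Otimes>\<^sub>M lborel)"
    using measurable_compose[OF measurable_point F, of lborel] by (simp add: case_prod_unfold)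
  have Ft: "(\<lambda>\<tau>. F (point t \<tau>)) \<in> borel_measurable lborel" for t
    using measurable_Pair2[OF Fp, of t] by simp
  have "(\<integral>\<^sup>+x. F x \<partial>unreduce n e (density lborel g)) = (\<integral>\<^sup>+t. \<integral>\<^sup>+\<tau>. F (point t \<tau>) \<partial>density lborel g \<partial>lborel)"
    by (rule nn_integral_unreduce[OF lf F])
  also have "\<dots> = (\<integral>\<^sup>+t. \<integral>\<^sup>+\<tau>. g \<tau> * F (point t \<tau>) \<partial>lborel \<partial>lborel)"
    using Ft by (intro nn_integral_cong nn_integral_density) auto
  finally show "(\<integral>\<^sup>+x. F x \<partial>unreduce n e (density lborel g)) = (\<integral>\<^sup>+t. \<integral>\<^sup>+\<tau>. g \<tau> * F (point t \<tau>) \<partial>lborel \<partial>lborel)" .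
  have "(\<lambda>(t, \<tau>). g \<tau> * F (point t \<tau>)) \<in> borel_measurable (lborel \<Otimes>\<^sub>M lborel)"
    using Fp by (simp add: case_prod_unfold)
  from lborel.borel_measurable_nn_integral_fst[OF this]
  show "(\<lambda>t. \<integral>\<^sup>+\<tau>. g \<tau> * F (point t \<tau>) \<partial>lborel) \<in> borel_measurable lborel" by simp
qed

text \<open>The identity for products of indicators determines \<open>c\<^sup>+ + d\<^sup>-\<close> and \<open>c\<^sup>- + d\<^sup>+\<close> as one measure.\<close>

lemma signed_density_unique:
  assumes c [measurable]: "c \<in> borel_measurable borel" and d [measurable]: "d \<in> borel_measurable borel"
    and lf: "locally_finite (fst (signed_density c))" "locally_finite (snd (signed_density c))"
      "locally_finite (fst (signed_density d))" "locally_finite (snd (signed_density d))"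
    and R: "R \<in> measurable (PiM {..<n} (\<lambda>_. borel)) borel" "\<And>t \<tau>. R (point t \<tau>) = \<tau>"
    and eq: "\<And>f. (\<And>j. j < n \<Longrightarrow> test_function (f j)) \<Longrightarrow>
      (\<integral>t. signed_integral (signed_density c) (\<lambda>\<tau>. \<Prod>j<n. f j (point t \<tau> j)) \<partial>lborel) =
      (\<integral>t. signed_integral (signed_density d) (\<lambda>\<tau>. \<Prod>j<n. f j (point t \<tau> j)) \<partial>lborel)"
  shows "AE \<tau> in lborel. c \<tau> = d \<tau>"
proof -
  let ?f = "\<lambda>\<tau>. ennreal (c \<tau>) + ennreal (- d \<tau>)" and ?g = "\<lambda>\<tau>. ennreal (- c \<tau>) + ennreal (d \<tau>)"
  \<comment> \<open>Sums of densities remain locally finite, and \<open>unreduce\<close> is additive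
    in the density; this is checked on the iterated integrals.\<close>
  have add: "locally_finite (density lborel (\<lambda>\<tau>. a \<tau> + b \<tau>)) \<and>
      (\<forall>F\<in>borel_measurable (PiM {..<n} (\<lambda>_. borel)). (\<integral>\<^sup>+x. F x \<partial>unreduce n e (density lborel (\<lambda>\<tau>. a \<tau> + b \<tau>))) =
        (\<integral>\<^sup>+x. F x \<partial>unreduce n e (density lborel a)) + (\<integral>\<^sup>+x. F x \<partial>unreduce n e (density lborel b)))"
    if [measurable]: "a \<in> borel_measurable borel" "b \<in> borel_measurable borel"
      and ab: "locally_finite (density lborel a)" "locally_finite (density lborel b)"
    for a b :: "'v \<Rightarrow> ennreal"
  proof (intro conjI ballI)
    show lf: "locally_finite (density lborel (\<lambda>\<tau>. a \<tau> + b \<tau>))"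
      unfolding locally_finite_def
    proof (intro conjI allI)
      fix r
      have [measurable]: "cball 0 r \<in> sets (borel :: 'v measure)" by simp
      have "emeasure (density lborel (\<lambda>\<tau>. a \<tau> + b \<tau>)) (cball 0 r) =
          emeasure (density lborel a) (cball 0 r) + emeasure (density lborel b) (cball 0 r)"
        by (simp add: emeasure_density distrib_right) (rule nn_integral_add, measurable)
      then show "emeasure (density lborel (\<lambda>\<tau>. a \<tau> + b \<tau>)) (cball 0 r) < \<infinity>"
        using ab by (simp add: locally_finite_def)
    qed simp
    fix F :: "(nat \<Rightarrow> real) \<Rightarrow> ennreal" assume F: "F \<in> borel_measurable (PiM {..<n} (\<lambda>_. borel))"
    have Ft: "(\<lambda>\<tau>. F (point t \<tau>)) \<in> borel_measurable lborel" for t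
    proof -
      have Fp: "(\<lambda>(t, \<tau>). F (point t \<tau>)) \<in> borel_measurable (lborel \<Otimes>\<^sub>M lborel)"
        using measurable_compose[OF measurable_point F, of lborel] by (simp add: case_prod_unfold)
      show ?thesis using measurable_Pair2[OF Fp, of t] by simp
    qed
    have "(\<integral>\<^sup>+x. F x \<partial>unreduce n e (density lborel (\<lambda>\<tau>. a \<tau> + b \<tau>))) =
        (\<integral>\<^sup>+t. \<integral>\<^sup>+\<tau>. (a \<tau> + b \<tau>) * F (point t \<tau>) \<partial>lborel \<partial>lborel)"
      by (rule nn_integral_unreduce_density(1)[OF lf _ F]) measurable
    also have "\<dots> = (\<integral>\<^sup>+t. (\<integral>\<^sup>+\<tau>. a \<tau> * F (point t \<tau>) \<partial>lborel) + (\<integral>\<^sup>+\<tau>. b \<tau> * F (point t \<tau>) \<partial>lborel) \<partial>lborel)"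
      unfolding distrib_right using Ft by (intro nn_integral_cong nn_integral_add) auto
    also have "\<dots> = (\<integral>\<^sup>+t. (\<integral>\<^sup>+\<tau>. a \<tau> * F (point t \<tau>) \<partial>lborel) \<partial>lborel) + (\<integral>\<^sup>+t. (\<integral>\<^sup>+\<tau>. b \<tau> * F (point t \<tau>) \<partial>lborel) \<partial>lborel)"
      by (rule nn_integral_add) (use nn_integral_unreduce_density(2)[OF ab(1) _ F] nn_integral_unreduce_density(2)[OF ab(2) _ F] in auto)
    also have "\<dots> = (\<integral>\<^sup>+x. F x \<partial>unreduce n e (density lborel a)) + (\<integral>\<^sup>+x. F x \<partial>unreduce n e (density lborel b))"
      by (simp add: nn_integral_unreduce_density(1)[OF ab(1) _ F] nn_integral_unreduce_density(1)[OF ab(2) _ F])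
    finally show "(\<integral>\<^sup>+x. F x \<partial>unreduce n e (density lborel (\<lambda>\<tau>. a \<tau> + b \<tau>))) =
        (\<integral>\<^sup>+x. F x \<partial>unreduce n e (density lborel a)) + (\<integral>\<^sup>+x. F x \<partial>unreduce n e (density lborel b))" .
  qed
  have lf': "locally_finite (density lborel (\<lambda>\<tau>. ennreal (c \<tau>)))" "locally_finite (density lborel (\<lambda>\<tau>. ennreal (- c \<tau>)))"
    "locally_finite (density lborel (\<lambda>\<tau>. ennreal (d \<tau>)))" "locally_finite (density lborel (\<lambda>\<tau>. ennreal (- d \<tau>)))"
    using lf by simp_all
  have F: "locally_finite (density lborel ?f)" and G: "locally_finite (density lborel ?g)"
    using add[OF _ _ lf'(1,4)] add[OF _ _ lf'(2,3)] by simp_all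
  have "unreduce n e (density lborel ?f) = unreduce n e (density lborel ?g)"
  proof (rule unreduce_eqI[OF F G])
    fix A :: "nat \<Rightarrow> real set" assume A: "\<And>i. i < n \<Longrightarrow> A i \<in> sets borel \<and> bounded (A i)"
    let ?E = "PiE {..<n} A"
    have E: "?E \<in> sets (PiM {..<n} (\<lambda>_. borel))" using A by (intro sets_PiM_I_finite) auto
    define f :: "nat \<Rightarrow> real \<Rightarrow> real" where "f j = indicator (A j)" for j
    have f: "test_function (f j)" if "j < n" for j
      using A[OF that] unfolding test_function_def f_def by (auto simp: indicator_def intro!: exI[of _ 1])
    note P = product_test_function[of f, OF f]
    obtain r where r: "\<And>t. (\<Prod>j<n. f j (t j)) \<noteq> 0 \<Longrightarrow> \<forall>i<n. \<bar>t i\<bar> \<le> r" using P(3) by blast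
    have meas: "(\<integral>x. (\<Prod>j<n. f j (x j)) \<partial>unreduce n e m) = measure (unreduce n e m) ?E" for m
    proof -
      have "(\<integral>x. (\<Prod>j<n. f j (x j)) \<partial>unreduce n e m) = (\<integral>x. indicator ?E x \<partial>unreduce n e m)"
      proof (intro Bochner_Integration.integral_cong refl)
        fix x assume "x \<in> space (unreduce n e m)"
        then have "x \<in> extensional {..<n}" by (simp add: space_PiM PiE_iff)
        moreover have "(\<Prod>j<n. f j (x j)) = (if \<forall>j<n. x j \<in> A j then 1 else 0)"
          by (auto simp: f_def indicator_def intro!: prod.neutral) 
        ultimately show "(\<Prod>j<n. f j (x j)) = indicator ?E x"
          by (auto simp: indicator_def PiE_iff)
      qed
      also have "\<dots> = measure (unreduce n e m) (?E \<inter> space (unreduce n e m))" by simp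
      also have "?E \<inter> space (unreduce n e m) = ?E" by (auto simp: space_PiM PiE_iff)
      finally show ?thesis .
    qed
    have signed: "measure (unreduce n e (fst \<rho>)) ?E - measure (unreduce n e (snd \<rho>)) ?E =
        (\<integral>t. signed_integral \<rho> (\<lambda>\<tau>. \<Prod>j<n. f j (point t \<tau> j)) \<partial>lborel)"
      if "locally_finite (fst \<rho>)" "locally_finite (snd \<rho>)" for \<rho> :: "'v signed_measure"
    proof -
      note I = integral_unreduce[OF that(1) P(1,2) r] integral_unreduce[OF that(2) P(1,2) r]
      show ?thesis
        using Bochner_Integration.integral_diff[OF I(2) I(5)] I(1) I(4) by (simp add: signed_integral_def meas)
    qed
    \<comment> \<open>The identity for signed integrals, rearranged so that only sums of finite
      masses occur.\<close>
    have real: "measure (unreduce n e (density lborel (\<lambda>\<tau>. ennreal (c \<tau>)))) ?E + measure (unreduce n e (density lborel (\<lambda>\<tau>. ennreal (- d \<tau>)))) ?E =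
        measure (unreduce n e (density lborel (\<lambda>\<tau>. ennreal (- c \<tau>)))) ?E + measure (unreduce n e (density lborel (\<lambda>\<tau>. ennreal (d \<tau>)))) ?E"
      using signed[OF lf(1,2)] signed[OF lf(3,4)] eq[OF f] by simp
    \<comment> \<open>Bounded boxes have finite mass, which allows the passage back from
      \<open>measure\<close> to \<open>emeasure\<close>.\<close>
    have fin: "emeasure (unreduce n e m) ?E = ennreal (measure (unreduce n e m) ?E)" if m: "locally_finite m" for m
    proof (rule emeasure_eq_ennreal_measure)
      obtain r where r: "\<And>t. t \<in> ?E \<Longrightarrow> \<forall>i<n. \<bar>t i\<bar> \<le> r"
      proof -
        have "(\<Prod>j<n. f j (t j)) \<noteq> 0" if "t \<in> ?E" for t using that by (auto simp: f_def indicator_def PiE_iff)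
        with r that show ?thesis by blast
      qed
      have "emeasure (unreduce n e m) ?E \<le> emeasure (unreduce n e m) {t \<in> space (unreduce n e m). \<forall>i\<in>{..<n}. \<bar>t i\<bar> \<le> r}"
      proof (rule emeasure_mono)
        show "?E \<subseteq> {t \<in> space (unreduce n e m). \<forall>i\<in>{..<n}. \<bar>t i\<bar> \<le> r}"
          using r by (auto simp: space_PiM PiE_iff)
        show "{t \<in> space (unreduce n e m). \<forall>i\<in>{..<n}. \<bar>t i\<bar> \<le> r} \<in> sets (unreduce n e m)"
          by measurable
      qed
      then show "emeasure (unreduce n e m) ?E \<noteq> \<top>"
        using emeasure_unreduce_bounded[OF m, of r] by (auto simp: Ball_def top_unique)
    qed
    have sum: "emeasure (unreduce n e (density lborel (\<lambda>\<tau>. a \<tau> + b \<tau>))) ?E =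
        emeasure (unreduce n e (density lborel a)) ?E + emeasure (unreduce n e (density lborel b)) ?E"
      if "a \<in> borel_measurable borel" "b \<in> borel_measurable borel"
        "locally_finite (density lborel a)" "locally_finite (density lborel b)" for a b :: "'v \<Rightarrow> ennreal"
      using add[OF that] E by (auto dest!: bspec[where x="indicator ?E"])
    show "emeasure (unreduce n e (density lborel ?f)) ?E = emeasure (unreduce n e (density lborel ?g)) ?E"
      using real by (simp add: sum lf' fin ennreal_plus[symmetric] del: ennreal_plus)
  qed
  then have "density lborel ?f = density lborel ?g" by (rule unreduce_inject[OF F G _ R])
  then have "AE \<tau> in lborel. ?f \<tau> = ?g \<tau>" by (subst (asm) sigma_finite_measure.density_unique_iff[OF lborel.sigma_finite_measure_axioms]) auto
  then show ?thesis
  proof eventually_elim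
    case (elim \<tau>)
    then show ?case
      by (cases "0 \<le> c \<tau>"; cases "0 \<le> d \<tau>")
        (auto simp: ennreal_neg ennreal_plus[symmetric] not_le simp del: ennreal_plus)
  qed
qed

end

text \<open>Two densities may come with different cumulant measures as witnesses. Uniqueness of
  mixed derivatives makes these agree on products of test functions, and such products determine the
  density.\<close>

lemma reduced_cumulant_density3_unique:
  assumes c: "reduced_cumulant_density3 M X c" and d: "reduced_cumulant_density3 M X d"
  shows "AE \<tau> in lborel. c \<tau> = d \<tau>"
proof -
  from c obtain \<kappa> where \<kappa>: "c \<in> borel_measurable borel" "factorial_cumulant M X 3 \<kappa>"
    "reduced_measure 3 coordinate3 \<kappa> (signed_density c)"
    unfolding reduced_cumulant_density3_def reduced_cumulant3_def by blast
  from d obtain \<kappa>' where \<kappa>': "d \<in> borel_measurable borel" "factorial_cumulant M X 3 \<kappa>'"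
    "reduced_measure 3 coordinate3 \<kappa>' (signed_density d)"
    unfolding reduced_cumulant_density3_def reduced_cumulant3_def by blast
  have lf: "coordinates3.locally_finite (fst (signed_density b))" "coordinates3.locally_finite (snd (signed_density b))"
    if "reduced_measure 3 coordinate3 k (signed_density b)" for b k
    using that unfolding reduced_measure_def coordinates3.locally_finite_def by simp_all
  show ?thesis
  proof (rule coordinates3.signed_density_unique[OF \<kappa>(1) \<kappa>'(1) lf[OF \<kappa>(3)] lf[OF \<kappa>'(3)]])
    \<comment> \<open>The lags \<tau> are recovered from a triple as differences from its first
      entry.\<close>
    show "(\<lambda>x :: nat \<Rightarrow> real. (x 1 - x 0, x 2 - x 0)) \<in> borel_measurable (PiM {..<3} (\<lambda>_. borel))"
      by (intro borel_measurable_Pair borel_measurable_diff measurable_component_singleton) auto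
    fix f :: "nat \<Rightarrow> real \<Rightarrow> real" assume f: "\<And>j. j < 3 \<Longrightarrow> test_function (f j)"
    note P = coordinates3.product_test_function[of f, OF f]
    have int: "signed_integral k (\<lambda>t. \<Prod>j<3. f j (t j)) =
        (\<integral>t. signed_integral (signed_density b) (\<lambda>\<tau>. \<Prod>j<3. f j (coordinates3.point t \<tau> j)) \<partial>lborel)"
      if "reduced_measure 3 coordinate3 k (signed_density b)" for b k
      by (rule that[unfolded reduced_measure_def, THEN conjunct2, rule_format, OF P])
    have "mixed_left_deriv 3 (log_pgfl M X 3 f) (\<lambda>_. 0) (signed_integral k (\<lambda>t. \<Prod>j<3. f j (t j)))"
      if "factorial_cumulant M X 3 k" for k
      using that f unfolding factorial_cumulant_def by simp
    from mixed_left_deriv_unique[OF this[OF \<kappa>(2)] this[OF \<kappa>'(2)]]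
    have "signed_integral \<kappa> (\<lambda>t. \<Prod>j<3. f j (t j)) = signed_integral \<kappa>' (\<lambda>t. \<Prod>j<3. f j (t j))" .
    then show "(\<integral>t. signed_integral (signed_density c) (\<lambda>\<tau>. \<Prod>j<3. f j (coordinates3.point t \<tau> j)) \<partial>lborel) =
        (\<integral>t. signed_integral (signed_density d) (\<lambda>\<tau>. \<Prod>j<3. f j (coordinates3.point t \<tau> j)) \<partial>lborel)"
      by (simp only: int[OF \<kappa>(3)] int[OF \<kappa>'(3)])
  qed simp
qed

section \<open>Transfer of third-order densities between biases\<close>

context cluster_model_mean
begin

text \<open>For \<theta> = 1 the reflected rate has weight 0, so derivatives of the rate itself can
  be read off the generating functional. Their existence is then part of the assumed cumulant
  property.\<close>

lemma mixed_left_deriv_pgfl_rateI: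
  assumes \<theta>1: "\<theta> = 1" and f: "\<And>j. j < n \<Longrightarrow> test_function (f j)"
    and D: "mixed_left_deriv n (log_pgfl M N n f) (\<lambda>_. 0) D"
  shows "mixed_left_deriv n (\<lambda>s. - \<nu> * pgfl_rate P C (\<lambda>x. 1 + (\<Sum>j<n. s j * f j x))) (\<lambda>_. 0) D"
proof -
  have "\<exists>\<delta>>0. \<forall>s x. (\<forall>j<n. s j \<in> {-\<delta><..0}) \<longrightarrow>
      1 / 2 \<le> 1 + (\<Sum>j<n. s j * f j x) \<and> 1 + (\<Sum>j<n. s j * f j x) \<le> 1"
    by (rule test_functions_factor_bounds) (rule f)
  then obtain \<delta> where \<delta>: "0 < \<delta>" "\<forall>s x. (\<forall>j<n. s j \<in> {-\<delta><..0}) \<longrightarrow>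
      1 / 2 \<le> 1 + (\<Sum>j<n. s j * f j x) \<and> 1 + (\<Sum>j<n. s j * f j x) \<le> 1"
    by (elim exE conjE)
  show ?thesis
  proof (rule mixed_left_deriv_cong[OF \<delta>(1) D])
    fix s :: "nat \<Rightarrow> real" assume s: "\<And>j. j < n \<Longrightarrow> s j \<in> {-\<delta><..0}"
    define h where "h x = 1 + (\<Sum>j<n. s j * f j x)" for x
    have h: "1 / 2 \<le> h x" "h x \<le> 1" for x
      using \<delta>(2)[rule_format, of s x] s by (simp_all add: h_def)
    show "log_pgfl M N n f s = - \<nu> * pgfl_rate P C (\<lambda>x. 1 + (\<Sum>j<n. s j * f j x))"
      using log_pgfl_N[OF f h_def h] by (simp add: \<theta>1 h_def[abs_def])
  qed
qed

end

text \<open>The process with signs \<open>S1\<close> supplies the third derivative of the rate for f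
  and for the reflected f. Reflecting the test functions is the same as reflecting the density, so
  the mixture of the two derivatives is the integral against the mixture of c and its
  reflection.\<close>

lemma reduced_cumulant_density3_mixture:
  assumes X: "cluster_model_mean M \<nu> U P C K S \<theta>" and Y: "cluster_model_mean M \<nu> U P C K S1 1"
    and c: "reduced_cumulant_density3 M (cluster_process U K S1) c" "integrable lborel c"
  shows "reduced_cumulant_density3 M (cluster_process U K S)
    (\<lambda>\<tau>. (1 + \<theta>) / 2 * c \<tau> + (1 - \<theta>) / 2 * c (- \<tau>))"
proof -
  interpret X: cluster_model_mean M \<nu> U P C K S \<theta> by (rule X)
  interpret Y: cluster_model_mean M \<nu> U P C K S1 1 by (rule Y)
  let ?c = "\<lambda>\<tau>. (1 + \<theta>) / 2 * c \<tau> + (1 - \<theta>) / 2 * c (- \<tau>)"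
  have c': "integrable lborel (\<lambda>\<tau>. c (- \<tau>))" by (rule integrable_lborel_uminus[OF c(2)])
  have int: "integrable lborel ?c" using c(2) c' by simp
  obtain \<kappa> where \<kappa>: "factorial_cumulant M (cluster_process U K S1) 3 \<kappa>"
    "reduced_measure 3 coordinate3 \<kappa> (signed_density c)"
    using c(1) unfolding reduced_cumulant_density3_def reduced_cumulant3_def by blast
  let ?U = "unreduce 3 coordinate3"
  let ?\<rho> = "signed_density ?c"
  let ?\<kappa> = "(?U (fst ?\<rho>), ?U (snd ?\<rho>))"
  have lf: "coordinates3.locally_finite (fst ?\<rho>)" "coordinates3.locally_finite (snd ?\<rho>)"
    unfolding fst_conv snd_conv
    by (rule coordinates3.locally_finite_density[OF int],
        rule coordinates3.locally_finite_density[OF Bochner_Integration.integrable_minus[OF int]])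
  have red: "reduced_measure 3 coordinate3 ?\<kappa> ?\<rho>"
    by (rule coordinates3.reduced_measure_unreduce[OF lf])
  \<comment> \<open>The signed integral written as an iterated integral against the density itself,
    which is linear in it, rather than against its positive and negative parts, which are
    not.\<close>
  define I where "I f b = (\<integral>t. \<integral>\<tau>. (\<Prod>j<3. f j (coordinates3.point t \<tau> j)) * b \<tau> \<partial>lborel \<partial>lborel)"
    for f :: "nat \<Rightarrow> real \<Rightarrow> real" and b
  have slice: "(\<lambda>\<tau>. \<Prod>j<3. f j (coordinates3.point t \<tau> j)) \<in> borel_measurable borel"
      "bounded (range (\<lambda>\<tau>. \<Prod>j<3. f j (coordinates3.point t \<tau> j)))"
    if f: "\<And>j. j < 3 \<Longrightarrow> test_function (f j)" for f t
  proof -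
    note P = coordinates3.product_test_function[of f, OF f]
    have "(\<lambda>\<tau>. coordinates3.point t \<tau>) \<in> measurable borel (PiM {..<3} (\<lambda>_. borel))"
      using measurable_Pair2[OF coordinates3.measurable_point[of borel], of t] by simp
    from measurable_compose[OF this P(1)]
    show "(\<lambda>\<tau>. \<Prod>j<3. f j (coordinates3.point t \<tau> j)) \<in> borel_measurable borel" .
    show "bounded (range (\<lambda>\<tau>. \<Prod>j<3. f j (coordinates3.point t \<tau> j)))"
      by (rule bounded_subset[OF P(2)]) auto
  qed
  have inner: "signed_integral (signed_density b) (\<lambda>\<tau>. \<Prod>j<3. f j (coordinates3.point t \<tau> j)) =
      (\<integral>\<tau>. (\<Prod>j<3. f j (coordinates3.point t \<tau> j)) * b \<tau> \<partial>lborel)"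
    if f: "\<And>j. j < 3 \<Longrightarrow> test_function (f j)" and b: "integrable lborel b" for f b t
    by (rule signed_integral_density(1)[OF b slice[of f, OF f]])
  have signed: "signed_integral k (\<lambda>t. \<Prod>j<3. f j (t j)) = I f b"
    if f: "\<And>j. j < 3 \<Longrightarrow> test_function (f j)" and b: "integrable lborel b"
      and k: "reduced_measure 3 coordinate3 k (signed_density b)" for f b k
  proof -
    note P = coordinates3.product_test_function[of f, OF f]
    have "signed_integral k (\<lambda>t. \<Prod>j<3. f j (t j)) =
        (\<integral>t. signed_integral (signed_density b) (\<lambda>\<tau>. \<Prod>j<3. f j (coordinates3.point t \<tau> j)) \<partial>lborel)"
      by (rule k[unfolded reduced_measure_def, THEN conjunct2, rule_format, OF P])
    also have "\<dots> = I f b" unfolding I_def by (simp only: inner[of f, OF f b])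
    finally show ?thesis .
  qed
  \<comment> \<open>Integrability in t, on which linearity of the outer integral depends.\<close>
  have int_I: "integrable lborel (\<lambda>t. \<integral>\<tau>. (\<Prod>j<3. f j (coordinates3.point t \<tau> j)) * b \<tau> \<partial>lborel)"
    if f: "\<And>j. j < 3 \<Longrightarrow> test_function (f j)" and b: "integrable lborel b" for f b
  proof -
    note P = coordinates3.product_test_function[of f, OF f]
    obtain r where r: "\<And>t. (\<Prod>j<3. f j (t j)) \<noteq> 0 \<Longrightarrow> \<forall>i<3. \<bar>t i\<bar> \<le> r" using P(3) by blast
    have lf: "coordinates3.locally_finite (density lborel (\<lambda>\<tau>. ennreal (b \<tau>)))"
      "coordinates3.locally_finite (density lborel (\<lambda>\<tau>. ennreal (- b \<tau>)))"
      using coordinates3.locally_finite_density[of b] coordinates3.locally_finite_density[of "\<lambda>\<tau>. - b \<tau>"] b by simp_all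
    have "integrable lborel (\<lambda>t. signed_integral (signed_density b) (\<lambda>\<tau>. \<Prod>j<3. f j (coordinates3.point t \<tau> j)))"
      unfolding signed_integral_def fst_conv snd_conv
      by (intro Bochner_Integration.integrable_diff coordinates3.integral_unreduce(2)[OF _ P(1,2) r] lf)
    then show ?thesis by (simp only: inner[of f, OF f b])
  qed
  have linear: "I f ?c = (1 + \<theta>) / 2 * I f c + (1 - \<theta>) / 2 * I f (\<lambda>\<tau>. c (- \<tau>))"
    if f: "\<And>j. j < 3 \<Longrightarrow> test_function (f j)" for f
  proof -
    have "(\<integral>\<tau>. (\<Prod>j<3. f j (coordinates3.point t \<tau> j)) * ?c \<tau> \<partial>lborel) =
        (1 + \<theta>) / 2 * (\<integral>\<tau>. (\<Prod>j<3. f j (coordinates3.point t \<tau> j)) * c \<tau> \<partial>lborel) +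
        (1 - \<theta>) / 2 * (\<integral>\<tau>. (\<Prod>j<3. f j (coordinates3.point t \<tau> j)) * c (- \<tau>) \<partial>lborel)" for t
    proof -
      note i = signed_integral_density(2)[OF c(2) slice[of f t, OF f]] signed_integral_density(2)[OF c' slice[of f t, OF f]]
      have "(\<integral>\<tau>. (\<Prod>j<3. f j (coordinates3.point t \<tau> j)) * ?c \<tau> \<partial>lborel) =
          (\<integral>\<tau>. (1 + \<theta>) / 2 * ((\<Prod>j<3. f j (coordinates3.point t \<tau> j)) * c \<tau>) +
            (1 - \<theta>) / 2 * ((\<Prod>j<3. f j (coordinates3.point t \<tau> j)) * c (- \<tau>)) \<partial>lborel)"
        by (intro Bochner_Integration.integral_cong refl) (simp add: distrib_left mult.left_commute)
      also have "\<dots> = (\<integral>\<tau>. (1 + \<theta>) / 2 * ((\<Prod>j<3. f j (coordinates3.point t \<tau> j)) * c \<tau>) \<partial>lborel) +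
          (\<integral>\<tau>. (1 - \<theta>) / 2 * ((\<Prod>j<3. f j (coordinates3.point t \<tau> j)) * c (- \<tau>)) \<partial>lborel)"
        by (intro Bochner_Integration.integral_add integrable_mult_right i)
      finally show ?thesis by (simp only: integral_mult_right_zero)
    qed
    moreover have "(\<integral>t. (1 + \<theta>) / 2 * (\<integral>\<tau>. (\<Prod>j<3. f j (coordinates3.point t \<tau> j)) * c \<tau> \<partial>lborel) +
        (1 - \<theta>) / 2 * (\<integral>\<tau>. (\<Prod>j<3. f j (coordinates3.point t \<tau> j)) * c (- \<tau>) \<partial>lborel) \<partial>lborel) =
        (\<integral>t. (1 + \<theta>) / 2 * (\<integral>\<tau>. (\<Prod>j<3. f j (coordinates3.point t \<tau> j)) * c \<tau> \<partial>lborel) \<partial>lborel) +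
        (\<integral>t. (1 - \<theta>) / 2 * (\<integral>\<tau>. (\<Prod>j<3. f j (coordinates3.point t \<tau> j)) * c (- \<tau>) \<partial>lborel) \<partial>lborel)"
      by (intro Bochner_Integration.integral_add integrable_mult_right int_I[of f, OF f] c(2) c')
    ultimately show ?thesis unfolding I_def by (simp only: integral_mult_right_zero)
  qed
  \<comment> \<open>Sign changes in \<tau> and then in t. Lebesgue measure is invariant under both,
    and the coordinates of \<open>point\<close> are odd in (t, \<tau>), so the sign ends up inside
    the test functions.\<close>
  have reflect: "I f (\<lambda>\<tau>. c (- \<tau>)) = I (\<lambda>j x. f j (- x)) c"
    if f: "\<And>j. j < 3 \<Longrightarrow> test_function (f j)" for f
  proof -
    let ?g = "\<lambda>t \<tau>. (\<Prod>j<3. f j (coordinates3.point t \<tau> j)) * c (- \<tau>)"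
    have "(\<integral>\<tau>. ?g t (- \<tau>) \<partial>lborel) = (\<integral>\<tau>. ?g t \<tau> \<partial>lborel)" for t
      using signed_integral_density(2)[OF c' slice[of f t, OF f]] by (intro integral_lborel_uminus) auto
    then have "I f (\<lambda>\<tau>. c (- \<tau>)) = (\<integral>t. \<integral>\<tau>. ?g t (- \<tau>) \<partial>lborel \<partial>lborel)" by (simp only: I_def)
    also have "\<dots> = (\<integral>t. \<integral>\<tau>. ?g (- t) (- \<tau>) \<partial>lborel \<partial>lborel)"
    proof (rule integral_lborel_uminus[symmetric])
      have "(\<lambda>t. \<integral>\<tau>. ?g t \<tau> \<partial>lborel) \<in> borel_measurable borel"
        using borel_measurable_integrable[OF int_I[of f, OF f c']] by simp
      then show "(\<lambda>t. \<integral>\<tau>. ?g t (- \<tau>) \<partial>lborel) \<in> borel_measurable borel"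
        by (simp only: \<open>\<And>t. (\<integral>\<tau>. ?g t (- \<tau>) \<partial>lborel) = (\<integral>\<tau>. ?g t \<tau> \<partial>lborel)\<close>)
    qed
    also have "\<dots> = I (\<lambda>j x. f j (- x)) c"
    proof -
      have "coordinates3.point (- t) (- \<tau>) j = - coordinates3.point t \<tau> j" if "j < 3" for t \<tau> j
        using that by simp
      then have "(\<Prod>j<3. f j (coordinates3.point (- t) (- \<tau>) j)) = (\<Prod>j<3. f j (- coordinates3.point t \<tau> j))" for t \<tau>
        by (intro prod.cong) auto
      then show ?thesis unfolding I_def by (simp only: minus_minus)
    qed
    finally show ?thesis .
  qed
  have fc: "factorial_cumulant M (cluster_process U K S) 3 ?\<kappa>"
    unfolding factorial_cumulant_def
  proof (intro conjI ballI allI impI)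
    fix \<rho>' assume "\<rho>' \<in> {fst ?\<kappa>, snd ?\<kappa>}"
    then obtain m where m: "\<rho>' = ?U m" "coordinates3.locally_finite m" using lf by auto
    show "sets \<rho>' = sets (PiM {..<3} (\<lambda>_. borel))" by (simp add: m(1))
    show "emeasure \<rho>' {t \<in> space \<rho>'. \<forall>i<3. \<bar>t i\<bar> \<le> r} < \<infinity>" for r
      unfolding m(1) by (rule coordinates3.emeasure_unreduce_bounded[OF m(2)])
  next
    fix f :: "nat \<Rightarrow> real \<Rightarrow> real" assume "\<forall>j<3. test_function (f j)"
    then have f: "\<And>j. j < 3 \<Longrightarrow> test_function (f j)" by blast
    have f': "test_function (\<lambda>x. f j (- x))" if "j < 3" for j
      using test_function_uminus[OF f[OF that]] .
    \<comment> \<open>Stated for arbitrary g, as it is used once for f and once for its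
      reflection.\<close>
    have D: "mixed_left_deriv 3 (\<lambda>s. - \<nu> * pgfl_rate P C (\<lambda>x. 1 + (\<Sum>j<3. s j * g j x))) (\<lambda>_. 0) (I g c)"
      if g: "\<And>j. j < 3 \<Longrightarrow> test_function (g j)" for g
    proof (rule Y.mixed_left_deriv_pgfl_rateI[OF refl g])
      have "mixed_left_deriv 3 (log_pgfl M (cluster_process U K S1) 3 g) (\<lambda>_. 0)
          (signed_integral \<kappa> (\<lambda>t. \<Prod>j<3. g j (t j)))"
        using \<kappa>(1) g unfolding factorial_cumulant_def by simp
      then show "mixed_left_deriv 3 (log_pgfl M (cluster_process U K S1) 3 g) (\<lambda>_. 0) (I g c)"
        by (simp only: signed[of g, OF g c(2) \<kappa>(2)])
    qed
    have "mixed_left_deriv 3 (log_pgfl M (cluster_process U K S) 3 f) (\<lambda>_. 0)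
        ((1 + \<theta>) / 2 * I f c + (1 - \<theta>) / 2 * I (\<lambda>j x. f j (- x)) c)"
      by (rule X.mixed_left_deriv_log_pgfl[OF f D[OF f] D[of "\<lambda>j x. f j (- x)", OF f']])
    then show "mixed_left_deriv 3 (log_pgfl M (cluster_process U K S) 3 f) (\<lambda>_. 0)
        (signed_integral ?\<kappa> (\<lambda>t. \<Prod>j<3. f j (t j)))"
      using signed[of f ?c ?\<kappa>, OF f int red] linear[of f, OF f] reflect[of f, OF f] by (simp only:)
  qed
  have "?c \<in> borel_measurable borel" using borel_measurable_integrable[OF int] by simp
  moreover have "reduced_cumulant3 M (cluster_process U K S) (signed_density ?c)"
    unfolding reduced_cumulant3_def by (rule exI, rule conjI[OF fc red])
  ultimately show ?thesis
    unfolding reduced_cumulant_density3_def by (rule conjI)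
qed

text \<open>As c is real, reflecting it conjugates the transform. The weights have sum 1 and
  difference \<theta>, so the real part is kept and the imaginary part multiplied by
  \<theta>.\<close>

lemma fourier_reflection_mixture:
  fixes c b :: "'v::euclidean_space \<Rightarrow> real"
  assumes c: "integrable lborel c" and b: "b \<in> borel_measurable borel"
    and ae: "AE \<tau> in lborel. b \<tau> = (1 + \<theta>) / 2 * c \<tau> + (1 - \<theta>) / 2 * c (- \<tau>)"
  shows "fourier b w = complex_of_real (Re (fourier c w)) + \<i> * complex_of_real \<theta> * complex_of_real (Im (fourier c w))"
proof -
  let ?e = "\<lambda>x::'v. exp (- (\<i> * complex_of_real (w \<bullet> x)))"
  have [measurable]: "c \<in> borel_measurable borel" using c by auto
  note [measurable] = b
  have int: "integrable lborel (\<lambda>x. ?e x * complex_of_real (d x))" if d: "integrable lborel d" for d :: "'v \<Rightarrow> real"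
  proof (rule Bochner_Integration.integrable_bound[OF d])
    show "(\<lambda>x. ?e x * complex_of_real (d x)) \<in> borel_measurable lborel" using d by measurable
    show "AE x in lborel. norm (?e x * complex_of_real (d x)) \<le> norm (d x)"
      by (intro AE_I2) (simp add: norm_mult)
  qed
  have "(\<integral>x. ?e x * complex_of_real (c (- x)) \<partial>lborel) = (\<integral>x. ?e (- x) * complex_of_real (c x) \<partial>lborel)"
    using integral_lborel_uminus[of "\<lambda>x. ?e (- x) * complex_of_real (c x)"] by simp
  also have "\<dots> = (\<integral>x. cnj (?e x * complex_of_real (c x)) \<partial>lborel)"
    by (intro Bochner_Integration.integral_cong refl) (simp add: exp_cnj)
  also have "\<dots> = cnj (fourier c w)" unfolding fourier_def by (rule Bochner_Integration.integral_cnj)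
  finally have refl: "(\<integral>x. ?e x * complex_of_real (c (- x)) \<partial>lborel) = cnj (fourier c w)" .
  have "fourier b w = (\<integral>x. complex_of_real ((1 + \<theta>) / 2) * (?e x * complex_of_real (c x)) +
      complex_of_real ((1 - \<theta>) / 2) * (?e x * complex_of_real (c (- x))) \<partial>lborel)"
    unfolding fourier_def
  proof (rule integral_cong_AE)
    show "AE x in lborel. ?e x * complex_of_real (b x) = complex_of_real ((1 + \<theta>) / 2) * (?e x * complex_of_real (c x)) +
      complex_of_real ((1 - \<theta>) / 2) * (?e x * complex_of_real (c (- x)))"
      using ae
    proof eventually_elim
      case (elim x)
      show ?case unfolding elim by (simp only: of_real_add of_real_mult distrib_left mult.left_commute)
    qed
  qed measurable
  also have "\<dots> = (\<integral>x. complex_of_real ((1 + \<theta>) / 2) * (?e x * complex_of_real (c x)) \<partial>lborel) +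
      (\<integral>x. complex_of_real ((1 - \<theta>) / 2) * (?e x * complex_of_real (c (- x))) \<partial>lborel)"
    by (intro Bochner_Integration.integral_add integrable_mult_right int c integrable_lborel_uminus)
  also have "\<dots> = complex_of_real ((1 + \<theta>) / 2) * fourier c w + complex_of_real ((1 - \<theta>) / 2) * cnj (fourier c w)"
    by (simp only: integral_mult_right_zero refl) (simp only: fourier_def)
  also have "\<dots> = complex_of_real (Re (fourier c w)) + \<i> * complex_of_real \<theta> * complex_of_real (Im (fourier c w))"
    by (rule complex_eqI) (simp_all add: field_simps)
  finally show ?thesis .
qed

text \<open>Third-order densities are determined only almost everywhere, so their properties are
  claimed for every density of N \<theta>; the existence clause keeps these claims from holding
  vacuously.\<close>

theorem proposition2p2:
  fixes P :: "'p measure" and C :: "'p \<Rightarrow> real measure"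
    and M :: "'a measure" and \<nu> :: real
    and U :: "nat \<Rightarrow> 'a \<Rightarrow> real"
    and K :: "nat \<Rightarrow> 'a \<Rightarrow> real measure"
    and S :: "real \<Rightarrow> nat \<Rightarrow> 'a \<Rightarrow> real"
    and N :: "real \<Rightarrow> 'a \<Rightarrow> real measure"
  assumes P: "prob_space P"
    and C: "C \<in> measurable P cluster_algebra"
    and C_zero: "AE \<omega> in P. emeasure (C \<omega>) {0} = 1"
    and C_supp: "AE \<omega> in P. emeasure (C \<omega>) {..<0} = 0"
    and C_moment: "integrable P (\<lambda>\<omega>. measure (C \<omega>) UNIV ^ 3)"
    and \<nu>: "0 < \<nu>"
    and M: "prob_space M"
    and U: "poisson_points M \<nu> U"
    and K_indep: "prob_space.indep_vars M (\<lambda>_. cluster_algebra) K UNIV"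
    and K_law: "\<And>j. distr M cluster_algebra (K j) = distr P cluster_algebra C"
    and U_K_indep: "indep_elements M (PiM UNIV (\<lambda>_. borel)) (\<lambda>\<omega> j. U j \<omega>)
                      (PiM UNIV (\<lambda>_. cluster_algebra)) (\<lambda>\<omega> j. K j \<omega>)"
    and S_indep: "\<And>\<theta>. \<theta> \<in> {-1..1} \<Longrightarrow> prob_space.indep_vars M (\<lambda>_. borel) (S \<theta>) UNIV"
    and S_plus: "\<And>\<theta> j. \<theta> \<in> {-1..1} \<Longrightarrow> measure M {\<omega> \<in> space M. S \<theta> j \<omega> = 1} = (1 + \<theta>) / 2"
    and S_minus: "\<And>\<theta> j. \<theta> \<in> {-1..1} \<Longrightarrow> measure M {\<omega> \<in> space M. S \<theta> j \<omega> = - 1} = (1 - \<theta>) / 2"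
    and S_UK_indep: "\<And>\<theta>. \<theta> \<in> {-1..1} \<Longrightarrow>
                      indep_elements M
                        (PiM UNIV (\<lambda>_. borel) \<Otimes>\<^sub>M PiM UNIV (\<lambda>_. cluster_algebra))
                        (\<lambda>\<omega>. (\<lambda>j. U j \<omega>, \<lambda>j. K j \<omega>))
                        (PiM UNIV (\<lambda>_. borel)) (\<lambda>\<omega> j. S \<theta> j \<omega>)"
    and N: "\<And>\<theta>. N \<theta> = cluster_process U K (S \<theta>)"
  shows
    "(\<forall>\<theta>\<in>{-1..1}. point_process M (N \<theta>) \<and> stationary M (N \<theta>)) \<and>
     (\<forall>\<theta>\<in>{-1..1}. has_intensity M (N \<theta>) (\<nu> * (\<integral>\<omega>. measure (C \<omega>) UNIV \<partial>P))) \<and>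
     (\<exists>\<kappa>. \<forall>\<theta>\<in>{-1..1}. reduced_cumulant2 M (N \<theta>) \<kappa>) \<and>
     (\<forall>\<theta>\<in>{-1..1}. bartlett_spectrum M (N \<theta>)
        (\<lambda>w. complex_of_real (\<nu> * (\<integral>\<omega>. (cmod (fourier_measure (C \<omega>) w))\<^sup>2 \<partial>P)))) \<and>
     same_law M (N (-1)) (\<lambda>\<omega>. flip (-1) (N 1 \<omega>)) \<and>
     reversible M (N 0) \<and>
     (\<forall>c\<^sub>1. reduced_cumulant_density3 M (N 1) c\<^sub>1 \<and> integrable lborel c\<^sub>1 \<longrightarrow>
        (\<forall>\<theta>\<in>{-1..1}. \<exists>c. reduced_cumulant_density3 M (N \<theta>) c) \<and>
        (\<forall>c. reduced_cumulant_density3 M (N (-1)) c \<longrightarrow> (AE \<tau> in lborel. c \<tau> = c\<^sub>1 (- \<tau>))) \<and>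
        (\<forall>\<theta>\<in>{-1..1}. \<forall>c. reduced_cumulant_density3 M (N \<theta>) c \<longrightarrow>
           (let c_even = (\<lambda>\<tau>. 1/2 * (c\<^sub>1 \<tau> + c\<^sub>1 (- \<tau>)));
                c_odd = (\<lambda>\<tau>. 1/2 * (c\<^sub>1 \<tau> - c\<^sub>1 (- \<tau>)))
            in AE \<tau> in lborel. c \<tau> = c_even \<tau> + \<theta> * c_odd \<tau>) \<and>
           (\<forall>w. fourier c w =
              complex_of_real (Re (fourier c\<^sub>1 w)) +
              \<i> * complex_of_real \<theta> * complex_of_real (Im (fourier c\<^sub>1 w)))))"
proof -
  interpret P: prob_space P by fact
  interpret M: prob_space M by fact
  have counting: "finite_simple_counting (C \<omega>)" if "\<omega> \<in> space P" for \<omega>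
    using measurable_space[OF C that] by (simp add: space_cluster_algebra)
  have size: "emeasure (C \<omega>) UNIV ^ k \<le> ennreal (measure (C \<omega>) UNIV ^ 3)"
    if "\<omega> \<in> space P" "k \<in> {1, 2}" for \<omega> and k :: nat
  proof -
    define n where "n = card (atoms (C \<omega>))"
    have n: "emeasure (C \<omega>) UNIV = of_nat n"
      using emeasure_UNIV_finite_simple_counting[OF counting[OF that(1)]] by (simp add: n_def)
    \<comment> \<open>Cluster sizes are natural numbers, so lower powers are bounded by the cube
      without an additive constant; for n = 0 this uses that k is positive.\<close>
    have "n ^ k \<le> n ^ 3" using that(2) by (cases "n = 0") (auto intro!: power_increasing)
    then have "real n ^ k \<le> real n ^ 3" by (metis of_nat_le_iff of_nat_power)
    then have "ennreal (real n ^ k) \<le> ennreal (real n ^ 3)" by (rule ennreal_leI)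
    then show ?thesis by (simp add: n measure_def ennreal_of_nat_eq_real_of_nat ennreal_power)
  qed
  have moments: "(\<integral>\<^sup>+\<omega>. emeasure (C \<omega>) UNIV ^ k \<partial>P) < \<top>" if "k \<in> {1, 2}" for k :: nat
  proof -
    have "(\<integral>\<^sup>+\<omega>. emeasure (C \<omega>) UNIV ^ k \<partial>P) \<le> (\<integral>\<^sup>+\<omega>. ennreal (measure (C \<omega>) UNIV ^ 3) \<partial>P)"
      using that by (intro nn_integral_mono size)
    also have "\<dots> < \<top>" using C_moment by (simp add: integrable_iff_bounded)
    finally show ?thesis .
  qed
  have model: "cluster_model_square M \<nu> U P C K (S \<theta>) \<theta>" if "\<theta> \<in> {-1..1}" for \<theta>
    using \<nu> U C K_indep K_law U_K_indep that S_indep[OF that] S_plus[OF that] S_minus[OF that] S_UK_indep[OF that]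
      moments[of 1] moments[of 2]
    by unfold_locales simp_all
  have mean: "cluster_model_mean M \<nu> U P C K (S \<theta>) \<theta>" if "\<theta> \<in> {-1..1}" for \<theta>
    using model[OF that] by (simp add: cluster_model_square_def)
  interpret N1: cluster_model_square M \<nu> U P C K "S 1" 1 by (rule model) simp
  interpret Nm1: cluster_model_square M \<nu> U P C K "S (-1)" "-1" by (rule model) simp
  interpret N0: cluster_model_square M \<nu> U P C K "S 0" 0 by (rule model) simp
  have basic: "point_process M (N \<theta>) \<and> stationary M (N \<theta>) \<and>
      has_intensity M (N \<theta>) (\<nu> * (\<integral>\<omega>. measure (C \<omega>) UNIV \<partial>P)) \<and>
      reduced_cumulant2 M (N \<theta>) (second_cumulant \<nu> P C, null_measure borel) \<and>
      bartlett_spectrum M (N \<theta>) (\<lambda>w. complex_of_real (\<nu> * (\<integral>\<omega>. (cmod (fourier_measure (C \<omega>) w))\<^sup>2 \<partial>P)))"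
    if "\<theta> \<in> {-1..1}" for \<theta>
  proof -
    interpret X: cluster_model_square M \<nu> U P C K "S \<theta>" \<theta> by (rule model[OF that])
    show ?thesis
      unfolding N using X.point_process_N[OF X.finite_mean] X.stationary_N X.has_intensity_N
        X.reduced_cumulant2_N X.bartlett_spectrum_N by blast
  qed
  have flip_laplace: "(\<integral>\<^sup>+\<omega>. eneg (\<integral>\<^sup>+x. g x \<partial>flip (- 1) (cluster_process U K T \<omega>)) \<partial>M) =
      (\<integral>\<^sup>+\<omega>. eneg (\<integral>\<^sup>+x. g (- x) \<partial>cluster_process U K T \<omega>) \<partial>M)"
    if "g \<in> borel_measurable borel" for g T
    using that by (simp add: nn_integral_flip cluster_process_def)
  \<comment> \<open>For \<theta> = -1 only the reflected rate is left, for \<theta> = 1 only the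
    unreflected one; evaluated at g and at the reflected g respectively, they coincide.\<close>
  have flip_law: "same_law M (N (-1)) (\<lambda>\<omega>. flip (-1) (N 1 \<omega>))"
    unfolding N
  proof (rule same_law_laplaceI[OF M Nm1.measurable_N measurable_compose[OF N1.measurable_N measurable_flip]])
    fix g :: "real \<Rightarrow> ennreal" assume g [measurable]: "g \<in> borel_measurable borel"
    show "(\<integral>\<^sup>+\<omega>. eneg (\<integral>\<^sup>+x. g x \<partial>cluster_process U K (S (-1)) \<omega>) \<partial>M) =
        (\<integral>\<^sup>+\<omega>. eneg (\<integral>\<^sup>+x. g x \<partial>flip (- 1) (cluster_process U K (S 1) \<omega>)) \<partial>M)"
      unfolding flip_laplace[OF g] by (simp add: Nm1.laplace_N N1.laplace_N)
  qed
  \<comment> \<open>For \<theta> = 0 both rates have weight 1/2, and reflecting g merely exchanges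
    them.\<close>
  have reversible: "reversible M (N 0)"
    unfolding N reversible_def
  proof (rule same_law_laplaceI[OF M N0.measurable_N measurable_compose[OF N0.measurable_N measurable_flip]])
    fix g :: "real \<Rightarrow> ennreal" assume g [measurable]: "g \<in> borel_measurable borel"
    show "(\<integral>\<^sup>+\<omega>. eneg (\<integral>\<^sup>+x. g x \<partial>cluster_process U K (S 0) \<omega>) \<partial>M) =
        (\<integral>\<^sup>+\<omega>. eneg (\<integral>\<^sup>+x. g x \<partial>flip (- 1) (cluster_process U K (S 0) \<omega>)) \<partial>M)"
      unfolding flip_laplace[OF g] by (simp add: N0.laplace_N add.commute)
  qed
  have third: "(\<forall>\<theta>\<in>{-1..1}. \<exists>c. reduced_cumulant_density3 M (N \<theta>) c) \<and>
        (\<forall>c. reduced_cumulant_density3 M (N (-1)) c \<longrightarrow> (AE \<tau> in lborel. c \<tau> = c\<^sub>1 (- \<tau>))) \<and>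
        (\<forall>\<theta>\<in>{-1..1}. \<forall>c. reduced_cumulant_density3 M (N \<theta>) c \<longrightarrow>
           (let c_even = (\<lambda>\<tau>. 1/2 * (c\<^sub>1 \<tau> + c\<^sub>1 (- \<tau>)));
                c_odd = (\<lambda>\<tau>. 1/2 * (c\<^sub>1 \<tau> - c\<^sub>1 (- \<tau>)))
            in AE \<tau> in lborel. c \<tau> = c_even \<tau> + \<theta> * c_odd \<tau>) \<and>
           (\<forall>w. fourier c w =
              complex_of_real (Re (fourier c\<^sub>1 w)) +
              \<i> * complex_of_real \<theta> * complex_of_real (Im (fourier c\<^sub>1 w))))"
    if c1: "reduced_cumulant_density3 M (N 1) c\<^sub>1" "integrable lborel c\<^sub>1" for c\<^sub>1
  proof -
    have mix: "reduced_cumulant_density3 M (N \<theta>) (\<lambda>\<tau>. (1 + \<theta>) / 2 * c\<^sub>1 \<tau> + (1 - \<theta>) / 2 * c\<^sub>1 (- \<tau>))"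
      if \<theta>: "\<theta> \<in> {-1..1}" for \<theta>
      using reduced_cumulant_density3_mixture[OF mean[OF \<theta>] N1.cluster_model_mean_axioms] c1 unfolding N by blast
    have ae: "AE \<tau> in lborel. c \<tau> = (1 + \<theta>) / 2 * c\<^sub>1 \<tau> + (1 - \<theta>) / 2 * c\<^sub>1 (- \<tau>)"
      if "\<theta> \<in> {-1..1}" "reduced_cumulant_density3 M (N \<theta>) c" for \<theta> c
      by (rule reduced_cumulant_density3_unique[OF that(2) mix[OF that(1)]])
    show ?thesis
      unfolding Let_def
    proof (intro conjI ballI allI impI)
      show "\<exists>c. reduced_cumulant_density3 M (N \<theta>) c" if "\<theta> \<in> {-1..1}" for \<theta>
        using mix[OF that] by blast
      \<comment> \<open>At \<theta> = -1 the weights are 0 and 1, so the mixture is the reflected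
        density.\<close>
      show "AE \<tau> in lborel. c \<tau> = c\<^sub>1 (- \<tau>)" if "reduced_cumulant_density3 M (N (-1)) c" for c
        using ae[OF _ that] by simp
      fix \<theta> :: real and c assume \<theta>: "\<theta> \<in> {-1..1}" and c: "reduced_cumulant_density3 M (N \<theta>) c"
      show "AE \<tau> in lborel. c \<tau> = 1/2 * (c\<^sub>1 \<tau> + c\<^sub>1 (- \<tau>)) + \<theta> * (1/2 * (c\<^sub>1 \<tau> - c\<^sub>1 (- \<tau>)))"
        using ae[OF \<theta> c] by eventually_elim (simp add: field_simps)
      have "c \<in> borel_measurable borel" using c by (simp add: reduced_cumulant_density3_def)
      then show "fourier c w = complex_of_real (Re (fourier c\<^sub>1 w)) +
          \<i> * complex_of_real \<theta> * complex_of_real (Im (fourier c\<^sub>1 w))" for w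
        by (rule fourier_reflection_mixture[OF c1(2) _ ae[OF \<theta> c]])
    qed
  qed
  show ?thesis
    using basic flip_law reversible third by blast
qed

end
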